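(* Let $(G,H)$ be a separable face instance of multicommodity flow that satisfies the cut condition. Then $(3G,H)$ is feasible; i.e., the flow-cut gap of $(G,H)$ is at most $3$.
   Context: $G=(V,E)$ is a planar graph with fixed embedding and capacities $c:E\to\mathbb{Z}_{\ge0}$; $H$ is a demand multigraph on $V$ with each edge of demand $1$. $(G,H)$ is feasible if there is an assignment of nonnegative reals to paths in $G$ so that each demand edge $uv$ receives total value $1$ on $u$–$v$ paths and each supply edge $e$ is used by total value at most $c(e)$. $\delta_G(S)$ is total capacity of edges leaving $S$, $\delta_H(S)$ the number of demand edges leaving $S$; the cut condition is $\delta_G(S)\ge\delta_H(S)$ for all $S\subseteq V$. $kG$ denotes $G$ with capacities multiplied by $k$. A face instance is one where for every demand edge $uv$ there is a face containing both $u$ and $v$; each demand is associated with such a face $F$, giving the demand set $H_F$. Faces are identified with their bounding cycles. The demands on $F$ are separable if there is a contiguous segment $S$ of the cycle $F$ such that every $uv\in H_F$ has exactly one endpoint in $S$. A separable face instance is a face instance in which the demands associated with every face are separable. *)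

theory Defs
  imports
    Complex_Main
    "HOL-Combinatorics.Orbits"
    "Graph_Theory.Graph_Theory"
    "Graph_Theory.Bidirected_Digraph"
begin

section \<open>Plane graphs\<close>

text \<open>
  An undirected (multi)graph is a bidirected digraph: every edge is a pair \<open>{a, arev a}\<close> of
  opposite arcs. An embedding is a rotation system: \<open>rot\<close> permutes cyclically the arcs leaving each
  vertex. The facial walk through an arc \<open>a\<close> continues with \<open>rot (arev a)\<close>, which leaves the head
  of \<open>a\<close>, so the faces are the orbits of \<open>rot \<circ> arev\<close>, each in its cyclic order.
\<close>

definition face_succ :: "('b \<Rightarrow> 'b) \<Rightarrow> ('b \<Rightarrow> 'b) \<Rightarrow> 'b \<Rightarrow> 'b" where
  "face_succ arev rot = rot \<circ> arev"

definition faces :: "('a, 'b) pre_digraph \<Rightarrow> ('b \<Rightarrow> 'b) \<Rightarrow> ('b \<Rightarrow> 'b) \<Rightarrow> 'b set set" where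
  "faces G arev rot = orbit (face_succ arev rot) ` arcs G"

definition face_verts :: "('a, 'b) pre_digraph \<Rightarrow> 'b set \<Rightarrow> 'a set" where
  "face_verts G F = tail G ` F"

definition isolated_verts :: "('a, 'b) pre_digraph \<Rightarrow> 'a set" where
  "isolated_verts G = {v \<in> verts G. out_arcs G v = {}}"

text \<open>
  The embedding is planar iff every connected component satisfies Euler's formula
  \<open>V - E + F = 2\<close>. As \<open>V - E + F \<le> 2\<close> holds for each component of any rotation system, it
  suffices to require the sum of these equations over all components. A component consisting of an
  isolated vertex has one face, which is not an orbit of arcs and is counted separately.
\<close>

locale plane_graph = fin_digraph G + bidirected_digraph G arev
  for G :: "('a, 'b) pre_digraph" and arev :: "'b \<Rightarrow> 'b" +
  fixes rot :: "'b \<Rightarrow> 'b"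
  assumes rot_permutes: "rot permutes arcs G"
    and rot_cyclic: "\<And>v. v \<in> verts G \<Longrightarrow> out_arcs G v \<noteq> {} \<Longrightarrow> cyclic_on rot (out_arcs G v)"
    and euler_formula:
      "int (card (verts G)) - int (card (arcs G) div 2)
         + int (card (faces G arev rot) + card (isolated_verts G))
       = 2 * int (card (pre_digraph.sccs_verts G))"


section \<open>Multicommodity flow\<close>

text \<open>
  The demand multigraph \<open>H\<close> has one arc for each demand edge; its orientation is arbitrary and
  carries no meaning. An edge of \<open>G\<close> leaving \<open>S\<close> is counted through its unique arc with tail
  in \<open>S\<close>.
\<close>

definition supply_cut :: "('a, 'b) pre_digraph \<Rightarrow> ('b \<Rightarrow> nat) \<Rightarrow> 'a set \<Rightarrow> nat" where
  "supply_cut G c S = (\<Sum>a | a \<in> arcs G \<and> tail G a \<in> S \<and> head G a \<notin> S. c a)"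

definition demand_cut :: "('a, 'd) pre_digraph \<Rightarrow> 'a set \<Rightarrow> nat" where
  "demand_cut H S = card {d \<in> arcs H. (tail H d \<in> S) \<noteq> (head H d \<in> S)}"

definition cut_condition ::
    "('a, 'b) pre_digraph \<Rightarrow> ('b \<Rightarrow> nat) \<Rightarrow> ('a, 'd) pre_digraph \<Rightarrow> bool" where
  "cut_condition G c H \<longleftrightarrow> (\<forall>S \<subseteq> verts G. demand_cut H S \<le> supply_cut G c S)"

definition demand_paths ::
    "('a, 'b) pre_digraph \<Rightarrow> ('a, 'd) pre_digraph \<Rightarrow> 'd \<Rightarrow> 'b list set" where
  "demand_paths G H d = {p. pre_digraph.apath G (tail H d) p (head H d)}"

definition feasible ::
    "('a, 'b) pre_digraph \<Rightarrow> ('b \<Rightarrow> 'b) \<Rightarrow> ('b \<Rightarrow> real) \<Rightarrow> ('a, 'd) pre_digraph \<Rightarrow> bool" where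
  "feasible G arev cap H \<longleftrightarrow>
     (\<exists>f :: 'd \<Rightarrow> 'b list \<Rightarrow> real.
        (\<forall>d \<in> arcs H. \<forall>p \<in> demand_paths G H d. 0 \<le> f d p) \<and>
        (\<forall>d \<in> arcs H. (\<Sum>p \<in> demand_paths G H d. f d p) = 1) \<and>
        (\<forall>a \<in> arcs G.
           (\<Sum>d \<in> arcs H. \<Sum>p | p \<in> demand_paths G H d \<and> (a \<in> set p \<or> arev a \<in> set p). f d p)
             \<le> cap a))"

definition scaled_capacity :: "real \<Rightarrow> ('b \<Rightarrow> nat) \<Rightarrow> 'b \<Rightarrow> real" where
  "scaled_capacity k c a = k * real (c a)"

text \<open>Meaningful only for instances satisfying the cut condition.\<close>

definition flow_cut_gap ::
    "('a, 'b) pre_digraph \<Rightarrow> ('b \<Rightarrow> 'b) \<Rightarrow> ('b \<Rightarrow> nat) \<Rightarrow> ('a, 'd) pre_digraph \<Rightarrow> real" where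
  "flow_cut_gap G arev c H = Inf {k. 1 \<le> k \<and> feasible G arev (scaled_capacity k c) H}"


section \<open>Separable face instances\<close>

text \<open>
  In the following, \<open>\<Phi> d\<close> is the face with which the demand edge \<open>d\<close> is associated.
\<close>

definition face_instance ::
    "('a, 'b) pre_digraph \<Rightarrow> ('b \<Rightarrow> 'b) \<Rightarrow> ('b \<Rightarrow> 'b) \<Rightarrow> ('a, 'd) pre_digraph \<Rightarrow> ('d \<Rightarrow> 'b set) \<Rightarrow> bool"
  where
  "face_instance G arev rot H \<Phi> \<longleftrightarrow>
     (\<forall>d \<in> arcs H. \<Phi> d \<in> faces G arev rot \<and>
        tail H d \<in> face_verts G (\<Phi> d) \<and> head H d \<in> face_verts G (\<Phi> d))"

text \<open>
  A contiguous segment consists of the vertices at \<open>n\<close> consecutive positions of the facial walk,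
  starting from the tail of some arc \<open>a\<close> of the face.
\<close>

definition face_segment ::
    "('a, 'b) pre_digraph \<Rightarrow> ('b \<Rightarrow> 'b) \<Rightarrow> ('b \<Rightarrow> 'b) \<Rightarrow> 'b set \<Rightarrow> 'a set \<Rightarrow> bool" where
  "face_segment G arev rot F S \<longleftrightarrow>
     (\<exists>a \<in> F. \<exists>n. S = (\<lambda>i. tail G ((face_succ arev rot ^^ i) a)) ` {..<n})"

definition separable_on ::
    "('a, 'b) pre_digraph \<Rightarrow> ('b \<Rightarrow> 'b) \<Rightarrow> ('b \<Rightarrow> 'b) \<Rightarrow> ('a, 'd) pre_digraph \<Rightarrow> ('d \<Rightarrow> 'b set)
      \<Rightarrow> 'b set \<Rightarrow> bool" where
  "separable_on G arev rot H \<Phi> F \<longleftrightarrow>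
     (\<exists>S. face_segment G arev rot F S \<and>
        (\<forall>d \<in> arcs H. \<Phi> d = F \<longrightarrow> (tail H d \<in> S) \<noteq> (head H d \<in> S)))"

definition separable_face_instance ::
    "('a, 'b) pre_digraph \<Rightarrow> ('b \<Rightarrow> 'b) \<Rightarrow> ('b \<Rightarrow> 'b) \<Rightarrow> ('a, 'd) pre_digraph \<Rightarrow> ('d \<Rightarrow> 'b set) \<Rightarrow> bool"
  where
  "separable_face_instance G arev rot H \<Phi> \<longleftrightarrow>
     face_instance G arev rot H \<Phi> \<and> (\<forall>F \<in> faces G arev rot. separable_on G arev rot H \<Phi> F)"

end

theory Submission
  imports Defs
begin

text \<open>
  By linear programming duality it suffices to bound the sum of the distances of the demand pairs by
  \<open>3 \<Sum> c l\<close>, for every length function \<open>l\<close>. For demands that can be drawn inside their faces without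
  crossings, the bound \<open>\<Sum> c l\<close> is Seymour's theorem on planar \<open>G + H\<close>: in the planar dual, the cut
  condition says that the weights \<open>c\<close> (on \<open>G\<close>) and \<open>-1\<close> (on \<open>H\<close>) are conservative, and the distances
  form a vector in which no edge of a cut exceeds the sum of the others; such a vector has a
  nonnegative product with every conservative weighting.

  The demands on a face \<open>F\<close>, joining sources in a segment to sinks in its complement, are replaced by
  two non-crossing demand sets. The first matches the sources with the sinks in nested order;
  the second joins sources to sources and sinks to sinks. On every pair of gaps of \<open>F\<close>, the first
  set crosses at most as often as the original demands, the second at most twice as often, and both
  together at least as often. As distances on a face are nonnegative combinations of the
  metrics given by pairs of gaps (by the crossing inequality, which is the planar theorem again),
  the sum of the distances is at most \<open>(1 + 2) \<Sum> c l\<close>.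
\<close>

section \<open>Even sets, trails and circuits\<close>

text \<open>Euler's formula enters once: as a dimension count over the field with two elements, it
  identifies the even edge sets of the dual with the cuts of \<open>G\<close>. The rest of planarity
  is parity counting around vertices and faces.

  A circuit of the dual meets every face at most twice. Hence the cut condition is used only for
  cuts that cross each facial walk in no gap or in two, and demands on a face can be exchanged by
  comparing crossing counts on pairs of gaps.

  The obstacle is that the demands of a face may cross each other. Take one gap among the sources
  and one among the sinks; let a demands have source and sink before these gaps, and b demands have
  both after them. The demands cross this pair a + b times, the nested matching only |a - b| times.
  The shortage 2 min(a, b) is covered by heights of at least min(a, b) at each gap. Such heights can
  be kept at most a + b at each of the two gaps, and this is the factor 2.

  Seymour's theorem needs a parity condition, which is met by doubling all weights.\<close>

definition incidence :: "('e \<Rightarrow> 'v) \<Rightarrow> ('e \<Rightarrow> 'v) \<Rightarrow> 'e set \<Rightarrow> 'v \<Rightarrow> nat" where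
  "incidence s t Z v = (\<Sum>e\<in>Z. of_bool (s e = v) + of_bool (t e = v))"

definition even_set :: "('e \<Rightarrow> 'v) \<Rightarrow> ('e \<Rightarrow> 'v) \<Rightarrow> 'e set \<Rightarrow> bool" where
  "even_set s t Z \<longleftrightarrow> finite Z \<and> (\<forall>v. even (incidence s t Z v))"

definition cutset :: "('e \<Rightarrow> 'v) \<Rightarrow> ('e \<Rightarrow> 'v) \<Rightarrow> 'e set \<Rightarrow> 'v set \<Rightarrow> 'e set" where
  "cutset s t E S = {e \<in> E. (s e \<in> S) \<noteq> (t e \<in> S)}"

definition circuit :: "('e \<Rightarrow> 'v) \<Rightarrow> ('e \<Rightarrow> 'v) \<Rightarrow> 'e set \<Rightarrow> bool" where
  "circuit s t C \<longleftrightarrow> even_set s t C \<and> C \<noteq> {} \<and>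
     (\<forall>D. D \<subseteq> C \<longrightarrow> D \<noteq> {} \<longrightarrow> even_set s t D \<longrightarrow> D = C)"

fun walk :: "('e \<Rightarrow> 'v) \<Rightarrow> ('e \<Rightarrow> 'v) \<Rightarrow> 'v \<Rightarrow> 'e list \<Rightarrow> 'v \<Rightarrow> bool" where
  "walk s t u [] v \<longleftrightarrow> u = v"
| "walk s t u (e # es) v \<longleftrightarrow>
     (s e = u \<and> walk s t (t e) es v) \<or> (t e = u \<and> walk s t (s e) es v)"

lemma walk_append: "walk s t u (p @ q) v \<longleftrightarrow> (\<exists>x. walk s t u p x \<and> walk s t x q v)"
  by (induction p arbitrary: u) auto

lemma walk_rev: "walk s t u p v \<Longrightarrow> walk s t v (rev p) u"
  by (induction p arbitrary: u) (auto simp: walk_append)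

lemma incidence_insert:
  "finite Z \<Longrightarrow> e \<notin> Z \<Longrightarrow>
    incidence s t (insert e Z) v = of_bool (s e = v) + of_bool (t e = v) + incidence s t Z v"
  by (simp add: incidence_def)

lemma incidence_Un:
  "finite Y \<Longrightarrow> finite Z \<Longrightarrow> Y \<inter> Z = {} \<Longrightarrow>
    incidence s t (Y \<union> Z) v = incidence s t Y v + incidence s t Z v"
  unfolding incidence_def by (rule sum.union_disjoint)

lemma incidence_subset_Diff:
  assumes "finite Z" "Y \<subseteq> Z"
  shows "incidence s t Z v = incidence s t Y v + incidence s t (Z - Y) v"
proof -
  have "Z = Y \<union> (Z - Y)" using assms by auto
  then show ?thesis using incidence_Un[of Y "Z - Y" s t v] assms
    by (metis Diff_disjoint finite_Diff finite_subset)
qed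

lemma even_set_Diff:
  assumes "even_set s t Z" "even_set s t Y" "Y \<subseteq> Z"
  shows "even_set s t (Z - Y)"
  using assms incidence_subset_Diff[of Z Y s t] unfolding even_set_def
  by (metis even_add finite_Diff)

lemma even_incidence_trail:
  assumes "walk s t u p v" "distinct p"
  shows "even (incidence s t (set p) x) \<longleftrightarrow> ((x = u) \<longleftrightarrow> (x = v))"
  using assms
proof (induction p arbitrary: u)
  case Nil
  then show ?case by (auto simp: incidence_def)
next
  case (Cons e p)
  have inc: "incidence s t (set (e # p)) x
      = of_bool (s e = x) + of_bool (t e = x) + incidence s t (set p) x"
    using Cons.prems by (simp add: incidence_insert)
  from Cons.prems(1) consider "s e = u" "walk s t (t e) p v" | "t e = u" "walk s t (s e) p v"
    by auto
  then show ?case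
  proof cases
    case 1
    have "even (incidence s t (set p) x) \<longleftrightarrow> ((x = t e) \<longleftrightarrow> (x = v))"
      using Cons.IH[OF 1(2)] Cons.prems by simp
    then show ?thesis unfolding inc using 1 by (auto simp: even_add)
  next
    case 2
    have "even (incidence s t (set p) x) \<longleftrightarrow> ((x = s e) \<longleftrightarrow> (x = v))"
      using Cons.IH[OF 2(2)] Cons.prems by simp
    then show ?thesis unfolding inc using 2 by (auto simp: even_add)
  qed
qed

lemma closed_trail_even:
  assumes "walk s t u p u" "distinct p"
  shows "even_set s t (set p)"
  using even_incidence_trail[OF assms] by (simp add: even_set_def)

lemma incidence_pos:
  assumes "incidence s t Z v \<noteq> 0"
  obtains e where "e \<in> Z" "s e = v \<or> t e = v"
proof -
  have "\<exists>e\<in>Z. s e = v \<or> t e = v"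
  proof (rule ccontr)
    assume "\<not> ?thesis"
    then have "incidence s t Z v = 0" by (auto simp: incidence_def)
    then show False using assms by simp
  qed
  then show ?thesis using that by blast
qed

lemma closed_trail_through:
  assumes Z: "even_set s t Z" and e: "e \<in> Z"
  shows "\<exists>p. walk s t (t e) p (s e) \<and> distinct (e # p) \<and> set p \<subseteq> Z"
proof -
  have fin: "finite Z" using Z by (simp add: even_set_def)
  define T where "T = {p. distinct (e # p) \<and> set (e # p) \<subseteq> Z \<and> (\<exists>v. walk s t (t e) p v)}"
  have "T \<subseteq> {p. set p \<subseteq> Z \<and> distinct p}" by (auto simp: T_def)
  then have finT: "finite T" using finite_subset_distinct[OF fin] finite_subset by blast
  have "[] \<in> T" using e by (auto simp: T_def)
  then have "Max (length ` T) \<in> length ` T" using finT by (intro Max_in) auto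
  then obtain p where p: "p \<in> T" "\<And>q. q \<in> T \<Longrightarrow> length q \<le> length p"
    using Max_ge[OF finite_imageI[OF finT, of length]] by auto
  from p(1) obtain v where v: "walk s t (t e) p v" by (auto simp: T_def)
  have d: "distinct (e # p)" and sub: "set (e # p) \<subseteq> Z" using p(1) by (auto simp: T_def)
  have "v = s e"
  proof (rule ccontr)
    assume ne: "v \<noteq> s e"
    have "walk s t (s e) (e # p) v" using v by simp
    then have "odd (incidence s t (set (e # p)) v)"
      using even_incidence_trail[OF _ d, of s t "s e" v v] ne by simp
    moreover have "even (incidence s t Z v)" using Z by (simp add: even_set_def)
    ultimately have "incidence s t (Z - set (e # p)) v \<noteq> 0"
      using incidence_subset_Diff[OF fin sub, of s t v] by (metis add.right_neutral)
    then obtain g where g: "g \<in> Z - set (e # p)" "s g = v \<or> t g = v"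
      by (rule incidence_pos)
    have "\<exists>x. walk s t (t e) (p @ [g]) x"
      using v g(2) by (auto simp: walk_append)
    then have "p @ [g] \<in> T" using g(1) d sub by (auto simp: T_def)
    from p(2)[OF this] show False by simp
  qed
  then show ?thesis using v d sub by auto
qed

lemma walk_split_at:
  assumes "walk s t u p v" "e \<in> set p" "s e = x \<or> t e = x"
  shows "\<exists>q r. p = q @ r \<and> walk s t u q x \<and> walk s t x r v"
proof -
  obtain q r where p: "p = q @ e # r" using assms(2) by (meson split_list)
  then obtain y z where yz: "walk s t u q y" "walk s t z r v" "{y,z} = {s e, t e}"
      "walk s t y [e] z"
    using assms(1) by (auto simp: walk_append)
  show ?thesis
  proof (cases "y = x")
    case True
    then show ?thesis using p yz assms(1) by (metis append_Cons append_Nil walk_append)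
  next
    case False
    then have "z = x" using yz(3) assms(3) by (metis doubleton_eq_iff)
    then have "walk s t u (q @ [e]) x" using yz by (auto simp: walk_append)
    then show ?thesis using p yz \<open>z = x\<close> by (metis append.assoc append_Cons append_Nil)
  qed
qed

lemma circuit_closed_trail:
  assumes C: "circuit s t C" and e: "e \<in> C"
  obtains p where "walk s t (t e) p (s e)" "distinct (e # p)" "set (e # p) = C"
proof -
  obtain p where p: "walk s t (t e) p (s e)" "distinct (e # p)" "set p \<subseteq> C"
    using closed_trail_through[of s t C e] C e by (auto simp: circuit_def)
  have "walk s t (s e) (e # p) (s e)" using p by simp
  then have "even_set s t (set (e # p))" by (rule closed_trail_even[OF _ p(2)])
  then have "set (e # p) = C" using C p(3) e unfolding circuit_def by (metis insert_subset list.simps(15) empty_not_insert)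
  then show ?thesis using that p by blast
qed

text \<open>A shortest nonempty closed trail at \<open>v\<close> inside \<open>C\<close> is an even
  set, so by minimality it is all of \<open>C\<close>. Being shortest, it returns to
  \<open>v\<close> only at its end, hence only its first and last edges touch
  \<open>v\<close>.\<close>

lemma circuit_incidence_le:
  assumes C: "circuit s t C"
  shows "incidence s t C v \<le> 2"
proof (cases "incidence s t C v = 0")
  case False
  then obtain e where e: "e \<in> C" "s e = v \<or> t e = v" by (rule incidence_pos)
  obtain p where p: "walk s t (t e) p (s e)" "distinct (e # p)" "set (e # p) = C"
    by (rule circuit_closed_trail[OF C e(1)])
  define P where "P q \<longleftrightarrow> q \<noteq> [] \<and> distinct q \<and> set q \<subseteq> C \<and> walk s t v q v" for q
  have "P (e # p) \<or> P (e # rev p)"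
  proof (cases "s e = v")
    case True
    then show ?thesis using p by (auto simp: P_def)
  next
    case False
    then have "walk s t v (e # rev p) v" using e p walk_rev[OF p(1)] by auto
    then show ?thesis using p by (auto simp: P_def)
  qed
  then obtain q where q: "P q" "\<And>r. P r \<Longrightarrow> length q \<le> length r"
    by (metis ex_has_least_nat)
  have qC: "set q = C"
    using C q(1) closed_trail_even[of s t v q] unfolding P_def circuit_def by auto
  from q(1) obtain g q' where gq: "q = g # q'" by (cases q) (auto simp: P_def)
  have rest: "s h \<noteq> v \<and> t h \<noteq> v" if h: "h \<in> set q'" "h \<noteq> last q" for h
  proof (rule ccontr)
    assume inc: "\<not> ?thesis"
    have "butlast q' @ [last q] = q'" using gq h by auto
    then have hb: "h \<in> set (butlast q')" using h by (metis Un_iff set_append empty_iff empty_set set_ConsD)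
    obtain y where y: "walk s t v [g] y" "walk s t y q' v"
      using q(1) gq by (auto simp: P_def)
    have "q' = butlast q' @ [last q']" using h by (metis append_butlast_last_id empty_iff empty_set)
    then obtain z where z: "walk s t y (butlast q') z" using y(2) by (metis walk_append)
    obtain a b where ab: "butlast q' = a @ b" "walk s t y a v"
      using walk_split_at[OF z hb, of v] inc by auto
    have "walk s t v (g # a) v" using y ab by auto
    moreover have "set (g # a) \<subseteq> C" "distinct (g # a)"
    proof -
      have "set a \<subseteq> set q'" using ab by (metis in_set_butlastD set_append Un_iff subsetI)
      then show "set (g # a) \<subseteq> C" using qC gq by auto
      have "distinct (butlast q')" using q(1) gq by (simp add: P_def distinct_butlast)
      then show "distinct (g # a)" using q(1) gq ab \<open>set a \<subseteq> set q'\<close> by (auto simp: P_def)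
    qed
    ultimately have "P (g # a)" by (simp add: P_def)
    from q(2)[OF this] have "length q' \<le> length a" using gq by simp
    moreover have "length (butlast q') < length q'" using h by (cases q') auto
    ultimately show False using ab by simp
  qed
  show ?thesis
  proof (cases "q' = []")
    case True
    then have "C = {g}" using qC gq by simp
    then show ?thesis by (simp add: incidence_def)
  next
    case False
    have ne: "g \<noteq> last q" using q(1) gq False by (auto simp: P_def)
    have nl: "s h \<noteq> v \<or> t h \<noteq> v" if "h \<in> C" for h
    proof (rule ccontr)
      assume "\<not> ?thesis"
      then have "P [h]" using that by (auto simp: P_def)
      from q(2)[OF this] show False using gq False by (cases q') auto
    qed
    have finC: "finite C" using C by (simp add: circuit_def even_set_def)
    have "incidence s t C v = (\<Sum>h\<in>{g, last q}. of_bool (s h = v) + of_bool (t h = v))"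
      unfolding incidence_def
    proof (rule sum.mono_neutral_right)
      show "{g, last q} \<subseteq> C" using qC gq by auto
      show "\<forall>i\<in>C - {g, last q}. of_bool (s i = v) + of_bool (t i = v) = (0::nat)"
        using rest qC gq by fastforce
    qed (rule finC)
    also have "\<dots> \<le> (\<Sum>h\<in>{g, last q}. 1)"
      by (rule sum_mono) (use nl qC gq in auto)
    also have "\<dots> = 2" using ne by simp
    finally show ?thesis .
  qed
qed simp

text \<open>A nonempty even subset of least size is a circuit, and splitting it off leaves an even
  set.\<close>

lemma even_set_circuit_induct:
  assumes "even_set s t Z" "P {}"
    and "\<And>C Y. circuit s t C \<Longrightarrow> C \<subseteq> Z \<Longrightarrow> Y \<subseteq> Z \<Longrightarrow> C \<inter> Y = {} \<Longrightarrow> P Y \<Longrightarrow> P (C \<union> Y)"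
  shows "P Z"
  using assms
proof (induction "card Z" arbitrary: Z rule: less_induct)
  case less
  show ?case
  proof (cases "Z = {}")
    case False
    define Q where "Q Y \<longleftrightarrow> Y \<subseteq> Z \<and> Y \<noteq> {} \<and> even_set s t Y" for Y
    have "Q Z" using False less.prems by (simp add: Q_def)
    then obtain C where C: "Q C" "\<And>Y. Q Y \<Longrightarrow> card C \<le> card Y" by (metis ex_has_least_nat)
    have fin: "finite Z" using less.prems by (simp add: even_set_def)
    have sub: "C \<subseteq> Z" and ne: "C \<noteq> {}" and ev: "even_set s t C" using C(1) by (auto simp: Q_def)
    have circ: "circuit s t C" unfolding circuit_def
    proof (intro conjI allI impI ev ne)
      fix D assume D: "D \<subseteq> C" "D \<noteq> {}" "even_set s t D"
      then have "Q D" using sub by (auto simp: Q_def)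
      from C(2)[OF this] D(1) show "D = C"
        using sub fin by (metis card_seteq finite_subset)
    qed
    have "P (Z - C)"
    proof (rule less.hyps)
      show "card (Z - C) < card Z" using sub ne fin by (intro psubset_card_mono) auto
      show "even_set s t (Z - C)" using even_set_Diff less.prems(1) ev sub by blast
      show "P (D \<union> Y)" if "circuit s t D" "D \<subseteq> Z - C" "Y \<subseteq> Z - C" "D \<inter> Y = {}" "P Y" for D Y
        using less.prems(3)[OF that(1)] that by blast
    qed (rule less.prems(2))
    then have "P (C \<union> (Z - C))" using less.prems(3)[OF circ sub, of "Z - C"] by blast
    moreover have "C \<union> (Z - C) = Z" using sub by auto
    ultimately show ?thesis by simp
  qed (simp add: less.prems(2))
qed

lemma even_set_circuit_sum_nonneg:
  fixes f :: "'e \<Rightarrow> 'w::linordered_idom"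
  assumes Z: "even_set s t Z" and circ: "\<And>C. circuit s t C \<Longrightarrow> C \<subseteq> Z \<Longrightarrow> 0 \<le> sum f C"
  shows "0 \<le> sum f Z"
  using Z
proof (rule even_set_circuit_induct)
  fix C Y assume C: "circuit s t C" "C \<subseteq> Z" and Y: "Y \<subseteq> Z" "C \<inter> Y = {}" "0 \<le> sum f Y"
  have "finite Z" using Z by (simp add: even_set_def)
  then have "sum f (C \<union> Y) = sum f C + sum f Y"
    using C(2) Y by (intro sum.union_disjoint) (auto intro: finite_subset)
  then show "0 \<le> sum f (C \<union> Y)" using circ[OF C] Y(3) by simp
qed simp

text \<open>Handshake count: an edge inside \<open>S\<close> contributes 2, an edge of the cut
  contributes 1.\<close>

lemma even_sum_incidence:
  assumes fin: "finite Z" and "finite S"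
  shows "even (\<Sum>v\<in>S. incidence s t Z v) \<longleftrightarrow> even (card (cutset s t Z S))"
proof -
  have "(\<Sum>v\<in>S. incidence s t Z v) = (\<Sum>e\<in>Z. \<Sum>v\<in>S. of_bool (s e = v) + of_bool (t e = v))"
    unfolding incidence_def by (rule sum.swap)
  also have "\<dots> = (\<Sum>e\<in>Z. of_bool (s e \<in> S) + of_bool (t e \<in> S))"
    by (rule sum.cong) (use \<open>finite S\<close> in \<open>auto simp: sum.distrib of_bool_def\<close>)
  also have "\<dots> = (\<Sum>e\<in>Z. of_bool ((s e \<in> S) \<noteq> (t e \<in> S)) + 2 * of_bool (s e \<in> S \<and> t e \<in> S))"
    by (rule sum.cong) auto
  also have "\<dots> = card (cutset s t Z S) + 2 * (\<Sum>e\<in>Z. of_bool (s e \<in> S \<and> t e \<in> S))"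
    unfolding sum.distrib sum_distrib_left[symmetric]
    using fin by (simp add: cutset_def of_bool_def sum.If_cases Int_def)
  finally show ?thesis by simp
qed

lemma even_set_cutset:
  assumes Z: "even_set s t Z"
  shows "even (card (cutset s t Z S))"
proof -
  let ?S = "S \<inter> (s ` Z \<union> t ` Z)"
  have fin: "finite Z" using Z by (simp add: even_set_def)
  have "even (\<Sum>v\<in>?S. incidence s t Z v)"
    using Z by (intro dvd_sum) (auto simp: even_set_def)
  moreover have "cutset s t Z S = cutset s t Z ?S" by (auto simp: cutset_def)
  ultimately show ?thesis using even_sum_incidence[OF fin, of ?S s t] fin by simp
qed

section \<open>Conservative weights\<close>

lemma incidence_no_loops:
  assumes "finite Z" "\<And>e. e \<in> Z \<Longrightarrow> s e \<noteq> t e"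
  shows "incidence s t Z b = card (cutset s t Z {b})"
proof -
  have "incidence s t Z b = (\<Sum>e\<in>Z. of_bool (e \<in> cutset s t Z {b}))"
    unfolding incidence_def by (rule sum.cong) (use assms(2) in \<open>auto simp: cutset_def of_bool_def\<close>)
  also have "\<dots> = card (cutset s t Z {b})"
    using assms(1) by (simp add: of_bool_def sum.If_cases Int_def cutset_def)
  finally show ?thesis .
qed

text \<open>Contraction merges the parities at the two ends of \<open>e\<close>. In \<open>Z\<close>
  they are both even or both odd, and in the odd case adding \<open>e\<close> repairs both.\<close>

lemma contracted_even_set:
  assumes Z: "even_set (\<kappa> \<circ> s) (\<kappa> \<circ> t) Z" and e: "e \<notin> Z" "s e \<noteq> t e"
    and \<kappa>: "\<kappa> = (\<lambda>x. if x = t e then s e else x)"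
  shows "even_set s t Z \<or> even_set s t (insert e Z)"
proof -
  have fin: "finite Z" using Z by (simp add: even_set_def)
  have ev: "even (incidence (\<kappa> \<circ> s) (\<kappa> \<circ> t) Z v)" for v using Z by (simp add: even_set_def)
  have other: "incidence s t Z v = incidence (\<kappa> \<circ> s) (\<kappa> \<circ> t) Z v" if "v \<noteq> s e" "v \<noteq> t e" for v
    unfolding incidence_def by (rule sum.cong) (use that \<kappa> in \<open>auto simp: of_bool_def\<close>)
  have ends: "incidence s t Z (s e) + incidence s t Z (t e) = incidence (\<kappa> \<circ> s) (\<kappa> \<circ> t) Z (s e)"
    unfolding incidence_def sum.distrib[symmetric]
    by (rule sum.cong) (use e \<kappa> in \<open>auto simp: of_bool_def\<close>)
  show ?thesis
  proof (cases "even (incidence s t Z (s e))")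
    case True
    then have "even (incidence s t Z (t e))" using ends ev[of "s e"] by (metis even_add)
    then have "even_set s t Z" unfolding even_set_def using True fin other ev by metis
    then show ?thesis ..
  next
    case False
    then have o: "odd (incidence s t Z (t e))" using ends ev[of "s e"] by (metis even_add)
    have "even (incidence s t (insert e Z) v)" for v
      using False o other[of v] ev[of v] e by (auto simp: incidence_insert[OF fin e(1)])
    then show ?thesis using fin by (simp add: even_set_def)
  qed
qed

text \<open>
  The vectors \<open>p\<close> are dual to the conservative weightings \<open>w\<close> (Seymour). Unless an edge can be deleted or
  contracted, take a trail of minimum weight, shortest among these. All edges at its end \<open>b\<close> other than
  its last edge \<open>f\<close> have positive weight. Lowering their weights by 1 and raising that of \<open>f\<close> by 1 changes
  the product with \<open>p\<close> by an amount of known sign, and it keeps the weights conservative: a circuit of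
  weight 0 through \<open>b\<close> that avoids \<open>f\<close> would combine with the trail to a trail of smaller weight or
  to a negative closed trail. By the parity assumption all other circuits avoiding \<open>f\<close> have weight at least 2.
\<close>

theorem sum_of_circuits_dual:
  fixes w :: "'e \<Rightarrow> int" and p :: "'e \<Rightarrow> real"
  assumes "finite E"
    and "\<And>e. e \<in> E \<Longrightarrow> 0 \<le> p e"
    and "\<And>S f. f \<in> cutset s t E S \<Longrightarrow> p f \<le> sum p (cutset s t E S - {f})"
    and "\<And>Z. Z \<subseteq> E \<Longrightarrow> even_set s t Z \<Longrightarrow> 0 \<le> sum w Z \<and> even (sum w Z)"
  shows "0 \<le> (\<Sum>e\<in>E. real_of_int (w e) * p e)"
  using assms
proof (induction "nat (\<Sum>e\<in>E. \<bar>w e\<bar>) + card E" arbitrary: E w s t rule: less_induct)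
  case less
  note fin = less.prems(1) and pos = less.prems(2) and cut = less.prems(3) and cons = less.prems(4)
  consider (loop) e where "e \<in> E" "s e = t e"
    | (zero) e where "e \<in> E" "s e \<noteq> t e" "w e = 0"
    | (nonneg) "\<And>e. e \<in> E \<Longrightarrow> 0 \<le> w e"
    | (main) e0 where "\<And>e. e \<in> E \<Longrightarrow> s e \<noteq> t e" "\<And>e. e \<in> E \<Longrightarrow> w e \<noteq> 0" "e0 \<in> E" "w e0 < 0"
    by (metis linorder_not_less)
  then show ?case
  proof cases
    case loop
    have "even_set s t {e}" using loop by (auto simp: even_set_def incidence_def)
    then have we: "0 \<le> w e" using cons[of "{e}"] loop by simp
    have cuteq: "cutset s t (E - {e}) S = cutset s t E S" for S using loop by (auto simp: cutset_def)
    have "0 \<le> (\<Sum>e\<in>E - {e}. real_of_int (w e) * p e)"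
    proof (rule less.hyps[where s = s and t = t])
      have "(\<Sum>e\<in>E - {e}. \<bar>w e\<bar>) \<le> (\<Sum>e\<in>E. \<bar>w e\<bar>)" using fin by (intro sum_mono2) auto
      moreover have "card (E - {e}) < card E" using loop fin by (meson card_Diff1_less)
      ultimately show "nat (\<Sum>e\<in>E - {e}. \<bar>w e\<bar>) + card (E - {e}) < nat (\<Sum>e\<in>E. \<bar>w e\<bar>) + card E"
        by linarith
    qed (use fin pos cut cuteq in \<open>auto dest: cons[OF subset_trans[OF _ Diff_subset]]\<close>)
    moreover have "0 \<le> real_of_int (w e) * p e" using we pos loop by simp
    ultimately show ?thesis using fin loop by (simp add: sum.remove)
  next
    case zero
    \<comment> \<open>Contraction of \<open>e\<close>: even sets lift to even sets of the same
      weight because \<open>w e = 0\<close>, and cuts of the contracted graph are cuts of the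
      original one.\<close>
    define \<kappa> where "\<kappa> = (\<lambda>x. if x = t e then s e else x)"
    have "0 \<le> (\<Sum>e\<in>E - {e}. real_of_int (w e) * p e)"
    proof (rule less.hyps[where s = "\<kappa> \<circ> s" and t = "\<kappa> \<circ> t"])
      have "(\<Sum>e\<in>E - {e}. \<bar>w e\<bar>) \<le> (\<Sum>e\<in>E. \<bar>w e\<bar>)" using fin by (intro sum_mono2) auto
      moreover have "card (E - {e}) < card E" using zero fin by (meson card_Diff1_less)
      ultimately show "nat (\<Sum>e\<in>E - {e}. \<bar>w e\<bar>) + card (E - {e}) < nat (\<Sum>e\<in>E. \<bar>w e\<bar>) + card E"
        by linarith
    next
      fix S f
      have "cutset (\<kappa> \<circ> s) (\<kappa> \<circ> t) (E - {e}) S = cutset s t E (\<kappa> -` S)"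
        using zero(2) by (auto simp: cutset_def \<kappa>_def)
      then show "f \<in> cutset (\<kappa> \<circ> s) (\<kappa> \<circ> t) (E - {e}) S \<Longrightarrow>
          p f \<le> sum p (cutset (\<kappa> \<circ> s) (\<kappa> \<circ> t) (E - {e}) S - {f})"
        using cut by metis
    next
      fix Z assume Z: "Z \<subseteq> E - {e}" "even_set (\<kappa> \<circ> s) (\<kappa> \<circ> t) Z"
      then have "finite Z" using fin finite_subset by (auto simp: even_set_def)
      then have "sum w (insert e Z) = sum w Z" using Z zero by (subst sum.insert) auto
      moreover have "even_set s t Z \<or> even_set s t (insert e Z)"
        using contracted_even_set[OF Z(2) _ zero(2) \<kappa>_def] Z by auto
      ultimately show "0 \<le> sum w Z \<and> even (sum w Z)"
        using cons[of Z] cons[of "insert e Z"] Z zero by auto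
    qed (use fin pos in auto)
    then show ?thesis using fin zero by (simp add: sum.remove)
  next
    case nonneg
    then show ?thesis using pos by (intro sum_nonneg) auto
  next
    case main
    note noloop = main(1) and nonzero = main(2)
    define T where "T = {q. set q \<subseteq> E \<and> distinct q \<and> (\<exists>u v. walk s t u q v)}"
    have finT: "finite T" by (rule finite_subset[OF _ finite_subset_distinct[OF fin]]) (auto simp: T_def)
    \<comment> \<open>Lexicographic order by weight, then length: the factor exceeds the length of
      every trail.\<close>
    define key where "key q = (int (card E) + 1) * sum w (set q) + int (length q)" for q
    have "walk s t (s e0) [e0] (t e0)" by simp
    then have "\<exists>u v. walk s t u [e0] v" by blast
    then have e0T: "[e0] \<in> T" using main(3) unfolding T_def by (simp del: walk.simps)
    obtain R where RT: "R \<in> T" and Rmin: "\<And>q. q \<in> T \<Longrightarrow> key R \<le> key q"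
      using finT e0T by (metis (mono_tags, lifting) arg_min_if_finite(1) arg_min_if_finite(2) empty_iff linorder_not_less)
    have len: "length q \<le> card E" if "q \<in> T" for q
      using that fin by (metis (mono_tags, lifting) T_def card_mono distinct_card mem_Collect_eq)
    have wmin: "sum w (set R) \<le> sum w (set q)" if q: "q \<in> T" for q
    proof (rule ccontr)
      assume "\<not> ?thesis"
      then have "sum w (set q) + 1 \<le> sum w (set R)" by simp
      then have "(int (card E) + 1) * (sum w (set q) + 1) \<le> (int (card E) + 1) * sum w (set R)"
        by (intro mult_left_mono) auto
      then show False using Rmin[OF q] len[OF q] unfolding key_def by (simp add: algebra_simps)
    qed
    have lmin: "length R \<le> length q" if "q \<in> T" "sum w (set q) \<le> sum w (set R)" for q
      using Rmin[OF that(1)] wmin[OF that(1)] that(2) by (simp add: key_def)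
    have Rneg: "sum w (set R) < 0" using wmin[OF e0T] main(4) by simp
    obtain u b where ub: "walk s t u R b" using RT by (auto simp: T_def)
    have Rd: "distinct R" and RE: "set R \<subseteq> E" using RT by (auto simp: T_def)
    have closed: "0 \<le> sum w (set q)" if "walk s t x q x" "distinct q" "set q \<subseteq> E" for q x
      using cons closed_trail_even that by metis
    \<comment> \<open>A suffix of nonnegative weight could be dropped, leaving a shorter trail that
      is no heavier.\<close>
    have suffix_neg: "sum w (set r) < 0" if "R = q @ r" "r \<noteq> []" for q r
    proof (rule ccontr)
      assume "\<not> ?thesis"
      moreover have "sum w (set R) = sum w (set q) + sum w (set r)"
        using that(1) Rd by (simp add: sum.union_disjoint)
      moreover have "q \<in> T" using RT that ub by (auto simp: T_def walk_append)
      ultimately have "length R \<le> length q" using lmin by auto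
      then show False using that by simp
    qed
    have "R \<noteq> []" using Rneg by auto
    then obtain R' f where R': "R = R' @ [f]" by (metis append_butlast_last_id)
    then obtain a where a: "walk s t u R' a" "walk s t a [f] b" using ub by (auto simp: walk_append)
    have fE: "f \<in> E" using RE R' by auto
    have fneg: "w f < 0" using suffix_neg[of R' "[f]"] R' by simp
    have fb: "f \<in> cutset s t E {b}" using a(2) fE noloop[OF fE] by (auto simp: cutset_def)
    \<comment> \<open>A second edge of the trail at \<open>b\<close> would make some suffix of
      \<open>R\<close> closed. Closed trails are nonnegative, suffixes of \<open>R\<close> are
      negative.\<close>
    have only_f: "e = f" if e: "e \<in> set R" "s e = b \<or> t e = b" for e
    proof (rule ccontr)
      assume "e \<noteq> f"
      then have "e \<in> set R'" using e R' by auto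
      then obtain q r where qr: "R' = q @ r" "walk s t b r a"
        using walk_split_at[OF a(1) _ e(2)] by auto
      have "walk s t b (r @ [f]) b" using qr a by (metis walk_append)
      moreover have "distinct (r @ [f])" "set (r @ [f]) \<subseteq> E" using Rd RE R' qr by auto
      ultimately have "0 \<le> sum w (set (r @ [f]))" using closed by blast
      moreover have "sum w (set (r @ [f])) < 0" by (rule suffix_neg[of q]) (use R' qr in auto)
      ultimately show False by simp
    qed
    have star_pos: "0 < w g" if g: "g \<in> cutset s t E {b}" "g \<noteq> f" for g
    proof -
      have gE: "g \<in> E" and gb: "s g = b \<or> t g = b" using g by (auto simp: cutset_def)
      have gR: "g \<notin> set R" using only_f gb g by auto
      have "\<exists>v. walk s t u (R @ [g]) v" using ub gb by (auto simp: walk_append)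
      then have "R @ [g] \<in> T" using gR gE RT by (auto simp: T_def)
      then have "0 \<le> w g" using wmin[of "R @ [g]"] gR by simp
      then show ?thesis using nonzero[OF gE] by simp
    qed
    define B where "B = cutset s t E {b}"
    have finB: "finite B" and BE: "B \<subseteq> E" using fin by (auto simp: B_def cutset_def)
    define w' where "w' e = (if e = f then w e + 1 else if e \<in> B then w e - 1 else w e)" for e
    have w'_sum: "sum w' Z = sum w Z - int (card (Z \<inter> B)) + 2 * of_bool (f \<in> Z)" if "Z \<subseteq> E" for Z
    proof -
      have finZ: "finite Z" using that fin finite_subset by blast
      have "sum w' Z = (\<Sum>e\<in>Z. w e - of_bool (e \<in> B) + 2 * of_bool (e = f))"
        by (rule sum.cong) (use fb in \<open>auto simp: w'_def B_def\<close>)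
      also have "\<dots> = sum w Z - int (card (Z \<inter> B)) + 2 * of_bool (f \<in> Z)"
        unfolding sum.distrib sum_subtractf sum_distrib_left[symmetric]
        using finZ by (simp add: of_bool_def sum.If_cases Int_def)
      finally show ?thesis .
    qed
    have cardB: "card (Z \<inter> B) = incidence s t Z b" if "Z \<subseteq> E" for Z
    proof -
      have "finite Z" using that fin finite_subset by blast
      moreover have "Z \<inter> B = cutset s t Z {b}" using that by (auto simp: B_def cutset_def)
      ultimately show ?thesis using incidence_no_loops[of Z s t b] noloop that by (metis subset_iff)
    qed
    \<comment> \<open>A circuit meets the star \<open>B\<close> in zero or two edges. If
      \<open>f\<close> is one of them, the weight does not drop; otherwise it drops by at most 2, so
      by parity only weight 0 is critical.\<close>
    have circ: "0 \<le> sum w' C" if C: "circuit s t C" "C \<subseteq> E" for C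
    proof -
      have ev: "even_set s t C" using C by (simp add: circuit_def)
      have wC: "0 \<le> sum w C" "even (sum w C)" using cons[OF C(2) ev] by auto
      have cB: "card (C \<inter> B) \<le> 2" "even (card (C \<inter> B))"
        using cardB[OF C(2)] circuit_incidence_le[OF C(1), of b] ev by (auto simp: even_set_def)
      show ?thesis
      proof (cases "f \<in> C")
        case True
        then show ?thesis using w'_sum[OF C(2)] wC cB by simp
      next
        case fC: False
        show ?thesis
        proof (cases "C \<inter> B = {}")
          case True
          then show ?thesis using w'_sum[OF C(2)] wC fC by simp
        next
          case False
          then obtain g where g: "g \<in> C" "g \<in> B" by auto
          have gf: "g \<noteq> f" using g fC by auto
          obtain p0 where p0: "walk s t (t g) p0 (s g)" "distinct (g # p0)" "set (g # p0) = C"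
            by (rule circuit_closed_trail[OF C(1) g(1)])
          obtain y p where y: "walk s t b [g] y" "walk s t y p b" "distinct (g # p)" "set (g # p) = C"
          proof (cases "s g = b")
            case True
            then show ?thesis using that[of "t g" p0] p0 by auto
          next
            case False
            then have "t g = b" using g(2) by (auto simp: B_def cutset_def)
            then show ?thesis using that[of "s g" "rev p0"] p0 walk_rev[OF p0(1)] by auto
          qed
          have gE: "g \<in> E" using g C by auto
          have yb: "y \<noteq> b" using y(1) noloop[OF gE] by auto
          then have "p \<noteq> []" using y(2) by auto
          then obtain P g2 where P: "p = P @ [g2]" by (metis append_butlast_last_id)
          then obtain y2 where y2: "walk s t y P y2" "walk s t y2 [g2] b"
            using y(2) by (auto simp: walk_append)
          have g2: "g2 \<in> C" "g2 \<noteq> g" "g2 \<notin> set P" "g \<notin> set P" using y P by auto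
          have g2B: "g2 \<in> B" using y2(2) g2(1) C(2) noloop[of g2] by (auto simp: B_def cutset_def)
          have CB: "C \<inter> B = {g, g2}"
          proof -
            have "{g, g2} \<subseteq> C \<inter> B" using g g2 g2B by auto
            moreover have "card (C \<inter> B) \<le> card {g, g2}" using cB g2 by simp
            ultimately show ?thesis using finB by (metis card_seteq finite_Int)
          qed
          have PB: "s h \<noteq> b \<and> t h \<noteq> b" if h: "h \<in> set P" for h
          proof -
            have "h \<in> C" using h y P by auto
            moreover have "h \<notin> B" using h g2 CB \<open>h \<in> C\<close> by auto
            ultimately show ?thesis using noloop[of h] C(2) by (auto simp: B_def cutset_def)
          qed
          have gR: "g \<notin> set R" "g2 \<notin> set R"
            using only_f g2 g2B g gf fC by (auto simp: B_def cutset_def)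
          have wCsum: "sum w C = w g + sum w (set P) + w g2"
            using y(4)[symmetric] P g2 y(3) by (simp add: algebra_simps)
          have "sum w C \<noteq> 0"
          proof
            assume w0: "sum w C = 0"
            \<comment> \<open>\<open>P\<close> is the circuit without its two edges \<open>g\<close>
              and \<open>g2\<close> at \<open>b\<close>. \<open>Q r\<close> says that the suffix
              \<open>r\<close> of \<open>R\<close> starts at a vertex \<open>z\<close> of
              \<open>P\<close>.\<close>
            define Q where "Q r \<longleftrightarrow> (\<exists>q z P1 P2. R = q @ r \<and> walk s t u q z \<and> walk s t z r b \<and>
                P = P1 @ P2 \<and> walk s t y P1 z \<and> walk s t z P2 y2)" for r
            show False
            proof (cases "\<exists>r. Q r")
              case True
              then obtain r where r: "Q r" "\<And>r'. Q r' \<Longrightarrow> length r \<le> length r'"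
                by (metis ex_has_least_nat)
              from r(1) obtain q z P1 P2 where z: "R = q @ r" "walk s t u q z" "walk s t z r b"
                 "P = P1 @ P2" "walk s t y P1 z" "walk s t z P2 y2"
                unfolding Q_def by blast
              have disj: "set r \<inter> set P = {}"
              proof (rule ccontr)
                assume "set r \<inter> set P \<noteq> {}"
                then obtain h where h: "h \<in> set r" "h \<in> set P" by auto
                then obtain r1 r2 where r12: "r = r1 @ h # r2" by (meson split_list)
                then obtain z1 z' where z': "walk s t z r1 z1" "walk s t z1 [h] z'" "walk s t z' r2 b"
                  using z(3) by (auto simp: walk_append)
                have hz: "s h = z' \<or> t h = z'" using z'(2) by auto
                obtain P3 P4 where P34: "P = P3 @ P4" "walk s t y P3 z'" "walk s t z' P4 y2"
                  using walk_split_at[OF y2(1) h(2) hz] by blast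
                have "walk s t u (q @ r1 @ [h]) z'" using z(2) z' by (metis walk_append)
                moreover have "R = (q @ r1 @ [h]) @ r2" using z r12 by simp
                ultimately have "Q r2" unfolding Q_def using P34 z'(3) by blast
                from r(2)[OF this] show False using r12 by simp
              qed
              have zb: "z \<noteq> b"
              proof
                assume "z = b"
                then have "P1 \<noteq> []" using z(5) yb by auto
                then obtain P5 h where h: "P1 = P5 @ [h]" by (metis append_butlast_last_id)
                then have "s h = b \<or> t h = b" using z(5) \<open>z = b\<close> by (auto simp: walk_append)
                then show False using PB[of h] h z(4) by auto
              qed
              then have "r \<noteq> []" using z(3) by auto
              then have neg: "sum w (set r) < 0" using suffix_neg z(1) by blast
              have dP: "distinct P" "set P \<subseteq> E" and dr: "distinct r" "set r \<subseteq> E"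
                using y P Rd RE z(1) C(2) by auto
              have gr: "g \<notin> set r" "g2 \<notin> set r" using gR z(1) by auto
              \<comment> \<open>For the shortest such suffix, \<open>z\<close> divides the circuit
                into two arcs from \<open>z\<close> to \<open>b\<close>. Each arc closes up with
                \<open>r\<close>, and the two closed trails together weigh
                \<open>sum w C + 2 * sum w (set r)\<close>, which is negative.\<close>
              have "walk s t b ((g # P1) @ r) b" using y(1) z(5,3) by (auto simp: walk_append)
              then have "0 \<le> sum w (set ((g # P1) @ r))"
                by (rule closed) (use dP dr gr disj g2 z(4) gE in auto)
              moreover have "sum w (set ((g # P1) @ r)) = w g + sum w (set P1) + sum w (set r)"
                using dP dr gr disj g2 z(4) by (subst sum_list_distinct_conv_sum_set[symmetric])
                  (auto simp: sum_list_distinct_conv_sum_set)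
              moreover have "walk s t z (P2 @ [g2] @ rev r) z"
                using y2(2) z(6) walk_rev[OF z(3)] by (metis walk_append)
              then have "0 \<le> sum w (set (P2 @ [g2] @ rev r))"
                by (rule closed) (use dP dr gr disj g2 z(4) C(2) in auto)
              moreover have "sum w (set (P2 @ [g2] @ rev r)) = sum w (set P2) + w g2 + sum w (set r)"
                using dP dr gr disj g2 z(4) by (subst sum_list_distinct_conv_sum_set[symmetric])
                  (auto simp: sum_list_distinct_conv_sum_set)
              moreover have "sum w (set P) = sum w (set P1) + sum w (set P2)"
                using dP z(4) by (simp add: sum.union_disjoint)
              ultimately show False using neg w0 wCsum by simp
            next
              case noQ: False
              have disj: "set R \<inter> set P = {}"
              proof (rule ccontr)
                assume "set R \<inter> set P \<noteq> {}"
                then obtain h where h: "h \<in> set R" "h \<in> set P" by auto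
                obtain q r where "R = q @ r" "walk s t u q (s h)" "walk s t (s h) r b"
                  using walk_split_at[OF ub h(1), of "s h"] by blast
                moreover obtain P3 P4 where "P = P3 @ P4" "walk s t y P3 (s h)" "walk s t (s h) P4 y2"
                  using walk_split_at[OF y2(1) h(2), of "s h"] by blast
                ultimately have "Q r" unfolding Q_def by blast
                then show False using noQ by blast
              qed
              have dP: "distinct P" "set P \<subseteq> E" using y P C(2) by auto
              \<comment> \<open>Without a common vertex, \<open>R\<close>, \<open>g\<close> and
                \<open>P\<close> form one trail. As the circuit has weight 0, it weighs
                \<open>sum w (set R) - w g2\<close>, less than the minimum.\<close>
              have "walk s t u (R @ [g] @ P) y2" using ub y(1) y2(1) by (metis walk_append)
              then have "R @ [g] @ P \<in> T" using dP Rd RE gR g2 gE disj by (auto simp: T_def)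
              from wmin[OF this] have "sum w (set R) \<le> sum w (set R) + w g + sum w (set P)"
                using dP Rd gR g2 disj by (subst (asm) (2) sum_list_distinct_conv_sum_set[symmetric])
                  (auto simp: sum_list_distinct_conv_sum_set)
              moreover have "0 < w g2" using star_pos[of g2] g2 g2B fC by (auto simp: B_def)
              ultimately show False using w0 wCsum by simp
            qed
          qed
          then have "2 \<le> sum w C" using wC by presburger
          then show ?thesis using w'_sum[OF C(2)] cB fC by simp
        qed
      qed
    qed
    have "0 \<le> (\<Sum>e\<in>E. real_of_int (w' e) * p e)"
    proof (rule less.hyps[where s = s and t = t])
      \<comment> \<open>The edge \<open>f\<close> is negative and the rest of its star positive, so
        every change moves a weight towards 0.\<close>
      have "(\<Sum>e\<in>E. \<bar>w' e\<bar>) < (\<Sum>e\<in>E. \<bar>w e\<bar>)"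
      proof (rule sum_strict_mono_ex1[OF fin])
        show "\<forall>x\<in>E. \<bar>w' x\<bar> \<le> \<bar>w x\<bar>"
          using star_pos fneg unfolding w'_def B_def by fastforce
        show "\<exists>a\<in>E. \<bar>w' a\<bar> < \<bar>w a\<bar>"
          using fE fneg by (intro bexI[of _ f]) (auto simp: w'_def)
      qed
      moreover have "0 \<le> (\<Sum>e\<in>E. \<bar>w' e\<bar>)" by (rule sum_nonneg) simp
      ultimately show "nat (\<Sum>e\<in>E. \<bar>w' e\<bar>) + card E < nat (\<Sum>e\<in>E. \<bar>w e\<bar>) + card E"
        by linarith
    next
      fix Z assume Z: "Z \<subseteq> E" "even_set s t Z"
      have "0 \<le> sum w' Z"
        by (rule even_set_circuit_sum_nonneg[OF Z(2)]) (use circ Z in auto)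
      moreover have "even (sum w' Z)"
        using w'_sum[OF Z(1)] cardB[OF Z(1)] cons[OF Z] Z(2) by (auto simp: even_set_def)
      ultimately show "0 \<le> sum w' Z \<and> even (sum w' Z)" ..
    qed (use fin pos cut in auto)
    moreover have "(\<Sum>e\<in>E. real_of_int (w e) * p e)
        = (\<Sum>e\<in>E. real_of_int (w' e) * p e) + (sum p (B - {f}) - p f)"
    proof -
      have "(\<Sum>e\<in>E. real_of_int (w e) * p e)
          = (\<Sum>e\<in>E. real_of_int (w' e) * p e + (if e \<in> B - {f} then p e else 0)
               - (if e = f then p e else 0))"
        by (rule sum.cong) (auto simp: w'_def algebra_simps)
      also have "\<dots> = (\<Sum>e\<in>E. real_of_int (w' e) * p e) + sum p (B - {f}) - p f"
      proof -
        have "E \<inter> (B - {f}) = B - {f}" using BE by auto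
        then show ?thesis using fin fE unfolding sum.distrib sum_subtractf
          by (simp only: sum.inter_restrict[symmetric] sum.delta if_True)
      qed
      finally show ?thesis by simp
    qed
    ultimately show ?thesis using cut[OF fb] by (simp add: B_def)
  qed
qed

section \<open>Cuts and dual cuts of plane graphs\<close>

lemma even_card_sym_diff:
  assumes "finite A" "finite B"
  shows "even (card ((A - B) \<union> (B - A))) \<longleftrightarrow> (even (card A) \<longleftrightarrow> even (card B))"
proof -
  have "card A = card (A - B) + card (A \<inter> B)" "card B = card (B - A) + card (A \<inter> B)"
    using card_Int_Diff[OF assms(1), of B] card_Int_Diff[OF assms(2), of A] by (simp_all add: Int_commute)
  moreover have "card ((A - B) \<union> (B - A)) = card (A - B) + card (B - A)"
    using assms by (intro card_Un_disjoint) auto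
  ultimately show ?thesis by auto
qed

text \<open>Sum \<open>(-1) ^ card (A \<inter> z)\<close> over all \<open>A \<in> W\<close> and \<open>z \<subseteq> E\<close> in both orders.\<close>

lemma card_times_card_orthogonal:
  assumes fin: "finite E" and W: "W \<subseteq> Pow E" "{} \<in> W"
    and closed: "\<And>A B. A \<in> W \<Longrightarrow> B \<in> W \<Longrightarrow> (A - B) \<union> (B - A) \<in> W"
  shows "card W * card {z \<in> Pow E. \<forall>A\<in>W. even (card (A \<inter> z))} = 2 ^ card E"
proof -
  define \<chi> :: "'a set \<Rightarrow> 'a set \<Rightarrow> int" where "\<chi> A z = (if even (card (A \<inter> z)) then 1 else -1)" for A z
  have finW: "finite W" using W fin by (meson finite_Pow_iff finite_subset)
  let ?O = "{z \<in> Pow E. \<forall>A\<in>W. even (card (A \<inter> z))}"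
  have inner_z: "(\<Sum>A\<in>W. \<chi> A z) = (if z \<in> ?O then int (card W) else 0)" if z: "z \<in> Pow E" for z
  proof (cases "z \<in> ?O")
    case True
    then show ?thesis by (simp add: \<chi>_def)
  next
    case False
    then obtain A0 where A0: "A0 \<in> W" "odd (card (A0 \<inter> z))" using z by auto
    have finz: "finite z" using z fin finite_subset by auto
    have "(\<Sum>A\<in>W. \<chi> A z) = (\<Sum>A\<in>W. - \<chi> A z)"
    proof (rule sum.reindex_bij_witness[where i = "\<lambda>A. (A - A0) \<union> (A0 - A)" and j = "\<lambda>A. (A - A0) \<union> (A0 - A)"])
      fix A assume "A \<in> W"
      have "((A - A0) \<union> (A0 - A)) \<inter> z = (A \<inter> z - A0 \<inter> z) \<union> (A0 \<inter> z - A \<inter> z)" by auto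
      then show "- \<chi> ((A - A0) \<union> (A0 - A)) z = \<chi> A z"
        using even_card_sym_diff[of "A \<inter> z" "A0 \<inter> z"] A0 finz by (simp add: \<chi>_def)
    qed (use closed A0 in auto)
    then have "(\<Sum>A\<in>W. \<chi> A z) = 0" by (simp add: sum_negf)
    then show ?thesis using False by (simp only: if_False)
  qed
  have inner_A: "(\<Sum>z\<in>Pow E. \<chi> A z) = (if A = {} then 2 ^ card E else 0)" if A: "A \<in> W" for A
  proof (cases "A = {}")
    case True
    then show ?thesis using fin by (simp add: \<chi>_def card_Pow)
  next
    case False
    then obtain e where e: "e \<in> A" by auto
    have finA: "finite A" using A W fin finite_subset[of A E] by auto
    have "(\<Sum>z\<in>Pow E. \<chi> A z) = (\<Sum>z\<in>Pow E. - \<chi> A z)"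
    proof (rule sum.reindex_bij_witness[where i = "\<lambda>z. (z - {e}) \<union> ({e} - z)" and j = "\<lambda>z. (z - {e}) \<union> ({e} - z)"])
      fix z
      have "A \<inter> ((z - {e}) \<union> ({e} - z)) = (A \<inter> z - {e}) \<union> ({e} - A \<inter> z)" using e by auto
      then show "- \<chi> A ((z - {e}) \<union> ({e} - z)) = \<chi> A z"
        using even_card_sym_diff[of "A \<inter> z" "{e}"] finA by (simp add: \<chi>_def)
    qed (use e A W in auto)
    then have "(\<Sum>z\<in>Pow E. \<chi> A z) = 0" by (simp add: sum_negf)
    then show ?thesis using False by simp
  qed
  have "int (card W * card ?O) = (\<Sum>z\<in>Pow E. if z \<in> ?O then int (card W) else 0)"
    using fin by (simp add: sum.If_cases Int_def)
  also have "\<dots> = (\<Sum>z\<in>Pow E. \<Sum>A\<in>W. \<chi> A z)" by (rule sum.cong) (simp_all only: inner_z)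
  also have "\<dots> = (\<Sum>A\<in>W. \<Sum>z\<in>Pow E. \<chi> A z)" by (rule sum.swap)
  also have "\<dots> = (\<Sum>A\<in>W. if A = {} then 2 ^ card E else 0)" by (rule sum.cong) (simp_all only: inner_A)
  also have "\<dots> = int (2 ^ card E)" using W finW by simp
  finally show ?thesis by (simp only: of_nat_eq_iff)
qed

text \<open>Additivity over the field with two elements, which makes \<open>cutset\<close> a linear
  map.\<close>

lemma cutset_sym_diff:
  "cutset s t E ((X - Y) \<union> (Y - X)) =
    (cutset s t E X - cutset s t E Y) \<union> (cutset s t E Y - cutset s t E X)"
proof (rule set_eqI)
  fix e
  show "e \<in> cutset s t E ((X - Y) \<union> (Y - X)) \<longleftrightarrow>
      e \<in> (cutset s t E X - cutset s t E Y) \<union> (cutset s t E Y - cutset s t E X)"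
    by (cases "e \<in> E"; cases "s e \<in> X"; cases "s e \<in> Y"; cases "t e \<in> X"; cases "t e \<in> Y")
      (simp_all add: cutset_def)
qed

text \<open>Rank-nullity as a count: by additivity, symmetric difference with a fixed member maps
  each fibre injectively into the kernel.\<close>

lemma card_cutsets:
  assumes fin: "finite A" and m: "card {X \<in> Pow A. cutset s t E X = {}} \<le> m"
  shows "2 ^ card A \<le> card (cutset s t E ` Pow A) * m"
proof -
  let ?g = "cutset s t E" and ?K = "{X \<in> Pow A. cutset s t E X = {}}"
  have fib: "card {x \<in> Pow A. ?g x = y} \<le> m" if y: "y \<in> ?g ` Pow A" for y
  proof -
    obtain X where X: "X \<in> Pow A" "?g X = y" using y by auto
    have "inj_on (\<lambda>Y. (Y - X) \<union> (X - Y)) {x \<in> Pow A. ?g x = y}" 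
      by (rule inj_on_inverseI[where g = "\<lambda>Y. (Y - X) \<union> (X - Y)"]) auto
    moreover have "(\<lambda>Y. (Y - X) \<union> (X - Y)) ` {x \<in> Pow A. ?g x = y} \<subseteq> ?K"
      using X by (auto simp: cutset_sym_diff)
    ultimately have "card {x \<in> Pow A. ?g x = y} \<le> card ?K"
      using fin by (intro card_inj_on_le) auto
    then show ?thesis using m by simp
  qed
  have "2 ^ card A = card (Pow A)" using fin by (simp add: card_Pow)
  also have "\<dots> = (\<Sum>y\<in>?g ` Pow A. card {x \<in> Pow A. ?g x = y})"
    using sum.image_gen[of "Pow A" "\<lambda>_. 1::nat" ?g] fin by simp
  also have "\<dots> \<le> (\<Sum>y\<in>?g ` Pow A. m)" by (rule sum_mono) (rule fib)
  finally show ?thesis by simp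
qed

section \<open>Edges, faces and the dual graph\<close>

context plane_graph
begin

abbreviation \<F> :: "'b set set" where
  "\<F> \<equiv> faces G arev rot"

text \<open>\<open>SOME\<close> sees only the unordered pair, so both arcs of an edge get the same
  representative.\<close>

definition rep :: "'b \<Rightarrow> 'b" where
  "rep a = (SOME b. b \<in> {a, arev a})"

definition edges :: "'b set" where
  "edges = rep ` arcs G"

abbreviation \<phi> :: "'b \<Rightarrow> 'b" where
  "\<phi> \<equiv> face_succ arev rot"

definition face :: "'b \<Rightarrow> 'b set" where
  "face a = orbit \<phi> a"

lemma rep_cases: "rep a = a \<or> rep a = arev a"
  unfolding rep_def using someI[of "\<lambda>b. b \<in> {a, arev a}" a] by auto

lemma rep_arev [simp]: "rep (arev a) = rep a"
  unfolding rep_def by (simp add: insert_commute)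

lemma rep_rep [simp]: "rep (rep a) = rep a"
  using rep_cases[of a] by auto

lemma rep_in_arcs [simp]: "a \<in> arcs G \<Longrightarrow> rep a \<in> arcs G"
  using rep_cases[of a] by auto

lemma edges_subset: "edges \<subseteq> arcs G" by (auto simp: edges_def)

lemma edges_arcs [simp]: "e \<in> edges \<Longrightarrow> e \<in> arcs G" using edges_subset by auto

lemma finite_edges [simp]: "finite edges" by (simp add: edges_def)

lemma rep_in_edges [simp]: "a \<in> arcs G \<Longrightarrow> rep a \<in> edges" by (auto simp: edges_def)

lemma rep_edge [simp]: "e \<in> edges \<Longrightarrow> rep e = e" by (auto simp: edges_def)

lemma arev_not_edge: "e \<in> edges \<Longrightarrow> arev e \<notin> edges"
  using arev_neq[of e] rep_arev[of e] rep_edge[of e] rep_edge[of "arev e"] by auto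

lemma arcs_eq_edges: "arcs G = edges \<union> arev ` edges"
proof -
  have "a \<in> edges \<union> arev ` edges" if "a \<in> arcs G" for a
    using rep_cases[of a] rep_in_edges[OF that] image_eqI[of a arev "arev a" edges] by auto
  then show ?thesis by auto
qed

lemma sum_arcs:
  fixes f :: "'b \<Rightarrow> 'w::comm_monoid_add"
  shows "sum f (arcs G) = (\<Sum>e\<in>edges. f e + f (arev e))"
proof -
  have "sum f (arcs G) = sum f edges + sum f (arev ` edges)"
    unfolding arcs_eq_edges by (rule sum.union_disjoint) (use arev_not_edge in auto)
  also have "sum f (arev ` edges) = (\<Sum>e\<in>edges. f (arev e))"
    by (subst sum.reindex) (auto simp: inj_on_arev)
  finally show ?thesis by (simp add: sum.distrib)
qed

lemma card_arcs: "card (arcs G) = 2 * card edges"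
  using sum_arcs[of "\<lambda>_. 1::nat"] by simp

lemma face_succ_permutes: "\<phi> permutes arcs G"
  unfolding face_succ_def by (rule permutes_compose[OF arev_permutes_arcs rot_permutes])

lemma permutation_face_succ: "permutation \<phi>"
  unfolding permutation_permutes using face_succ_permutes finite_arcs by blast

lemma self_in_face [simp]: "a \<in> face a"
  unfolding face_def by (rule permutation_self_in_orbit[OF permutation_face_succ])

lemma face_eq: "b \<in> face a \<Longrightarrow> face b = face a"
  unfolding face_def by (rule orbit_cyclic_eq3[OF cyclic_on_orbit'[OF permutation_face_succ]])

lemma face_succ_face [simp]: "face (\<phi> a) = face a"
  by (rule face_eq) (simp add: face_def orbit.base)

lemma face_subset: "a \<in> arcs G \<Longrightarrow> face a \<subseteq> arcs G"
  unfolding face_def by (rule permutes_orbit_subset[OF face_succ_permutes])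

lemma face_iff: "b \<in> face a \<longleftrightarrow> face b = face a"
  by (rule iffI, erule face_eq, erule subst, rule self_in_face)

lemma faces_eq: "\<F> = face ` arcs G"
  by (simp add: faces_def face_def)

lemma finite_faces [simp]: "finite (\<F>)"
  by (simp add: faces_eq)

lemma tail_face_succ: 
  assumes "a \<in> arcs G" shows "tail G (\<phi> a) = head G a"
proof -
  let ?b = "arev a"
  have b: "?b \<in> out_arcs G (tail G ?b)" "tail G ?b \<in> verts G" using assms by auto
  then have "cyclic_on rot (out_arcs G (tail G ?b))" using rot_cyclic by blast
  then have "rot ?b \<in> out_arcs G (tail G ?b)" using b(1) by (rule cyclic_on_inI)
  then show ?thesis using assms by (auto simp: face_succ_def)
qed

lemma face_memD:
  assumes "F \<in> \<F>" "a \<in> F"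
  shows "a \<in> arcs G" "face a = F"
  using assms face_subset face_iff by (auto simp: faces_eq)

lemma face_in_faces [simp]: "a \<in> arcs G \<Longrightarrow> face a \<in> \<F>"
  by (simp add: faces_eq)

lemma sum_faces:
  fixes f :: "'b \<Rightarrow> 'w::comm_monoid_add"
  shows "(\<Sum>F\<in>\<F>. sum f F) = sum f (arcs G)"
proof -
  have "(\<Sum>F\<in>\<F>. sum f F) = (\<Sum>F\<in>\<F>. sum f {a \<in> arcs G. face a = F})"
  proof (rule sum.cong)
    fix F assume F: "F \<in> \<F>"
    have "F = {a \<in> arcs G. face a = F}"
    proof (intro set_eqI iffI)
      fix a assume "a \<in> F"
      then show "a \<in> {a \<in> arcs G. face a = F}" using face_memD[OF F] by simp
    next
      fix a assume "a \<in> {a \<in> arcs G. face a = F}"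
      then show "a \<in> F" using self_in_face[of a] by simp
    qed
    then show "sum f F = sum f {a \<in> arcs G. face a = F}" by simp
  qed simp
  also have "\<dots> = sum f (arcs G)" by (rule sum.group) (auto simp: faces_eq)
  finally show ?thesis .
qed

lemma tail_rot: "a \<in> arcs G \<Longrightarrow> tail G (rot a) = tail G a"
  using tail_face_succ[of "arev a"] by (simp add: face_succ_def)

text \<open>The dual graph in terms of end functions: its nodes are the faces, and \<open>e\<close>
  joins the faces on its two sides.\<close>

abbreviation dual_cut :: "'b set set \<Rightarrow> 'b set" where
  "dual_cut \<equiv> cutset face (face \<circ> arev) edges"

abbreviation cut :: "'a set \<Rightarrow> 'b set" where
  "cut \<equiv> cutset (tail G) (head G) edges"

lemma sum_edges_as_arcs:
  fixes f :: "'b \<Rightarrow> 'w::comm_monoid_add"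
  assumes "Y \<subseteq> edges"
  shows "(\<Sum>e\<in>Y. f e + f (arev e)) = (\<Sum>a | a \<in> arcs G \<and> rep a \<in> Y. f a)"
proof -
  have "(\<Sum>a | a \<in> arcs G \<and> rep a \<in> Y. f a) = (\<Sum>a\<in>arcs G. if rep a \<in> Y then f a else 0)"
    by (simp add: sum.inter_filter)
  also have "\<dots> = (\<Sum>e\<in>edges. (if rep e \<in> Y then f e else 0) + (if rep (arev e) \<in> Y then f (arev e) else 0))"
    by (rule sum_arcs)
  also have "\<dots> = (\<Sum>e\<in>edges. if e \<in> Y then f e + f (arev e) else 0)"
    by (rule sum.cong) auto
  also have "\<dots> = (\<Sum>e\<in>Y. f e + f (arev e))"
    using assms by (simp add: sum.inter_restrict[symmetric] Int_absorb1)
  finally show ?thesis by simp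
qed

text \<open>An edge with \<open>F\<close> on both sides is a loop of the dual; it counts twice, just
  as both of its arcs lie on \<open>F\<close>.\<close>

lemma dual_incidence:
  assumes "Y \<subseteq> edges" "F \<in> \<F>"
  shows "incidence face (face \<circ> arev) Y F = card {a \<in> F. rep a \<in> Y}"
proof -
  obtain b where b: "b \<in> arcs G" "F = face b" using assms(2) by (auto simp: faces_eq)
  have "incidence face (face \<circ> arev) Y F = (\<Sum>e\<in>Y. of_bool (face e = F) + of_bool (face (arev e) = F))"
    by (simp add: incidence_def)
  also have "\<dots> = (\<Sum>a | a \<in> arcs G \<and> rep a \<in> Y. of_bool (face a = F))"
    by (rule sum_edges_as_arcs[OF assms(1)])
  also have "\<dots> = card {a \<in> {a. a \<in> arcs G \<and> rep a \<in> Y}. face a = F}"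
    by (simp add: of_bool_def sum.If_cases Int_def)
  also have "{a \<in> {a. a \<in> arcs G \<and> rep a \<in> Y}. face a = F} = {a \<in> F. rep a \<in> Y}"
    using face_iff face_subset b by blast
  finally show ?thesis .
qed

lemma dual_incidence_not_face:
  assumes "Y \<subseteq> edges" "F \<notin> \<F>"
  shows "incidence face (face \<circ> arev) Y F = 0"
proof -
  have "face e \<noteq> F \<and> face (arev e) \<noteq> F" if "e \<in> Y" for e
    using that assms edges_arcs[of e] by (auto simp: faces_eq)
  then show ?thesis by (auto simp: incidence_def)
qed

text \<open>A facial walk is closed, so it enters \<open>S\<close> as often as it leaves it;
  reindexing by \<open>\<phi>\<close> turns heads into tails.\<close>

lemma even_face_crossings:
  assumes "F \<in> \<F>"
  shows "even (card {a \<in> F. (tail G a \<in> S) \<noteq> (head G a \<in> S)})"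
proof -
  obtain b where b: "b \<in> arcs G" "F = face b" using assms by (auto simp: faces_eq)
  have sub: "F \<subseteq> arcs G" using face_subset b by simp
  then have fin: "finite F" by (rule finite_subset) simp
  have inj: "inj_on \<phi> F" using face_succ_permutes by (metis inj_on_subset permutes_inj subset_UNIV)
  have "\<phi> ` F \<subseteq> F" using b face_iff by auto
  then have img: "\<phi> ` F = F" using endo_inj_surj[OF fin] inj by blast
  have "(\<Sum>a\<in>F. of_bool (tail G (\<phi> a) \<in> S)) = (\<Sum>a\<in>F. of_bool (tail G a \<in> S) :: nat)"
    using sum.reindex[OF inj, of "\<lambda>a. of_bool (tail G a \<in> S) :: nat"] img by (simp add: o_def)
  then have "(\<Sum>a\<in>F. of_bool (tail G a \<in> S) + of_bool (head G a \<in> S) :: nat)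
      = 2 * (\<Sum>a\<in>F. of_bool (tail G a \<in> S))"
    using sub by (simp add: sum.distrib subset_iff tail_face_succ cong: sum.cong)
  moreover have "(\<Sum>a\<in>F. of_bool (tail G a \<in> S) + of_bool (head G a \<in> S) :: nat)
      = (\<Sum>a\<in>F. of_bool ((tail G a \<in> S) \<noteq> (head G a \<in> S)) + 2 * of_bool (tail G a \<in> S \<and> head G a \<in> S))"
    by (rule sum.cong) auto
  moreover have "\<dots> = card {a \<in> F. (tail G a \<in> S) \<noteq> (head G a \<in> S)}
      + 2 * (\<Sum>a\<in>F. of_bool (tail G a \<in> S \<and> head G a \<in> S))"
    unfolding sum.distrib sum_distrib_left[symmetric]
    using fin by (simp add: of_bool_def sum.If_cases Int_def)
  ultimately show ?thesis by presburger
qed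

lemma rep_in_cut: "a \<in> arcs G \<Longrightarrow> rep a \<in> cut S \<longleftrightarrow> (tail G a \<in> S) \<noteq> (head G a \<in> S)"
  using rep_cases[of a] rep_in_edges[of a] by (auto simp: cutset_def)

lemma even_set_cut: "even_set face (face \<circ> arev) (cut S)"
proof -
  have sub: "cut S \<subseteq> edges" by (auto simp: cutset_def)
  have "even (incidence face (face \<circ> arev) (cut S) F)" for F
  proof (cases "F \<in> \<F>")
    case True
    then obtain b where "b \<in> arcs G" "F = face b" by (auto simp: faces_eq)
    then have "{a \<in> F. rep a \<in> cut S} = {a \<in> F. (tail G a \<in> S) \<noteq> (head G a \<in> S)}"
      using face_subset rep_in_cut by blast
    then show ?thesis using dual_incidence[OF sub True] even_face_crossings[OF True] by simp
  qed (simp add: dual_incidence_not_face[OF sub])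
  then show ?thesis using finite_subset[OF sub finite_edges] by (simp add: even_set_def)
qed

lemma reachable_closed:
  assumes "\<And>a. a \<in> arcs G \<Longrightarrow> tail G a \<in> S \<Longrightarrow> head G a \<in> S" "u \<rightarrow>\<^sup>*\<^bsub>G\<^esub> v" "u \<in> S"
  shows "v \<in> S"
proof -
  obtain p where "awalk u p v" using assms(2) by (auto simp: reachable_awalk)
  then show ?thesis using assms(3)
    by (induction p arbitrary: u) (auto simp: awalk_simps assms(1))
qed

lemma closed_eq_Union_sccs:
  assumes "\<And>a. a \<in> arcs G \<Longrightarrow> tail G a \<in> S \<Longrightarrow> head G a \<in> S" "S \<subseteq> verts G"
  shows "S = \<Union>{C \<in> sccs_verts. C \<subseteq> S}"
proof -
  have "\<exists>C\<in>sccs_verts. v \<in> C \<and> C \<subseteq> S" if v: "v \<in> S" for v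
  proof (intro bexI conjI)
    show "scc_of v \<in> sccs_verts" using v assms(2) scc_of_in_sccs_verts by blast
    show "v \<in> scc_of v" using v assms(2) by (auto simp: scc_of_def)
    show "scc_of v \<subseteq> S" using reachable_closed[OF assms(1) _ v] by (auto simp: scc_of_def)
  qed
  then show ?thesis by blast
qed

lemma closed_iff_cut_empty:
  assumes "cut S = {}" "a \<in> arcs G" "tail G a \<in> S"
  shows "head G a \<in> S"
  using rep_in_cut[OF assms(2), of S] assms by auto

text \<open>A set with empty cut is closed along arcs, hence a union of components and determined by
  them.\<close>

lemma card_kernel_cut: "card {S \<in> Pow (verts G). cut S = {}} \<le> 2 ^ card sccs_verts"
proof -
  have "inj_on (\<lambda>S. {C \<in> sccs_verts. C \<subseteq> S}) {S \<in> Pow (verts G). cut S = {}}"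
  proof (rule inj_onI)
    have U: "\<Union>{C \<in> sccs_verts. C \<subseteq> S} = S" if "S \<in> {S \<in> Pow (verts G). cut S = {}}" for S
      by (intro closed_eq_Union_sccs[symmetric]) (use that closed_iff_cut_empty[of S] in auto)
    show "S = T" if "S \<in> {S \<in> Pow (verts G). cut S = {}}" "T \<in> {S \<in> Pow (verts G). cut S = {}}"
        "{C \<in> sccs_verts. C \<subseteq> S} = {C \<in> sccs_verts. C \<subseteq> T}" for S T
      using U[OF that(1)] U[OF that(2)] unfolding that(3) by simp
  qed
  moreover have "(\<lambda>S. {C \<in> sccs_verts. C \<subseteq> S}) ` {S \<in> Pow (verts G). cut S = {}} \<subseteq> Pow sccs_verts"
    by auto
  ultimately have "card {S \<in> Pow (verts G). cut S = {}} \<le> card (Pow sccs_verts)"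
    using finite_sccs_verts by (intro card_inj_on_le) auto
  then show ?thesis using finite_sccs_verts by (simp add: card_Pow)
qed

lemma isolated_singleton_sccs:
  assumes "v \<in> isolated_verts G" shows "{v} \<in> sccs_verts"
proof -
  have v: "v \<in> verts G" "\<And>a. a \<in> arcs G \<Longrightarrow> tail G a \<noteq> v"
    using assms by (auto simp: isolated_verts_def)
  have "w = v" if "v \<rightarrow>\<^sup>*\<^bsub>G\<^esub> w" for w
    using reachable_closed[OF _ that, of "{v}"] v by auto
  then show ?thesis using v by (auto simp: in_sccs_verts_conv_reachable)
qed

text \<open>Membership of faces in such an \<open>X\<close> is preserved by crossing an edge and by
  turning around a vertex. Hence the vertices met by \<open>X\<close> form a union of components,
  and they determine \<open>X\<close>. Isolated vertices bear no arc, which lowers the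
  exponent.\<close>

lemma card_kernel_dual_cut:
  "card {X \<in> Pow (\<F>). dual_cut X = {}}
     \<le> 2 ^ (card sccs_verts - card (isolated_verts G))"
proof -
  let ?iso = "(\<lambda>v. {v}) ` isolated_verts G"
  let ?K = "{X \<in> Pow (\<F>). dual_cut X = {}}"
  define V where "V X = {tail G a |a. a \<in> arcs G \<and> face a \<in> X}" for X
  have fin_iso: "finite (isolated_verts G)" by (simp add: isolated_verts_def)
  have card_iso: "card ?iso = card (isolated_verts G)" by (rule card_image) auto
  have iso_sub: "?iso \<subseteq> sccs_verts" using isolated_singleton_sccs by auto
  have arevX: "face (arev a) \<in> X" if X: "X \<in> ?K" and a: "a \<in> arcs G" "face a \<in> X" for X a
  proof -
    have "rep a \<notin> dual_cut X" using X by auto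
    then show ?thesis using a rep_cases[of a] rep_in_edges[OF a(1)] by (auto simp: cutset_def)
  qed
  have rotX: "face (rot a) \<in> X" if X: "X \<in> ?K" and a: "a \<in> arcs G" "face a \<in> X" for X a
  proof -
    have "\<phi> (arev a) = rot a" by (simp add: face_succ_def)
    then show ?thesis using arevX[OF X a] face_succ_face[of "arev a"] by metis
  qed
  have tailX: "face a \<in> X" if X: "X \<in> ?K" and a: "a \<in> arcs G" "tail G a \<in> V X" for X a
  proof -
    obtain b where b: "b \<in> arcs G" "face b \<in> X" "tail G b = tail G a" using a by (auto simp: V_def)
    have "cyclic_on rot (out_arcs G (tail G a))" using a(1) rot_cyclic[of "tail G a"] by force
    then have "a \<in> orbit rot b" using a b by (auto simp: cyclic_on_alldef)
    then have "a \<in> arcs G \<and> face a \<in> X"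
    proof induction
      case base
      then show ?case using rotX[OF X b(1,2)] b(1) permutes_in_image[OF rot_permutes] by auto
    next
      case (step y)
      then show ?case using rotX[OF X] permutes_in_image[OF rot_permutes] by auto
    qed
    then show ?thesis by simp
  qed
  have VX: "V X = \<Union>{C \<in> sccs_verts. C \<subseteq> V X}" if X: "X \<in> ?K" for X
  proof (rule closed_eq_Union_sccs)
    fix a assume "a \<in> arcs G" "tail G a \<in> V X"
    then have "arev a \<in> arcs G" "face (arev a) \<in> X" using tailX[OF X] arevX[OF X] by auto
    moreover have "tail G (arev a) = head G a" using \<open>a \<in> arcs G\<close> by simp
    ultimately show "head G a \<in> V X" unfolding V_def by (metis (mono_tags, lifting) mem_Collect_eq)
  qed (auto simp: V_def)
  have "inj_on (\<lambda>X. {C \<in> sccs_verts. C \<subseteq> V X}) ?K"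
  proof (rule inj_onI)
    fix X X' assume X: "X \<in> ?K" and X': "X' \<in> ?K"
      and "{C \<in> sccs_verts. C \<subseteq> V X} = {C \<in> sccs_verts. C \<subseteq> V X'}"
    then have eq: "V X = V X'" using VX[OF X] VX[OF X'] by simp
    have "X \<subseteq> Y" if K: "X \<in> ?K" "Y \<in> ?K" "V X = V Y" for X Y
    proof
      fix F assume F: "F \<in> X"
      then obtain a where a: "a \<in> arcs G" "F = face a" using K(1) by (auto simp: faces_eq)
      then have "tail G a \<in> V Y" using F K(3)[symmetric] by (auto simp: V_def)
      then show "F \<in> Y" using tailX[OF K(2) a(1)] a by simp
    qed
    then show "X = X'" using X X' eq by (simp add: subset_antisym)
  qed
  moreover have "(\<lambda>X. {C \<in> sccs_verts. C \<subseteq> V X}) ` ?K \<subseteq> Pow (sccs_verts - ?iso)"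
    by (auto simp: V_def isolated_verts_def out_arcs_def)
  ultimately have "card ?K \<le> card (Pow (sccs_verts - ?iso))"
    using finite_sccs_verts by (intro card_inj_on_le) auto
  also have "\<dots> = 2 ^ (card sccs_verts - card (isolated_verts G))"
    using finite_sccs_verts fin_iso iso_sub card_iso by (simp add: card_Pow card_Diff_subset)
  finally show ?thesis .
qed

text \<open>
  Cuts are orthogonal to dual cuts. Counting components bounds the number of cuts and
  of dual cuts from below, and by Euler's formula there are then as many cuts as sets orthogonal to all
  dual cuts.
\<close>

theorem even_dual_set_is_cut:
  assumes Y: "Y \<subseteq> edges" "even_set face (face \<circ> arev) Y"
  obtains S where "S \<subseteq> verts G" "Y = cut S"
proof -
  let ?W = "dual_cut ` Pow (\<F>)" and ?C = "cut ` Pow (verts G)"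
  let ?O = "{z \<in> Pow edges. \<forall>A\<in>?W. even (card (A \<inter> z))}"
  let ?\<kappa> = "card sccs_verts" and ?i = "card (isolated_verts G)"
  have sub: "?W \<subseteq> Pow edges" by (auto simp: cutset_def)
  have "{} = dual_cut {}" by (simp add: cutset_def)
  then have "{} \<in> ?W" by auto
  moreover have "(A - B) \<union> (B - A) \<in> ?W" if "A \<in> ?W" "B \<in> ?W" for A B
  proof -
    obtain X X' where "X \<in> Pow (\<F>)" "X' \<in> Pow (\<F>)" "A = dual_cut X" "B = dual_cut X'"
      using \<open>A \<in> ?W\<close> \<open>B \<in> ?W\<close> by auto
    then show ?thesis
      using cutset_sym_diff[of face "face \<circ> arev" edges X X']
      by (intro image_eqI[of _ _ "(X - X') \<union> (X' - X)"]) auto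
  qed
  ultimately have WO: "card ?W * card ?O = 2 ^ card edges"
    using card_times_card_orthogonal[OF finite_edges sub] by blast
  have evenO: "z \<in> ?O" if z: "z \<subseteq> edges" "even_set face (face \<circ> arev) z" for z
  proof -
    have "even (card (dual_cut X \<inter> z))" if "X \<subseteq> \<F>" for X
    proof -
      have "dual_cut X \<inter> z = cutset face (face \<circ> arev) z X" using z by (auto simp: cutset_def)
      then show ?thesis using even_set_cutset[OF z(2)] by simp
    qed
    then show ?thesis using z by auto
  qed
  have CO: "?C \<subseteq> ?O" using evenO even_set_cut by (auto simp: cutset_def)
  have c1: "2 ^ card (verts G) \<le> card ?C * 2 ^ ?\<kappa>"
    by (rule card_cutsets[OF finite_verts card_kernel_cut])
  have c2: "2 ^ card (\<F>) \<le> card ?W * 2 ^ (?\<kappa> - ?i)"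
    by (rule card_cutsets[OF finite_faces card_kernel_dual_cut])
  \<comment> \<open>This makes the truncated subtraction \<open>?\<kappa> - ?i\<close>
    exact.\<close>
  have "?i \<le> ?\<kappa>"
  proof -
    have "card ((\<lambda>v. {v}) ` isolated_verts G) \<le> ?\<kappa>"
      using isolated_singleton_sccs finite_sccs_verts by (intro card_mono) auto
    then show ?thesis by (simp add: card_image)
  qed
  then have euler: "card (verts G) + card (\<F>) = card edges + ?\<kappa> + (?\<kappa> - ?i)"
    using euler_formula card_arcs by simp
  have "card ?W * card ?O * (2 ^ ?\<kappa> * 2 ^ (?\<kappa> - ?i)) = 2 ^ (card (verts G) + card (\<F>))"
    unfolding WO euler by (simp add: power_add)
  also have "\<dots> \<le> (card ?C * 2 ^ ?\<kappa>) * (card ?W * 2 ^ (?\<kappa> - ?i))"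
    unfolding power_add using c1 c2 by (rule mult_le_mono)
  also have "\<dots> = card ?W * card ?C * (2 ^ ?\<kappa> * 2 ^ (?\<kappa> - ?i))" by simp
  finally have "card ?W * card ?O \<le> card ?W * card ?C" by simp
  moreover have "0 < card ?W" using WO by (cases "card ?W = 0") auto
  ultimately have "card ?O \<le> card ?C" by simp
  then have "?C = ?O" using CO by (intro card_seteq) auto
  then have "Y \<in> ?C" using evenO[OF Y] by simp
  then show ?thesis using that by auto
qed

lemma supply_cut_eq:
  assumes "\<And>a. a \<in> arcs G \<Longrightarrow> c (arev a) = c a"
  shows "supply_cut G c S = sum c (cut S)"
proof -
  have "supply_cut G c S = (\<Sum>a\<in>arcs G. if tail G a \<in> S \<and> head G a \<notin> S then c a else 0)"
    unfolding supply_cut_def by (simp only: sum.inter_filter[OF finite_arcs])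
  also have "\<dots> = (\<Sum>e\<in>edges. if (tail G e \<in> S) \<noteq> (head G e \<in> S) then c e else 0)"
    unfolding sum_arcs by (rule sum.cong) (use assms in auto)
  also have "\<dots> = sum c (cut S)"
    unfolding cutset_def by (simp only: sum.inter_filter[OF finite_edges])
  finally show ?thesis .
qed

lemma awalk_reverse: "awalk u p v \<Longrightarrow> awalk v (rev (map arev p)) u"
proof (induction p arbitrary: u)
  case (Cons a p)
  then have a: "a \<in> arcs G" "tail G a = u" "awalk (head G a) p v" by (auto simp: awalk_simps)
  have "awalk (head G a) [arev a] u" using a(1) a(2)[symmetric] by (simp add: awalk_simps)
  then show ?case using awalk_appendI[OF Cons.IH[OF a(3)]] by simp
qed (simp add: awalk_simps)

lemma some_in_face: "F \<in> \<F> \<Longrightarrow> (SOME a. a \<in> F) \<in> F"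
proof -
  assume "F \<in> \<F>"
  then obtain a where "F = face a" by (auto simp: faces_eq)
  then have "a \<in> F" by simp
  then show ?thesis by (rule someI)
qed

text \<open>Serves to use walks as capacities: an edge receives the number of its
  traversals.\<close>

lemma sum_count_list_rep:
  fixes f :: "'b \<Rightarrow> real"
  assumes "set p \<subseteq> arcs G"
  shows "(\<Sum>e\<in>edges. real (count_list (map rep p) e) * f e) = (\<Sum>a\<leftarrow>p. f (rep a))"
  using assms
proof (induction p)
  case (Cons a p)
  have "(\<Sum>e\<in>edges. real (count_list (map rep (a # p)) e) * f e)
      = (\<Sum>e\<in>edges. (if e = rep a then f e else 0) + real (count_list (map rep p) e) * f e)"
    by (rule sum.cong) (auto simp: algebra_simps)
  also have "\<dots> = f (rep a) + (\<Sum>a\<leftarrow>p. f (rep a))"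
    using Cons by (simp add: sum.distrib)
  finally show ?case by simp
qed simp

lemma awalk_crosses_cut:
  assumes "awalk u p v" "(u \<in> S) \<noteq> (v \<in> S)"
  shows "1 \<le> sum (count_list (map rep p)) (cut S)"
proof -
  have "\<exists>a\<in>set p. (tail G a \<in> S) \<noteq> (head G a \<in> S)"
    using assms
  proof (induction p arbitrary: u)
    case (Cons a p)
    then show ?case by (cases "(u \<in> S) \<noteq> (head G a \<in> S)") (auto simp: awalk_simps)
  qed (auto simp: awalk_simps)
  then obtain a where a: "a \<in> set p" "(tail G a \<in> S) \<noteq> (head G a \<in> S)" by blast
  then have "a \<in> arcs G" using assms(1) by (auto simp: awalk_def)
  then have "rep a \<in> cut S" using rep_in_cut a(2) by simp
  moreover have "1 \<le> count_list (map rep p) (rep a)"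
    using a(1) count_list_0_iff[of "map rep p" "rep a"] by fastforce
  moreover have "finite (cut S)" by (simp add: cutset_def)
  ultimately show ?thesis using member_le_sum[of "rep a" "cut S" "count_list (map rep p)"] by simp
qed

end

section \<open>Non-crossing chords from profiles\<close>

text \<open>
  A profile \<open>h\<close> assigns a height to each gap \<open>0, \<dots>, N - 1\<close> of a cycle, where gap \<open>i\<close> lies between the positions \<open>i\<close> and
  \<open>i + 1\<close>. A pair \<open>(j, t)\<close> in \<open>chords h N\<close> stands for the maximal run of gaps of height at least \<open>t\<close> that starts with
  gap \<open>j\<close>; it is drawn as a chord from position \<open>j\<close> to position \<open>run_end h N (j, t)\<close>, and no two chords cross.
  They divide the disc into regions which form a tree: \<open>(j, t)\<close> also denotes the region under the chord,
  \<open>chord_parent\<close> the region on its other side, \<open>gap_node\<close> the region at a gap, and \<open>(0, 0)\<close> the outermost region.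
\<close>

definition run_start :: "(nat \<Rightarrow> nat) \<Rightarrow> nat \<Rightarrow> nat \<Rightarrow> nat" where
  "run_start h i t = (LEAST j. j \<le> i \<and> (\<forall>k\<in>{j..i}. t \<le> h k))"

definition chords :: "(nat \<Rightarrow> nat) \<Rightarrow> nat \<Rightarrow> (nat \<times> nat) set" where
  "chords h N = {(j, t). j < N \<and> 1 \<le> t \<and> t \<le> h j \<and> run_start h j t = j}"

definition covers :: "(nat \<Rightarrow> nat) \<Rightarrow> nat \<times> nat \<Rightarrow> nat \<Rightarrow> bool" where
  "covers h c i \<longleftrightarrow> fst c \<le> i \<and> (\<forall>k\<in>{fst c..i}. snd c \<le> h k)"

text \<open>Runs are not continued around the cycle. A run up to the last gap ends at position
  \<open>N\<close>, the same corner as 0, so a run over all gaps gives a degenerate chord.\<close>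

definition run_end :: "(nat \<Rightarrow> nat) \<Rightarrow> nat \<Rightarrow> nat \<times> nat \<Rightarrow> nat" where
  "run_end h N c = (LEAST e. fst c < e \<and> (e = N \<or> h e < snd c))"

definition chord_parent :: "(nat \<Rightarrow> nat) \<Rightarrow> nat \<times> nat \<Rightarrow> nat \<times> nat" where
  "chord_parent h c = (run_start h (fst c) (snd c - 1), snd c - 1)"

definition gap_node :: "(nat \<Rightarrow> nat) \<Rightarrow> nat \<Rightarrow> nat \<times> nat" where
  "gap_node h i = (run_start h i (h i), h i)"

text \<open>The subtree hanging from \<open>c\<close>: all nodes whose run at the level of
  \<open>c\<close> is the run of \<open>c\<close>.\<close>

definition below :: "(nat \<Rightarrow> nat) \<Rightarrow> nat \<times> nat \<Rightarrow> (nat \<times> nat) set" where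
  "below h c = {(j, t). snd c \<le> t \<and> t \<le> h j \<and> run_start h j (snd c) = fst c}"

lemma run_start_run:
  assumes "t \<le> h i"
  shows "run_start h i t \<le> i" "\<And>k. run_start h i t \<le> k \<Longrightarrow> k \<le> i \<Longrightarrow> t \<le> h k"
proof -
  have "run_start h i t \<le> i \<and> (\<forall>k\<in>{run_start h i t..i}. t \<le> h k)"
    unfolding run_start_def by (rule LeastI[of _ i]) (use assms in auto)
  then show "run_start h i t \<le> i" "\<And>k. run_start h i t \<le> k \<Longrightarrow> k \<le> i \<Longrightarrow> t \<le> h k" by auto
qed

lemma run_start_least:
  assumes "j \<le> i" "\<And>k. j \<le> k \<Longrightarrow> k \<le> i \<Longrightarrow> t \<le> h k"
  shows "run_start h i t \<le> j"
  unfolding run_start_def by (rule Least_le) (use assms in auto)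

lemma run_start_0 [simp]: "run_start h i 0 = 0"
  using run_start_least[of 0 i 0 h] by auto

text \<open>Runs are laminar: the run at a lower level contains the one at a higher level, so it may
  be sought from either of these gaps.\<close>

lemma run_start_run_start:
  assumes "t \<le> u" "u \<le> h i"
  shows "run_start h (run_start h i u) t = run_start h i t"
proof (rule antisym)
  let ?a = "run_start h i u"
  have a: "?a \<le> i" "\<And>k. ?a \<le> k \<Longrightarrow> k \<le> i \<Longrightarrow> u \<le> h k" using run_start_run[of u h i] assms by auto
  have t: "t \<le> h i" "t \<le> h ?a" using assms a(1) a(2)[of ?a] by auto
  have "run_start h i t \<le> ?a" using a assms by - (rule run_start_least, auto intro: order_trans)
  then show "run_start h ?a t \<le> run_start h i t"
    using run_start_run[of t h i, OF t(1)] a(1) by - (rule run_start_least, auto)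
  show "run_start h i t \<le> run_start h ?a t"
  proof (rule run_start_least)
    show "run_start h ?a t \<le> i" using run_start_run(1)[of t h ?a, OF t(2)] a(1) by simp
    fix k assume "run_start h ?a t \<le> k" "k \<le> i"
    then show "t \<le> h k" using run_start_run(2)[of t h ?a, OF t(2), of k] a(2)[of k] assms(1) by (cases "k \<le> ?a") auto
  qed
qed

lemma run_start_chord:
  assumes "1 \<le> t" "t \<le> h i" "i < N"
  shows "(run_start h i t, t) \<in> chords h N"
  using assms run_start_run[of t h i] run_start_run_start[of t t h i] by (auto simp: chords_def)

text \<open>Two runs of the same level that share a gap coincide.\<close>

lemma covers_iff_run_start:
  assumes "c \<in> chords h N"
  shows "covers h c i \<longleftrightarrow> snd c \<le> h i \<and> run_start h i (snd c) = fst c"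
proof -
  obtain j t where c: "c = (j, t)" "t \<le> h j" "run_start h j t = j" using assms by (auto simp: chords_def)
  show ?thesis
  proof
    assume cov: "covers h c i"
    then have ji: "j \<le> i" "\<And>k. j \<le> k \<Longrightarrow> k \<le> i \<Longrightarrow> t \<le> h k" by (auto simp: covers_def c)
    then have th: "t \<le> h i" by auto
    have le: "run_start h i t \<le> j" by (rule run_start_least) (use ji in auto)
    have "run_start h j t \<le> run_start h i t"
      using run_start_run[of t h i, OF th] le ji(1) by - (rule run_start_least, auto)
    then show "snd c \<le> h i \<and> run_start h i (snd c) = fst c" using c le th by auto
  next
    assume "snd c \<le> h i \<and> run_start h i (snd c) = fst c"
    then show "covers h c i" using run_start_run[of t h i] by (auto simp: covers_def c)
  qed
qed

lemma run_end:
  assumes "c \<in> chords h N"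
  shows "fst c < run_end h N c" "run_end h N c \<le> N"
    and "\<And>i. i < N \<Longrightarrow> covers h c i \<longleftrightarrow> fst c \<le> i \<and> i < run_end h N c"
proof -
  obtain j t where c: "c = (j, t)" "j < N" "t \<le> h j" using assms by (auto simp: chords_def)
  let ?P = "\<lambda>e. fst c < e \<and> (e = N \<or> h e < snd c)" and ?e = "run_end h N c"
  have P: "?P ?e" unfolding run_end_def by (rule LeastI[of _ N]) (use c in auto)
  have least: "?e \<le> k" if "?P k" for k unfolding run_end_def using that by (rule Least_le)
  show "fst c < ?e" using P by simp
  show "?e \<le> N" using least[of N] c by simp
  fix i assume i: "i < N"
  show "covers h c i \<longleftrightarrow> fst c \<le> i \<and> i < ?e"
  proof
    assume "covers h c i"
    then have ji: "j \<le> i" "\<And>k. j \<le> k \<Longrightarrow> k \<le> i \<Longrightarrow> t \<le> h k" by (auto simp: covers_def c)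
    have "\<not> ?e \<le> i"
    proof
      assume "?e \<le> i"
      then show False using P ji(2)[of ?e] i c by auto
    qed
    then show "fst c \<le> i \<and> i < ?e" using ji c by simp
  next
    assume a: "fst c \<le> i \<and> i < ?e"
    have "t \<le> h k" if "j \<le> k" "k \<le> i" for k
    proof (cases "k = j")
      case False
      then have "\<not> ?P k" using least[of k] that a by auto
      then show ?thesis using that False c by auto
    qed (use c in simp)
    then show "covers h c i" using a by (auto simp: covers_def c)
  qed
qed

lemma finite_chords [simp]: "finite (chords h N)"
proof (rule finite_subset)
  show "chords h N \<subseteq> {..<N} \<times> (\<Union>j<N. {..h j})" by (auto simp: chords_def)
qed auto

lemma chords_covering:
  assumes "i < N"
  shows "{c \<in> chords h N. covers h c i} = (\<lambda>t. (run_start h i t, t)) ` {1..h i}"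
proof (intro set_eqI iffI)
  fix c assume "c \<in> {c \<in> chords h N. covers h c i}"
  then have c: "c \<in> chords h N" "snd c \<le> h i" "run_start h i (snd c) = fst c"
    by (auto simp: covers_iff_run_start)
  then have "1 \<le> snd c" by (auto simp: chords_def)
  then show "c \<in> (\<lambda>t. (run_start h i t, t)) ` {1..h i}" using c by (intro image_eqI[of _ _ "snd c"]) auto
next
  fix c assume "c \<in> (\<lambda>t. (run_start h i t, t)) ` {1..h i}"
  then obtain t where t: "1 \<le> t" "t \<le> h i" "c = (run_start h i t, t)" by auto
  then have "c \<in> chords h N" using run_start_chord assms by simp
  then show "c \<in> {c \<in> chords h N. covers h c i}" using t by (auto simp: covers_iff_run_start)
qed

lemma card_chords_covering:
  assumes "i < N"
  shows "card {c \<in> chords h N. covers h c i} = h i"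
proof -
  have "inj_on (\<lambda>t. (run_start h i t, t)) {1..h i}" by (auto simp: inj_on_def)
  then show ?thesis unfolding chords_covering[OF assms] by (simp add: card_image)
qed

text \<open>The run of level \<open>t\<close> around \<open>i1\<close> reaches \<open>i2\<close>
  exactly if no gap between them drops below \<open>t\<close>.\<close>

lemma card_chords_covering_both:
  assumes "i1 \<le> i2" "i2 < N"
  shows "card {c \<in> chords h N. covers h c i1 \<and> covers h c i2} = Min (h ` {i1..i2})"
proof -
  let ?m = "Min (h ` {i1..i2})"
  have m: "?m \<le> h k" if "i1 \<le> k" "k \<le> i2" for k using that by (intro Min_le) auto
  have "{c \<in> chords h N. covers h c i1 \<and> covers h c i2} = (\<lambda>t. (run_start h i1 t, t)) ` {1..?m}"
  proof (intro set_eqI iffI)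
    fix c assume "c \<in> {c \<in> chords h N. covers h c i1 \<and> covers h c i2}"
    then have c: "c \<in> chords h N" "covers h c i1" "covers h c i2" by auto
    have "snd c \<le> h k" if "k \<in> {i1..i2}" for k using c that by (auto simp: covers_def)
    then have "snd c \<le> ?m" using assms(1) by (subst Min_ge_iff) auto
    moreover have "1 \<le> snd c" using c(1) by (auto simp: chords_def)
    moreover have "run_start h i1 (snd c) = fst c" using c(1,2) by (simp add: covers_iff_run_start)
    ultimately show "c \<in> (\<lambda>t. (run_start h i1 t, t)) ` {1..?m}"
      by (intro image_eqI[of _ _ "snd c"]) auto
  next
    fix c assume "c \<in> (\<lambda>t. (run_start h i1 t, t)) ` {1..?m}"
    then obtain t where t: "1 \<le> t" "t \<le> ?m" "c = (run_start h i1 t, t)" by auto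
    have th: "t \<le> h i1" using t m[of i1] assms by simp
    then have cc: "c \<in> chords h N" using run_start_chord[of t h i1 N] t assms by simp
    have "covers h c i1" using cc t th by (simp add: covers_iff_run_start)
    moreover have "t \<le> h k" if "run_start h i1 t \<le> k" "k \<le> i2" for k
      using run_start_run(2)[of t h i1, OF th, of k] m[of k] t that by (cases "k \<le> i1") auto
    then have "covers h c i2" using t run_start_run(1)[of t h i1, OF th] assms by (auto simp: covers_def)
    ultimately show "c \<in> {c \<in> chords h N. covers h c i1 \<and> covers h c i2}" using cc by simp
  qed
  moreover have "inj_on (\<lambda>t. (run_start h i1 t, t)) {1..?m}" by (auto simp: inj_on_def)
  ultimately show ?thesis by (simp add: card_image)
qed

text \<open>The usual distance in a tree coded by a height function, written additively because
  subtraction of naturals truncates.\<close>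

lemma card_chords_separating:
  assumes "i1 \<le> i2" "i2 < N"
  shows "card {c \<in> chords h N. covers h c i1 \<noteq> covers h c i2} + 2 * Min (h ` {i1..i2}) = h i1 + h i2"
proof -
  let ?A = "{c \<in> chords h N. covers h c i1}" and ?B = "{c \<in> chords h N. covers h c i2}"
  have i1: "i1 < N" using assms by simp
  have "card ?A = card (?A \<inter> ?B) + card (?A - ?B)" by (rule card_Int_Diff) simp
  moreover have "card ?B = card (?B \<inter> ?A) + card (?B - ?A)" by (rule card_Int_Diff) simp
  moreover have "{c \<in> chords h N. covers h c i1 \<noteq> covers h c i2} = (?A - ?B) \<union> (?B - ?A)" by auto
  moreover have "card ((?A - ?B) \<union> (?B - ?A)) = card (?A - ?B) + card (?B - ?A)"
    by (intro card_Un_disjoint) auto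
  moreover have "?A \<inter> ?B = {c \<in> chords h N. covers h c i1 \<and> covers h c i2}"
    "?B \<inter> ?A = {c \<in> chords h N. covers h c i1 \<and> covers h c i2}" by auto
  ultimately show ?thesis
    using card_chords_covering[OF i1, of h] card_chords_covering[OF assms(2), of h]
      card_chords_covering_both[OF assms, of h] by simp
qed

text \<open>The chords over gap \<open>i\<close> are the edges of the tree path from its region to
  the root \<open>(0, 0)\<close>. Membership in \<open>T\<close> differs at the two ends of this
  path iff it switches an odd number of times along it.\<close>

lemma odd_covering_in_cut:
  assumes i: "i < N"
  shows "odd (card {c \<in> chords h N. covers h c i \<and> (c \<in> T) \<noteq> (chord_parent h c \<in> T)}) \<longleftrightarrow>
      (gap_node h i \<in> T) \<noteq> ((0, 0) \<in> T)"
proof -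
  define Y where "Y = {c. (c \<in> T) \<noteq> (chord_parent h c \<in> T)}"
  let ?n = "\<lambda>t. (run_start h i t, t)"
  have step: "odd (card {u \<in> {1..t}. ?n u \<in> Y}) \<longleftrightarrow> (?n t \<in> T) \<noteq> ((0, 0) \<in> T)" if "t \<le> h i" for t
    using that
  proof (induction t)
    case (Suc t)
    have "chord_parent h (?n (Suc t)) = ?n t"
      using run_start_run_start[of t "Suc t" h i] Suc.prems by (simp add: chord_parent_def)
    then have Y: "?n (Suc t) \<in> Y \<longleftrightarrow> (?n (Suc t) \<in> T) \<noteq> (?n t \<in> T)" by (simp add: Y_def)
    have "{u \<in> {1..Suc t}. ?n u \<in> Y} = {u \<in> {1..t}. ?n u \<in> Y} \<union> (if ?n (Suc t) \<in> Y then {Suc t} else {})"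
      by (auto simp: le_Suc_eq)
    then have "card {u \<in> {1..Suc t}. ?n u \<in> Y} = card {u \<in> {1..t}. ?n u \<in> Y} + of_bool (?n (Suc t) \<in> Y)"
      by (auto simp: card_insert_if)
    then show ?case using Suc Y by auto
  qed simp
  have "{c \<in> chords h N. covers h c i \<and> c \<in> Y} = ?n ` {u \<in> {1..h i}. ?n u \<in> Y}"
  proof -
    have "{c \<in> chords h N. covers h c i \<and> c \<in> Y} = {c \<in> chords h N. covers h c i} \<inter> Y" by auto
    also have "\<dots> = ?n ` {u \<in> {1..h i}. ?n u \<in> Y}" unfolding chords_covering[OF i] by auto
    finally show ?thesis .
  qed
  moreover have "inj_on ?n {u \<in> {1..h i}. ?n u \<in> Y}" by (auto simp: inj_on_def)
  ultimately have "card {c \<in> chords h N. covers h c i \<and> c \<in> Y} = card {u \<in> {1..h i}. ?n u \<in> Y}"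
    by (simp add: card_image)
  then show ?thesis using step[of "h i"] by (simp add: Y_def gap_node_def)
qed

lemma gap_node_below:
  assumes "c \<in> chords h N"
  shows "gap_node h i \<in> below h c \<longleftrightarrow> covers h c i"
  using run_start_run[of "h i" h i] run_start_run_start[of "snd c" "h i" h i]
  by (auto simp: gap_node_def below_def covers_iff_run_start[OF assms])

text \<open>Removing one edge of a tree leaves two parts, and no other edge joins them. Thus the cut
  given by \<open>below h c\<close> isolates the chord \<open>c\<close>.\<close>

lemma chord_separates_below:
  assumes c: "c \<in> chords h N" and d: "d \<in> chords h N"
  shows "(d \<in> below h c) \<noteq> (chord_parent h d \<in> below h c) \<longleftrightarrow> d = c"
proof -
  obtain j t where c': "c = (j, t)" "1 \<le> t" "t \<le> h j" "run_start h j t = j" using c by (auto simp: chords_def)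
  obtain j' t' where d': "d = (j', t')" "1 \<le> t'" "t' \<le> h j'" "run_start h j' t' = j'"
    using d by (auto simp: chords_def)
  consider "t < t'" | "t' = t" | "t' < t" by linarith
  then show ?thesis
  proof cases
    case 1
    have "t' - 1 \<le> h j'" using d'(3) by simp
    then have "t' - 1 \<le> h (run_start h j' (t' - 1))"
      using run_start_run(1)[of "t' - 1" h j'] run_start_run(2)[of "t' - 1" h j'] by blast
    moreover have "run_start h (run_start h j' (t' - 1)) t = run_start h j' t"
      by (rule run_start_run_start) (use 1 d' in auto)
    ultimately show ?thesis using 1 c' d' by (auto simp: below_def chord_parent_def)
  next
    case 2
    then show ?thesis using c' d' by (auto simp: below_def chord_parent_def)
  next
    case 3
    then show ?thesis using c' d' by (auto simp: below_def chord_parent_def)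
  qed
qed

text \<open>Passing from one gap to the next, a chord is entered or left only at its ends. Starts
  are numbered from 0 to \<open>N - 1\<close> and ends from 1 to \<open>N\<close>, so only the start
  is compared modulo \<open>N\<close>.\<close>

lemma even_covers_consecutive:
  assumes c: "c \<in> chords h N" and i: "i < N"
  shows "even (of_bool (covers h c i) + of_bool (covers h c (Suc i mod N))
    + (of_bool (fst c = Suc i mod N) + of_bool (run_end h N c = Suc i)) :: nat)"
proof -
  have c1: "fst c < N" using c by (auto simp: chords_def)
  note e = run_end(1,2)[OF c] run_end(3)[OF c i] run_end(3)[OF c, of "Suc i mod N"]
  show ?thesis
  proof (cases "Suc i = N")
    case True
    then show ?thesis using e c1 by (auto simp: of_bool_def)
  next
    case False
    then have "Suc i mod N = Suc i" using i by simp
    then show ?thesis using e c1 False i by (auto simp: of_bool_def)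
  qed
qed

section \<open>Non-crossing demands\<close>

lemma even_sum_add:
  fixes f g :: "'x \<Rightarrow> nat"
  assumes "\<And>x. x \<in> A \<Longrightarrow> even (f x + g x)"
  shows "even (sum f A) \<longleftrightarrow> even (sum g A)"
proof -
  have "even (\<Sum>x\<in>A. f x + g x)" using assms by (intro dvd_sum) auto
  then show ?thesis by (simp add: sum.distrib)
qed

locale pseudometric_on =
  fixes V :: "'v set" and \<delta> :: "'v \<Rightarrow> 'v \<Rightarrow> real"
  assumes nonneg: "u \<in> V \<Longrightarrow> v \<in> V \<Longrightarrow> 0 \<le> \<delta> u v"
    and refl: "u \<in> V \<Longrightarrow> \<delta> u u = 0"
    and sym: "u \<in> V \<Longrightarrow> v \<in> V \<Longrightarrow> \<delta> u v = \<delta> v u"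
    and triangle: "u \<in> V \<Longrightarrow> v \<in> V \<Longrightarrow> x \<in> V \<Longrightarrow> \<delta> u x \<le> \<delta> u v + \<delta> v x"
begin

lemma walk_le:
  assumes "walk s t u p v" "u \<in> V" "\<And>e. e \<in> set p \<Longrightarrow> s e \<in> V \<and> t e \<in> V"
  shows "\<delta> u v \<le> (\<Sum>e\<leftarrow>p. \<delta> (s e) (t e))"
  using assms
proof (induction p arbitrary: u)
  case Nil
  then show ?case using refl by simp
next
  case (Cons e p)
  have V: "s e \<in> V" "t e \<in> V" using Cons.prems by auto
  have vV: "v \<in> V" using Cons.prems
  proof (induction p arbitrary: u e)
    case (Cons f q)
    then show ?case by (metis list.set_intros(1) list.set_intros(2) walk.simps(2))
  qed auto
  from Cons.prems(1) consider "s e = u" "walk s t (t e) p v" | "t e = u" "walk s t (s e) p v" by auto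
  then show ?case
  proof cases
    case 1
    have "\<delta> (t e) v \<le> (\<Sum>e\<leftarrow>p. \<delta> (s e) (t e))" using Cons.IH[OF 1(2)] Cons.prems V by simp
    then show ?thesis using triangle[of u "t e" v] 1 V vV by simp
  next
    case 2
    have "\<delta> (s e) v \<le> (\<Sum>e\<leftarrow>p. \<delta> (s e) (t e))" using Cons.IH[OF 2(2)] Cons.prems V by simp
    then show ?thesis using triangle[of u "s e" v] sym[of "t e" "s e"] 2 V vV by simp
  qed
qed

text \<open>The rest of a closed trail through \<open>f\<close> joins the ends of \<open>f\<close>,
  so the triangle inequality applies. Since cuts of the dual are even sets of the primal graph, this
  supplies the cut hypothesis of \<open>sum_of_circuits_dual\<close>.\<close>

lemma even_set_le:
  assumes Y: "even_set s t Y" and f: "f \<in> Y" and V: "\<And>e. e \<in> Y \<Longrightarrow> s e \<in> V \<and> t e \<in> V"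
  shows "\<delta> (s f) (t f) \<le> (\<Sum>e\<in>Y - {f}. \<delta> (s e) (t e))"
proof -
  obtain p where p: "walk s t (t f) p (s f)" "distinct (f # p)" "set p \<subseteq> Y"
    using closed_trail_through[OF Y f] by blast
  have finY: "finite Y" using Y by (simp add: even_set_def)
  have "\<delta> (s f) (t f) = \<delta> (t f) (s f)" using V[OF f] sym by simp
  also have "\<dots> \<le> (\<Sum>e\<leftarrow>p. \<delta> (s e) (t e))" by (rule walk_le[OF p(1)]) (use p V f in auto)
  also have "\<dots> = (\<Sum>e\<in>set p. \<delta> (s e) (t e))" using p(2) by (simp add: sum_list_distinct_conv_sum_set)
  also have "\<dots> \<le> (\<Sum>e\<in>Y - {f}. \<delta> (s e) (t e))"
    by (rule sum_mono2) (use finY p V nonneg in auto)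
  finally show ?thesis .
qed

end

text \<open>A base arc turns each cyclic facial walk into numbered positions. It is a parameter
  because separable demands need position 0 at the start of their segment.\<close>

locale plane_profile = plane_graph +
  fixes base :: "'b set \<Rightarrow> 'b" and prof :: "'b set \<Rightarrow> nat \<Rightarrow> nat"
  assumes base: "F \<in> \<F> \<Longrightarrow> base F \<in> F"
begin

definition arc_at :: "'b set \<Rightarrow> nat \<Rightarrow> 'b" where
  "arc_at F i = (\<phi> ^^ i) (base F)"

definition pos :: "'b \<Rightarrow> nat" where
  "pos a = inv_into {..<card (face a)} (arc_at (face a)) a"

definition vert_at :: "'b set \<Rightarrow> nat \<Rightarrow> 'a" where
  "vert_at F i = tail G (arc_at F i)"

lemma bij_arc_at:
  assumes F: "F \<in> \<F>"
  shows "bij_betw (arc_at F) {..<card F} F" "arc_at F (card F) = arc_at F 0"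
proof -
  let ?b = "base F"
  let ?n = "funpow_dist1 \<phi> ?b ?b"
  have b: "face ?b = F" "?b \<in> orbit \<phi> ?b" using face_memD(2)[OF F base[OF F]] self_in_face[of ?b] by (auto simp: face_def)
  have F': "F = arc_at F ` {0..<?n}"
    using orbit_conv_funpow_dist1[OF b(2)] b(1) by (simp add: face_def arc_at_def)
  have inj: "inj_on (arc_at F) {0..<?n}"
    using inj_on_funpow_dist1[OF b(2)] by (simp add: arc_at_def[abs_def])
  have n: "card F = ?n" using card_image[OF inj] F' by simp
  show "bij_betw (arc_at F) {..<card F} F"
    unfolding bij_betw_def n using inj F' by (simp add: lessThan_atLeast0)
  show "arc_at F (card F) = arc_at F 0"
    unfolding n arc_at_def using funpow_dist1_prop[OF b(2)] by simp
qed

lemma arc_at_Suc: "arc_at F (Suc i) = \<phi> (arc_at F i)"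
  by (simp add: arc_at_def)

lemma arc_at_in:
  assumes "F \<in> \<F>" "i < card F"
  shows "arc_at F i \<in> F" "arc_at F i \<in> arcs G" "face (arc_at F i) = F" "pos (arc_at F i) = i"
proof -
  show 1: "arc_at F i \<in> F" using bij_arc_at(1)[OF assms(1)] assms(2) by (auto simp: bij_betw_def)
  show "arc_at F i \<in> arcs G" and 2: "face (arc_at F i) = F" using face_memD[OF assms(1) 1] by auto
  show "pos (arc_at F i) = i" unfolding pos_def 2
    using bij_arc_at(1)[OF assms(1)] assms(2) by (intro inv_into_f_f) (auto simp: bij_betw_def)
qed

lemma pos:
  assumes "a \<in> arcs G"
  shows "pos a < card (face a)" "arc_at (face a) (pos a) = a"
proof -
  have A: "a \<in> arc_at (face a) ` {..<card (face a)}"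
    using bij_arc_at(1)[of "face a"] assms by (simp add: bij_betw_def)
  show "pos a < card (face a)" using inv_into_into[OF A] by (simp add: pos_def)
  show "arc_at (face a) (pos a) = a" using f_inv_into_f[OF A] by (simp add: pos_def)
qed

lemma card_face_pos: "F \<in> \<F> \<Longrightarrow> 0 < card F"
  using base bij_arc_at(1)[of F] by (cases "card F = 0") (auto simp: bij_betw_def)

lemma arc_at_mod:
  assumes "F \<in> \<F>" "i < card F"
  shows "arc_at F (Suc i mod card F) = \<phi> (arc_at F i)"
  using bij_arc_at(2)[OF assms(1)] assms(2) arc_at_Suc[of F i]
  by (cases "Suc i = card F") auto

lemma vert_at_Suc:
  assumes "F \<in> \<F>" "i < card F"
  shows "vert_at F (Suc i) = head G (arc_at F i)" "vert_at F (Suc i mod card F) = head G (arc_at F i)"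
  using arc_at_in[OF assms] arc_at_mod[OF assms] tail_face_succ
  by (auto simp: vert_at_def arc_at_Suc)

lemma vert_at_in_verts:
  assumes "F \<in> \<F>" "i \<le> card F"
  shows "vert_at F i \<in> verts G"
proof (cases "i = card F")
  case True
  then show ?thesis using bij_arc_at(2)[OF assms(1)] arc_at_in[OF assms(1), of 0] card_face_pos[OF assms(1)]
    by (simp add: vert_at_def)
next
  case False
  then show ?thesis using arc_at_in[OF assms(1), of i] assms(2) by (simp add: vert_at_def)
qed

lemma sum_face_arc_at:
  "F \<in> \<F> \<Longrightarrow> (\<Sum>i<card F. f (arc_at F i)) = sum f F"
  using sum.reindex_bij_betw[OF bij_arc_at(1)] .

abbreviation chords_of :: "'b set \<Rightarrow> (nat \<times> nat) set" where
  "chords_of F \<equiv> chords (prof F) (card F)"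

abbreviation covers_of :: "'b set \<Rightarrow> nat \<times> nat \<Rightarrow> nat \<Rightarrow> bool" where
  "covers_of F \<equiv> covers (prof F)"

definition all_chords :: "('b set \<times> nat \<times> nat) set" where
  "all_chords = Sigma (\<F>) chords_of"

text \<open>
  The dual of \<open>G\<close> with all chords added: \<open>dsrc\<close> and \<open>dtgt\<close> are the two regions on the sides of an
  edge or chord, \<open>psrc\<close> and \<open>ptgt\<close> its end vertices. Gap \<open>i\<close> of a face is its \<open>i\<close>-th arc.
\<close>

definition dnode :: "'b \<Rightarrow> 'b set \<times> nat \<times> nat" where
  "dnode a = (face a, gap_node (prof (face a)) (pos a))"

definition dsrc :: "'b + 'b set \<times> nat \<times> nat \<Rightarrow> 'b set \<times> nat \<times> nat" where
  "dsrc = case_sum dnode (\<lambda>x. x)"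

definition dtgt :: "'b + 'b set \<times> nat \<times> nat \<Rightarrow> 'b set \<times> nat \<times> nat" where
  "dtgt = case_sum (dnode \<circ> arev) (\<lambda>(F, c). (F, chord_parent (prof F) c))"

definition psrc :: "'b + 'b set \<times> nat \<times> nat \<Rightarrow> 'a" where
  "psrc = case_sum (tail G) (\<lambda>(F, c). vert_at F (fst c))"

definition ptgt :: "'b + 'b set \<times> nat \<times> nat \<Rightarrow> 'a" where
  "ptgt = case_sum (head G) (\<lambda>(F, c). vert_at F (run_end (prof F) (card F) c))"

definition dedges :: "('b + 'b set \<times> nat \<times> nat) set" where
  "dedges = edges <+> all_chords"

lemma finite_all_chords [simp]: "finite all_chords" by (auto simp: all_chords_def)

lemma finite_dedges [simp]: "finite dedges" by (simp add: dedges_def)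

lemma ends_in_verts: "x \<in> dedges \<Longrightarrow> psrc x \<in> verts G \<and> ptgt x \<in> verts G"
  using vert_at_in_verts run_end(2) by (auto simp: dedges_def psrc_def ptgt_def all_chords_def chords_def)

text \<open>The chords of a cut that end at a given corner of a face are, modulo 2, those separating
  the two gaps next to this corner.\<close>

lemma corner_parity:
  assumes F: "F \<in> \<F>"
  shows "even (\<Sum>c | c \<in> chords_of F \<and> ((F, c) \<in> T) \<noteq> ((F, chord_parent (prof F) c) \<in> T).
      of_bool (vert_at F (fst c) = v) + of_bool (vert_at F (run_end (prof F) (card F) c) = v) :: nat) \<longleftrightarrow>
    even (\<Sum>a\<in>F. of_bool (head G a = v \<and> (dnode a \<in> T) \<noteq> (dnode (\<phi> a) \<in> T)) :: nat)"
proof -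
  let ?N = "card F" and ?h = "prof F"
  define Y where "Y = {c. c \<in> chords_of F \<and> ((F, c) \<in> T) \<noteq> ((F, chord_parent ?h c) \<in> T)}"
  define nx where "nx i = Suc i mod ?N" for i
  define av where "av i = (of_bool (vert_at F (Suc i) = v) :: nat)" for i
  have N: "0 < ?N" using card_face_pos[OF F] .
  have finY: "finite Y" by (auto simp: Y_def)
  have Ych: "c \<in> chords ?h ?N" if "c \<in> Y" for c using that by (simp add: Y_def)
  have ends: "of_bool (vert_at F (fst c) = v) + of_bool (vert_at F (run_end ?h ?N c) = v)
      = (\<Sum>i<?N. av i * (of_bool (fst c = nx i) + of_bool (run_end ?h ?N c = Suc i)))"
    if c: "c \<in> Y" for c
  proof -
    have j: "fst c < ?N" using Ych[OF c] by (auto simp: chords_def)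
    \<comment> \<open>\<open>i0\<close> and \<open>i1\<close> are the gaps just before the two ends
      of the chord. A start at position 0 comes after the last gap, whereas an end is never at
      position 0.\<close>
    define i0 where "i0 = (if fst c = 0 then ?N - 1 else fst c - 1)"
    define i1 where "i1 = run_end ?h ?N c - 1"
    have i0: "i0 < ?N" "nx i0 = fst c" using j N by (auto simp: i0_def nx_def)
    have nx0: "fst c = nx i \<longleftrightarrow> i = i0" if "i < ?N" for i
      using that j N by (auto simp: i0_def nx_def mod_Suc split: if_splits)
    have i1: "i1 < ?N" "Suc i1 = run_end ?h ?N c" using run_end(1,2)[OF Ych[OF c]] by (auto simp: i1_def)
    have "(\<Sum>i<?N. av i * (of_bool (fst c = nx i) + of_bool (run_end ?h ?N c = Suc i)))
        = (\<Sum>i<?N. (if i = i0 then av i else 0) + (if i = i1 then av i else 0))"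
      by (rule sum.cong) (use nx0 i1 in auto)
    also have "\<dots> = av i0 + av i1" using i0(1) i1(1) by (simp add: sum.distrib)
    also have "av i0 = of_bool (vert_at F (fst c) = v)"
      using vert_at_Suc[OF F i0(1)] i0(2) by (simp add: av_def nx_def)
    also have "av i1 = of_bool (vert_at F (run_end ?h ?N c) = v)"
      using i1 by (simp add: av_def)
    finally show ?thesis by simp
  qed
  have "(\<Sum>c\<in>Y. of_bool (vert_at F (fst c) = v) + of_bool (vert_at F (run_end ?h ?N c) = v))
      = (\<Sum>c\<in>Y. \<Sum>i<?N. av i * (of_bool (fst c = nx i) + of_bool (run_end ?h ?N c = Suc i)))"
    using ends by (intro sum.cong) auto
  also have "\<dots> = (\<Sum>i<?N. \<Sum>c\<in>Y. av i * (of_bool (fst c = nx i) + of_bool (run_end ?h ?N c = Suc i)))"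
    by (rule sum.swap)
  also have "even \<dots> \<longleftrightarrow> even (\<Sum>i<?N. \<Sum>c\<in>Y. av i * (of_bool (covers ?h c i) + of_bool (covers ?h c (nx i))))"
  proof (rule even_sum_add)
    fix i assume i: "i \<in> {..<?N}"
    have "even (\<Sum>c\<in>Y. av i * (of_bool (fst c = nx i) + of_bool (run_end ?h ?N c = Suc i))) \<longleftrightarrow>
       even (\<Sum>c\<in>Y. av i * (of_bool (covers ?h c i) + of_bool (covers ?h c (nx i))))"
    proof (rule even_sum_add)
      fix c assume "c \<in> Y"
      then show "even (av i * (of_bool (fst c = nx i) + of_bool (run_end ?h ?N c = Suc i)) +
         av i * (of_bool (covers ?h c i) + of_bool (covers ?h c (nx i))))"
        using even_covers_consecutive[OF Ych, of c i] i
        unfolding nx_def distrib_left[symmetric] by (simp add: add.commute add.left_commute)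
    qed
    then show "even ((\<Sum>c\<in>Y. av i * (of_bool (fst c = nx i) + of_bool (run_end ?h ?N c = Suc i))) +
       (\<Sum>c\<in>Y. av i * (of_bool (covers ?h c i) + of_bool (covers ?h c (nx i)))))" by simp
  qed
  also have "(\<Sum>i<?N. \<Sum>c\<in>Y. av i * (of_bool (covers ?h c i) + of_bool (covers ?h c (nx i))))
      = (\<Sum>i<?N. av i * (card {c \<in> Y. covers ?h c i} + card {c \<in> Y. covers ?h c (nx i)}))"
    using finY by (simp add: sum_distrib_left[symmetric] sum.distrib of_bool_def sum.If_cases Int_def)
  also have "even \<dots> \<longleftrightarrow> even (\<Sum>i<?N. (of_bool (head G (arc_at F i) = v \<and>
      (dnode (arc_at F i) \<in> T) \<noteq> (dnode (\<phi> (arc_at F i)) \<in> T)) :: nat))"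
  proof (rule even_sum_add)
    fix i assume "i \<in> {..<?N}"
    then have i: "i < ?N" by simp
    have ni: "nx i < ?N" using N by (simp add: nx_def)
    \<comment> \<open>Both neighbouring gaps are compared with the outermost region
      \<open>(F, 0, 0)\<close>, which cancels when the two parities are added.\<close>
    have cov: "odd (card {c \<in> Y. covers ?h c k}) \<longleftrightarrow> (dnode (arc_at F k) \<in> T) \<noteq> ((F, 0, 0) \<in> T)"
      if k: "k < ?N" for k
    proof -
      have "{c \<in> Y. covers ?h c k} = {c \<in> chords ?h ?N. covers ?h c k \<and>
          (c \<in> {x. (F, x) \<in> T}) \<noteq> (chord_parent ?h c \<in> {x. (F, x) \<in> T})}"
        by (auto simp: Y_def)
      then show ?thesis using odd_covering_in_cut[OF k, of ?h "{x. (F, x) \<in> T}"] arc_at_in[OF F k]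
        by (simp add: dnode_def)
    qed
    have "arc_at F (nx i) = \<phi> (arc_at F i)" using arc_at_mod[OF F i] by (simp add: nx_def)
    then show "even (av i * (card {c \<in> Y. covers ?h c i} + card {c \<in> Y. covers ?h c (nx i)}) +
         of_bool (head G (arc_at F i) = v \<and> (dnode (arc_at F i) \<in> T) \<noteq> (dnode (\<phi> (arc_at F i)) \<in> T)))"
      using cov[OF i] cov[OF ni] vert_at_Suc(1)[OF F i] by (auto simp: av_def)
  qed
  also have "(\<Sum>i<?N. (of_bool (head G (arc_at F i) = v \<and>
      (dnode (arc_at F i) \<in> T) \<noteq> (dnode (\<phi> (arc_at F i)) \<in> T)) :: nat))
     = (\<Sum>a\<in>F. of_bool (head G a = v \<and> (dnode a \<in> T) \<noteq> (dnode (\<phi> a) \<in> T)))"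
    by (rule sum_face_arc_at[OF F, of "\<lambda>a. of_bool (head G a = v \<and> (dnode a \<in> T) \<noteq> (dnode (\<phi> a) \<in> T))"])
  finally show ?thesis by (simp only: Y_def)
qed

text \<open>On a full turn around a vertex, membership in \<open>T\<close> changes an even number of
  times. The changes occur at edges leaving the vertex and at chords ending in its corners.\<close>

lemma even_set_dual_cutset: "even_set psrc ptgt (cutset dsrc dtgt dedges T)"
proof -
  let ?Y = "cutset dsrc dtgt dedges T"
  let ?\<chi> = "\<lambda>a. dnode a \<in> T"
  define YF where "YF F = {c. c \<in> chords_of F \<and> ((F, c) \<in> T) \<noteq> ((F, chord_parent (prof F) c) \<in> T)}" for F
  define YE where "YE = {e \<in> edges. ?\<chi> e \<noteq> ?\<chi> (arev e)}"
  have Y: "?Y = YE <+> Sigma (\<F>) YF"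
    by (auto simp: cutset_def dedges_def dsrc_def dtgt_def YE_def YF_def all_chords_def)
  have finYF: "finite (YF F)" for F by (simp add: YF_def)
  have finYE: "finite YE" by (simp add: YE_def)
  have "even (incidence psrc ptgt ?Y v)" for v
  proof -
    let ?B1 = "\<Sum>F\<in>\<F>. \<Sum>c\<in>YF F. of_bool (vert_at F (fst c) = v) +
           of_bool (vert_at F (run_end (prof F) (card F) c) = v) :: nat"
    have "incidence psrc ptgt ?Y v = (\<Sum>e\<in>YE. of_bool (tail G e = v) + of_bool (head G e = v))
        + (\<Sum>x\<in>Sigma (\<F>) YF. of_bool (vert_at (fst x) (fst (snd x)) = v)
           + of_bool (vert_at (fst x) (run_end (prof (fst x)) (card (fst x)) (snd x)) = v))"
      unfolding incidence_def Y using finYE finYF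
      by (subst sum.Plus) (auto simp: psrc_def ptgt_def case_prod_beta)
    also have "(\<Sum>x\<in>Sigma (\<F>) YF. of_bool (vert_at (fst x) (fst (snd x)) = v)
           + of_bool (vert_at (fst x) (run_end (prof (fst x)) (card (fst x)) (snd x)) = v)) = ?B1"
      by (subst sum.Sigma) (auto simp: finYF case_prod_beta)
    finally have inc: "incidence psrc ptgt ?Y v
        = (\<Sum>e\<in>YE. of_bool (tail G e = v) + of_bool (head G e = v)) + ?B1" .
    have "(\<Sum>e\<in>YE. of_bool (tail G e = v) + of_bool (head G e = v) :: nat)
        = (\<Sum>e\<in>YE. of_bool (tail G e = v) + of_bool (tail G (arev e) = v))"
      by (rule sum.cong) (auto simp: YE_def)
    also have "\<dots> = (\<Sum>a | a \<in> arcs G \<and> rep a \<in> YE. of_bool (tail G a = v))"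
      by (rule sum_edges_as_arcs) (auto simp: YE_def)
    also have "\<dots> = (\<Sum>a\<in>arcs G. of_bool (tail G a = v \<and> ?\<chi> a \<noteq> ?\<chi> (arev a)))"
    proof -
      have "rep a \<in> YE \<longleftrightarrow> ?\<chi> a \<noteq> ?\<chi> (arev a)" if "a \<in> arcs G" for a
        using rep_cases[of a] rep_in_edges[OF that] by (auto simp: YE_def)
      then have "(\<Sum>a\<in>arcs G. of_bool (tail G a = v \<and> ?\<chi> a \<noteq> ?\<chi> (arev a)) :: nat)
          = (\<Sum>a\<in>arcs G. if rep a \<in> YE then of_bool (tail G a = v) else 0)"
        by (intro sum.cong) auto
      then show ?thesis by (simp only: sum.inter_filter[OF finite_arcs])
    qed
    finally have A: "(\<Sum>e\<in>YE. of_bool (tail G e = v) + of_bool (head G e = v) :: nat)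
        = (\<Sum>a\<in>arcs G. of_bool (tail G a = v \<and> ?\<chi> a \<noteq> ?\<chi> (arev a)))" .
    have "even ?B1 \<longleftrightarrow> even (\<Sum>F\<in>\<F>. \<Sum>a\<in>F. of_bool (head G a = v \<and> ?\<chi> a \<noteq> ?\<chi> (\<phi> a)) :: nat)"
      by (rule even_sum_add) (use corner_parity in \<open>simp add: YF_def\<close>)
    also have "(\<Sum>F\<in>\<F>. \<Sum>a\<in>F. of_bool (head G a = v \<and> ?\<chi> a \<noteq> ?\<chi> (\<phi> a)) :: nat)
        = (\<Sum>a\<in>arcs G. of_bool (head G a = v \<and> ?\<chi> a \<noteq> ?\<chi> (\<phi> a)))"
      by (rule sum_faces)
    also have "\<dots> = (\<Sum>a\<in>arcs G. of_bool (head G (arev a) = v \<and> ?\<chi> (arev a) \<noteq> ?\<chi> (\<phi> (arev a))))"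
      using sum.permute[OF arev_permutes_arcs, of "\<lambda>a. of_bool (head G a = v \<and> ?\<chi> a \<noteq> ?\<chi> (\<phi> a)) :: nat"]
      by (simp add: o_def)
    also have "\<dots> = (\<Sum>a\<in>arcs G. of_bool (tail G a = v \<and> ?\<chi> (arev a) \<noteq> ?\<chi> (rot a)))"
      by (rule sum.cong) (auto simp: face_succ_def)
    finally have B: "even ?B1 \<longleftrightarrow>
        even (\<Sum>a\<in>arcs G. of_bool (tail G a = v \<and> ?\<chi> (arev a) \<noteq> ?\<chi> (rot a)) :: nat)" .
    have "(\<Sum>a\<in>arcs G. of_bool (tail G a = v \<and> ?\<chi> a) :: nat)
        = (\<Sum>a\<in>arcs G. of_bool (tail G (rot a) = v \<and> ?\<chi> (rot a)))"
      using sum.permute[OF rot_permutes, of "\<lambda>a. of_bool (tail G a = v \<and> ?\<chi> a) :: nat"] by (simp add: o_def)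
    also have "\<dots> = (\<Sum>a\<in>arcs G. of_bool (tail G a = v \<and> ?\<chi> (rot a)))"
      by (rule sum.cong) (auto simp: tail_rot)
    finally have R: "(\<Sum>a\<in>arcs G. of_bool (tail G a = v \<and> ?\<chi> a) :: nat)
        = (\<Sum>a\<in>arcs G. of_bool (tail G a = v \<and> ?\<chi> (rot a)))" .
    \<comment> \<open>The step from \<open>a\<close> to \<open>rot a\<close> crosses the edge of
      \<open>a\<close> and then a corner. Modulo 2 the two changes add up to
      \<open>?\<chi> a + ?\<chi> (rot a)\<close>, and the total is even since \<open>rot\<close>
      permutes the arcs at \<open>v\<close>.\<close>
    have "even (\<Sum>a\<in>arcs G. of_bool (tail G a = v \<and> ?\<chi> a \<noteq> ?\<chi> (arev a))
          + of_bool (tail G a = v \<and> ?\<chi> (arev a) \<noteq> ?\<chi> (rot a)) :: nat) \<longleftrightarrow>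
        even (\<Sum>a\<in>arcs G. of_bool (tail G a = v \<and> ?\<chi> a) + of_bool (tail G a = v \<and> ?\<chi> (rot a)) :: nat)"
      by (rule even_sum_add) (auto simp: of_bool_def)
    moreover have "even (\<Sum>a\<in>arcs G. of_bool (tail G a = v \<and> ?\<chi> a) + of_bool (tail G a = v \<and> ?\<chi> (rot a)) :: nat)"
      unfolding sum.distrib R[symmetric] by simp
    ultimately show ?thesis unfolding inc A using B by (simp add: sum.distrib)
  qed
  moreover have "finite ?Y" by (simp add: cutset_def)
  ultimately show ?thesis by (simp add: even_set_def)
qed

text \<open>Merging all regions of a face undoes its chords: they join regions of the same face, so
  the cut around these regions contains edges only.\<close>

lemma even_set_edge_part:
  assumes Z: "Z \<subseteq> dedges" "even_set dsrc dtgt Z"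
  shows "even_set face (face \<circ> arev) {e \<in> edges. Inl e \<in> Z}" (is "even_set _ _ ?Y")
proof -
  have "even (incidence face (face \<circ> arev) ?Y F)" for F
  proof -
    have "cutset dsrc dtgt Z {x. fst x = F} = Inl ` cutset face (face \<circ> arev) ?Y {F}"
    proof (rule set_eqI)
      fix x
      show "x \<in> cutset dsrc dtgt Z {x. fst x = F} \<longleftrightarrow> x \<in> Inl ` cutset face (face \<circ> arev) ?Y {F}"
        using Z(1) by (cases x) (auto simp: cutset_def dsrc_def dtgt_def dnode_def dedges_def case_prod_beta)
    qed
    then have "card (cutset dsrc dtgt Z {x. fst x = F}) = card (cutset face (face \<circ> arev) ?Y {F})"
      by (simp add: card_image)
    then have "even (card (cutset face (face \<circ> arev) ?Y {F}))"
      using even_set_cutset[OF Z(2), of "{x. fst x = F}"] by simp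
    then show ?thesis using even_sum_incidence[of ?Y "{F}" face "face \<circ> arev"] by simp
  qed
  then show ?thesis by (simp add: even_set_def)
qed

text \<open>The cut around the subtree below \<open>c\<close> contains no chord but
  \<open>c\<close>, so evenness decides whether \<open>c\<close> belongs to \<open>Z\<close>. An
  even set of the extended dual is therefore determined by its edges of \<open>G\<close>.\<close>

lemma chord_in_even_set:
  assumes Z: "Z \<subseteq> dedges" "even_set dsrc dtgt Z" and F: "F \<in> \<F>" and c: "c \<in> chords_of F"
  shows "Inr (F, c) \<in> Z \<longleftrightarrow> odd (card {a \<in> F. Inl (rep a) \<in> Z \<and> covers_of F c (pos a)})"
proof -
  define S where "S = {(F', x). F' = F \<and> x \<in> below (prof F) c}"
  define in_run where "in_run a \<longleftrightarrow> face a = F \<and> covers_of F c (pos a)" for a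
  define Y where "Y = {e \<in> edges. Inl e \<in> Z}"
  define Y' where "Y' = {e \<in> Y. in_run e \<noteq> in_run (arev e)}"
  have dn: "dnode a \<in> S \<longleftrightarrow> in_run a" for a
    using gap_node_below[OF c] by (auto simp: dnode_def in_run_def S_def)
  have ch: "(Inr (F', d) \<in> cutset dsrc dtgt Z S) \<longleftrightarrow> Inr (F', d) \<in> Z \<and> F' = F \<and> d = c" for F' d
  proof (cases "Inr (F', d) \<in> Z")
    case True
    then have "d \<in> chords_of F'" using Z(1) by (auto simp: dedges_def all_chords_def)
    then show ?thesis using chord_separates_below[OF c, of d] by (auto simp: cutset_def dsrc_def dtgt_def S_def)
  qed (simp add: cutset_def)
  have ed: "Inl e \<in> cutset dsrc dtgt Z S \<longleftrightarrow> e \<in> Y'" for e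
  proof (cases "Inl e \<in> Z")
    case True
    then have "e \<in> edges" using Z(1) by (auto simp: dedges_def)
    then show ?thesis using True unfolding cutset_def dsrc_def dtgt_def Y'_def Y_def
      by (simp only: mem_Collect_eq sum.case o_apply dn simp_thms)
  qed (simp add: cutset_def Y'_def Y_def)
  have "cutset dsrc dtgt Z S = Y' <+> {x. x = (F, c) \<and> Inr x \<in> Z}"
  proof (rule set_eqI)
    fix x
    show "x \<in> cutset dsrc dtgt Z S \<longleftrightarrow> x \<in> Y' <+> {x. x = (F, c) \<and> Inr x \<in> Z}"
    proof (cases x)
      case (Inl e)
      then show ?thesis using ed[of e] by auto
    next
      case (Inr y)
      then show ?thesis using ch[of "fst y" "snd y"] by (cases y) auto
    qed
  qed
  moreover have finY': "finite Y'" by (simp add: Y'_def Y_def)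
  moreover have fin2: "finite {x. x = (F, c) \<and> Inr x \<in> Z}" by simp
  ultimately have "card (cutset dsrc dtgt Z S) = card Y' + card {x. x = (F, c) \<and> Inr x \<in> Z}"
    by (simp only: card_Plus)
  moreover have "card {x. x = (F, c) \<and> Inr x \<in> Z} = of_bool (Inr (F, c) \<in> Z)"
    by (cases "Inr (F, c) \<in> Z") (auto simp: Collect_conv_if)
  ultimately have par: "Inr (F, c) \<in> Z \<longleftrightarrow> odd (card Y')"
    using even_set_cutset[OF Z(2), of S] by (auto simp: of_bool_def split: if_splits)
  have "card Y' = (\<Sum>e\<in>Y. of_bool (in_run e \<noteq> in_run (arev e)))"
    by (simp add: Y'_def of_bool_def sum.If_cases Int_def Y_def)
  also have "even \<dots> \<longleftrightarrow> even (\<Sum>e\<in>Y. of_bool (in_run e) + of_bool (in_run (arev e)) :: nat)"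
    by (rule even_sum_add) auto
  also have "(\<Sum>e\<in>Y. of_bool (in_run e) + of_bool (in_run (arev e)) :: nat)
      = (\<Sum>a | a \<in> arcs G \<and> rep a \<in> Y. of_bool (in_run a))"
    by (rule sum_edges_as_arcs) (auto simp: Y_def)
  also have "\<dots> = card {a \<in> {a. a \<in> arcs G \<and> rep a \<in> Y}. in_run a}"
    by (simp add: of_bool_def sum.If_cases Int_def)
  also have "{a \<in> {a. a \<in> arcs G \<and> rep a \<in> Y}. in_run a} = {a \<in> F. Inl (rep a) \<in> Z \<and> covers_of F c (pos a)}"
  proof (intro set_eqI iffI)
    fix a assume "a \<in> {a \<in> {a. a \<in> arcs G \<and> rep a \<in> Y}. in_run a}"
    then show "a \<in> {a \<in> F. Inl (rep a) \<in> Z \<and> covers_of F c (pos a)}"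
      using self_in_face[of a] by (auto simp: Y_def in_run_def)
  next
    fix a assume "a \<in> {a \<in> F. Inl (rep a) \<in> Z \<and> covers_of F c (pos a)}"
    then show "a \<in> {a \<in> {a. a \<in> arcs G \<and> rep a \<in> Y}. in_run a}"
      using face_memD[OF F, of a] by (auto simp: Y_def in_run_def)
  qed
  finally show ?thesis using par by simp
qed

section \<open>Seymour's bound for non-crossing chords\<close>

definition crossings :: "'b set \<Rightarrow> 'a set \<Rightarrow> nat set" where
  "crossings F S = {i. i < card F \<and> (vert_at F i \<in> S) \<noteq> (vert_at F (Suc i) \<in> S)}"

text \<open>These are the chords whose end vertices lie on different sides of \<open>S\<close>: the
  facial walk between the ends changes sides an odd number of times.\<close>

definition crossed_chords :: "'b set \<Rightarrow> 'a set \<Rightarrow> (nat \<times> nat) set" where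
  "crossed_chords F S = {c \<in> chords_of F. odd (card {i \<in> crossings F S. covers_of F c i})}"

lemma crossings_arcs:
  assumes F: "F \<in> \<F>"
  shows "card {a \<in> F. rep a \<in> cut S \<and> P (pos a)} = card {i \<in> crossings F S. P i}"
proof -
  have "{a \<in> F. rep a \<in> cut S \<and> P (pos a)} = arc_at F ` {i \<in> crossings F S. P i}"
  proof (intro set_eqI iffI)
    fix a assume a: "a \<in> {a \<in> F. rep a \<in> cut S \<and> P (pos a)}"
    then have aG: "a \<in> arcs G" "face a = F" using face_memD[OF F] by auto
    then have i: "pos a < card F" "arc_at F (pos a) = a" using pos[OF aG(1)] by auto
    have "pos a \<in> crossings F S"
      using rep_in_cut[OF aG(1), of S] a i vert_at_Suc(1)[OF F i(1)] by (auto simp: crossings_def vert_at_def)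
    then show "a \<in> arc_at F ` {i \<in> crossings F S. P i}" using a i by (intro image_eqI[of _ _ "pos a"]) auto
  next
    fix a assume "a \<in> arc_at F ` {i \<in> crossings F S. P i}"
    then obtain i where i: "i \<in> crossings F S" "P i" "a = arc_at F i" by auto
    then have "i < card F" by (simp add: crossings_def)
    note at = arc_at_in[OF F this] vert_at_Suc(1)[OF F this]
    show "a \<in> {a \<in> F. rep a \<in> cut S \<and> P (pos a)}"
      using i at rep_in_cut[OF at(2), of S] by (auto simp: crossings_def vert_at_def)
  qed
  moreover have "inj_on (arc_at F) {i \<in> crossings F S. P i}"
    using bij_arc_at(1)[OF F] by (auto simp: bij_betw_def crossings_def inj_on_def)
  ultimately show ?thesis by (simp add: card_image)
qed

text \<open>The cut hypothesis is restricted to cuts with at most two crossings per face. They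
  suffice because conservativeness is checked on circuits of the dual, which have degree at most 2
  at each face.\<close>

theorem sum_chords_le:
  fixes cap :: "'b \<Rightarrow> nat"
  assumes metric: "pseudometric_on (verts G) \<delta>"
    and cut: "\<And>S. S \<subseteq> verts G \<Longrightarrow> (\<And>F. F \<in> \<F> \<Longrightarrow> card (crossings F S) = 0 \<or> card (crossings F S) = 2)
      \<Longrightarrow> (\<Sum>F\<in>\<F>. card (crossed_chords F S)) \<le> sum cap (cut S)"
  shows "(\<Sum>F\<in>\<F>. \<Sum>c\<in>chords_of F. \<delta> (vert_at F (fst c)) (vert_at F (run_end (prof F) (card F) c)))
    \<le> (\<Sum>e\<in>edges. real (cap e) * \<delta> (tail G e) (head G e))"
proof -
  interpret pseudometric_on "verts G" \<delta> by (rule metric)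
  \<comment> \<open>The chords that the edge set \<open>Y\<close> forces into an even set of the
    extended dual.\<close>
  define odd_chords where
    "odd_chords Y = {(F, c) \<in> all_chords. odd (card {a \<in> F. rep a \<in> Y \<and> covers_of F c (pos a)})}" for Y
  have fin_odd: "finite (odd_chords Y)" for Y
    by (rule finite_subset[OF _ finite_all_chords]) (auto simp: odd_chords_def)
  have circ: "card (odd_chords C) \<le> sum cap C" if C: "circuit face (face \<circ> arev) C" "C \<subseteq> edges" for C
  proof -
    have ev: "even_set face (face \<circ> arev) C" using C by (simp add: circuit_def)
    obtain S where S: "S \<subseteq> verts G" "C = cut S" by (rule even_dual_set_is_cut[OF C(2) ev])
    have "card (crossings F S) = 0 \<or> card (crossings F S) = 2" if F: "F \<in> \<F>" for F
    proof -
      have "card (crossings F S) = incidence face (face \<circ> arev) C F"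
        using dual_incidence[OF C(2) F] crossings_arcs[OF F, of S "\<lambda>_. True"] S by simp
      moreover have "incidence face (face \<circ> arev) C F \<le> 2" by (rule circuit_incidence_le[OF C(1)])
      moreover have "even (incidence face (face \<circ> arev) C F)" using ev by (simp add: even_set_def)
      moreover have "n = 0 \<or> n = 2" if "n \<le> 2" "even n" for n :: nat
        using that by (cases "n = 1") auto
      ultimately show ?thesis by metis
    qed
    then have "(\<Sum>F\<in>\<F>. card (crossed_chords F S)) \<le> sum cap C" using cut[OF S(1)] S(2) by simp
    moreover have "odd_chords C = Sigma (\<F>) (\<lambda>F. crossed_chords F S)"
      unfolding odd_chords_def all_chords_def crossed_chords_def S(2)
      using crossings_arcs by auto
    then have "card (odd_chords C) = (\<Sum>F\<in>\<F>. card (crossed_chords F S))"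
      by (simp add: card_SigmaI crossed_chords_def)
    ultimately show ?thesis by simp
  qed
  have odd_le: "card (odd_chords Y) \<le> sum cap Y"
    if Y: "even_set face (face \<circ> arev) Y" "Y \<subseteq> edges" for Y
    using Y(1)
  proof (rule even_set_circuit_induct)
    show "card (odd_chords {}) \<le> sum cap {}" by (simp add: odd_chords_def)
  next
    fix C Z assume C: "circuit face (face \<circ> arev) C" "C \<subseteq> Y"
      and Z: "Z \<subseteq> Y" "C \<inter> Z = {}" "card (odd_chords Z) \<le> sum cap Z"
    have fin: "finite C" "finite Z" using C Z Y(2) finite_subset[OF _ finite_edges] by (meson order_trans)+
    \<comment> \<open>If a sum of two counts is odd, one of them is odd; thus the bound passes from
      circuits to all even sets.\<close>
    have "odd_chords (C \<union> Z) \<subseteq> odd_chords C \<union> odd_chords Z"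
    proof
      fix x assume x: "x \<in> odd_chords (C \<union> Z)"
      obtain F c where Fc: "x = (F, c)" by (cases x)
      then have F: "F \<in> \<F>" using x by (auto simp: odd_chords_def all_chords_def)
      have finF: "finite F" using F card_face_pos card_gt_0_iff by blast
      have "{a \<in> F. rep a \<in> C \<union> Z \<and> covers_of F c (pos a)}
          = {a \<in> F. rep a \<in> C \<and> covers_of F c (pos a)} \<union> {a \<in> F. rep a \<in> Z \<and> covers_of F c (pos a)}"
        by auto
      then have "card {a \<in> F. rep a \<in> C \<union> Z \<and> covers_of F c (pos a)}
          = card {a \<in> F. rep a \<in> C \<and> covers_of F c (pos a)} + card {a \<in> F. rep a \<in> Z \<and> covers_of F c (pos a)}"
        using finF Z(2) by (simp add: card_Un_disjoint disjoint_iff)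
      then show "x \<in> odd_chords C \<union> odd_chords Z" using x Fc by (auto simp: odd_chords_def)
    qed
    then have "card (odd_chords (C \<union> Z)) \<le> card (odd_chords C \<union> odd_chords Z)"
      using fin_odd by (intro card_mono) auto
    also have "\<dots> \<le> card (odd_chords C) + card (odd_chords Z)" by (rule card_Un_le)
    also have "\<dots> \<le> sum cap C + sum cap Z" using circ[OF C(1)] C(2) Y(2) Z(3) by (intro add_mono) auto
    also have "\<dots> = sum cap (C \<union> Z)" using fin Z(2) by (simp add: sum.union_disjoint)
    finally show "card (odd_chords (C \<union> Z)) \<le> sum cap (C \<union> Z)" .
  qed
  \<comment> \<open>Capacities on edges and unit demands on chords, doubled so that every sum is
    even as \<open>sum_of_circuits_dual\<close> demands.\<close>
  define w :: "'b + 'b set \<times> nat \<times> nat \<Rightarrow> int" where "w = case_sum (\<lambda>e. 2 * int (cap e)) (\<lambda>_. - 2)"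
  define p where "p x = \<delta> (psrc x) (ptgt x)" for x
  have "0 \<le> (\<Sum>x\<in>dedges. real_of_int (w x) * p x)"
  proof (rule sum_of_circuits_dual[where s = dsrc and t = dtgt])
    show "finite dedges" by simp
    show "0 \<le> p x" if "x \<in> dedges" for x using ends_in_verts[OF that] nonneg by (simp add: p_def)
    show "p f \<le> sum p (cutset dsrc dtgt dedges S - {f})" if "f \<in> cutset dsrc dtgt dedges S" for S f
      unfolding p_def
      by (rule even_set_le[OF even_set_dual_cutset that]) (use ends_in_verts in \<open>auto simp: cutset_def\<close>)
  next
    fix Z assume Z: "Z \<subseteq> dedges" "even_set dsrc dtgt Z"
    define Y where "Y = {e \<in> edges. Inl e \<in> Z}"
    have Y: "Y \<subseteq> edges" "even_set face (face \<circ> arev) Y" using even_set_edge_part[OF Z] by (auto simp: Y_def)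
    have "Z = Y <+> odd_chords Y"
    proof (rule set_eqI)
      fix x
      show "x \<in> Z \<longleftrightarrow> x \<in> Y <+> odd_chords Y"
      proof (cases x)
        case (Inl e)
        then show ?thesis using Z(1) by (auto simp: Y_def dedges_def)
      next
        case (Inr y)
        obtain F c where y: "y = (F, c)" by (cases y)
        show ?thesis
        proof (cases "y \<in> all_chords")
          case True
          then have F: "F \<in> \<F>" "c \<in> chords_of F" using y by (auto simp: all_chords_def)
          have "{a \<in> F. Inl (rep a) \<in> Z \<and> covers_of F c (pos a)} = {a \<in> F. rep a \<in> Y \<and> covers_of F c (pos a)}"
            using face_memD(1)[OF F(1)] by (auto simp: Y_def)
          then show ?thesis using chord_in_even_set[OF Z F] True Inr y by (auto simp: odd_chords_def)
        next
          case False
          then show ?thesis using Inr Z(1) by (auto simp: dedges_def odd_chords_def)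
        qed
      qed
    qed
    then have "sum w Z = (\<Sum>e\<in>Y. 2 * int (cap e)) + (\<Sum>x\<in>odd_chords Y. - 2)"
      using fin_odd finite_subset[OF Y(1) finite_edges] by (simp only: sum.Plus) (simp add: w_def)
    also have "\<dots> = 2 * (int (sum cap Y) - int (card (odd_chords Y)))"
      by (simp add: sum_distrib_left[symmetric])
    finally have sum_w: "sum w Z = 2 * (int (sum cap Y) - int (card (odd_chords Y)))" .
    have "int (card (odd_chords Y)) \<le> int (sum cap Y)"
      using odd_le[OF Y(2,1)] by (simp only: of_nat_le_iff)
    then show "0 \<le> sum w Z \<and> even (sum w Z)" unfolding sum_w by simp
  qed
  also have "(\<Sum>x\<in>dedges. real_of_int (w x) * p x)
      = 2 * (\<Sum>e\<in>edges. real (cap e) * \<delta> (tail G e) (head G e))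
        - 2 * (\<Sum>x\<in>all_chords. \<delta> (psrc (Inr x)) (ptgt (Inr x)))"
    unfolding dedges_def
    by (simp add: sum.Plus w_def p_def sum_distrib_left sum_negf psrc_def ptgt_def mult.assoc)
  also have "(\<Sum>x\<in>all_chords. \<delta> (psrc (Inr x)) (ptgt (Inr x)))
      = (\<Sum>F\<in>\<F>. \<Sum>c\<in>chords_of F. \<delta> (vert_at F (fst c)) (vert_at F (run_end (prof F) (card F) c)))"
    unfolding all_chords_def by (subst sum.Sigma) (auto simp: psrc_def ptgt_def case_prod_beta)
  finally show ?thesis by simp
qed

end

section \<open>Separable demands on a cycle\<close>

definition splits :: "nat \<Rightarrow> nat \<Rightarrow> nat \<Rightarrow> nat \<Rightarrow> bool" where
  "splits i j p q \<longleftrightarrow> (p \<le> i \<and> i < q) \<noteq> (p \<le> j \<and> j < q)"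

lemma sum_mixed_difference:
  fixes d :: "nat \<Rightarrow> nat \<Rightarrow> real"
  assumes "x \<le> y" "z \<le> u"
  shows "(\<Sum>j\<in>{z..<u}. \<Sum>i\<in>{x..<y}. d i j + d (Suc i) (Suc j) - d i (Suc j) - d (Suc i) j)
    = d x z + d y u - d x u - d y z"
proof -
  have inner: "(\<Sum>i\<in>{x..<y}. d i j + d (Suc i) (Suc j) - d i (Suc j) - d (Suc i) j)
      = (d y (Suc j) - d x (Suc j)) - (d y j - d x j)" for j
  proof -
    have "(\<Sum>i\<in>{x..<y}. d i j + d (Suc i) (Suc j) - d i (Suc j) - d (Suc i) j)
        = (\<Sum>i\<in>{x..<y}. d (Suc i) (Suc j) - d i (Suc j)) - (\<Sum>i\<in>{x..<y}. d (Suc i) j - d i j)"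
      unfolding sum_subtractf[symmetric] by (rule sum.cong) auto
    then show ?thesis
      using sum_Suc_diff'[OF assms(1), of "\<lambda>i. d i (Suc j)"] sum_Suc_diff'[OF assms(1), of "\<lambda>i. d i j"] by simp
  qed
  have "(\<Sum>j\<in>{z..<u}. (d y (Suc j) - d x (Suc j)) - (d y j - d x j)) = (d y u - d x u) - (d y z - d x z)"
    using sum_Suc_diff'[OF assms(2), of "\<lambda>j. d y j - d x j"] by simp
  then show ?thesis unfolding inner by simp
qed

text \<open>
  The positions \<open>0\<close> and \<open>N\<close> coincide. Only the crossing inequalities for consecutive positions are
  needed, since they say that the weights in the decomposition into pairs of gaps are nonnegative.
\<close>

locale cyclic_metric =
  fixes N :: nat and d :: "nat \<Rightarrow> nat \<Rightarrow> real"
  assumes d_refl: "i \<le> N \<Longrightarrow> d i i = 0"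
    and d_sym: "i \<le> N \<Longrightarrow> j \<le> N \<Longrightarrow> d i j = d j i"
    and d_wrap: "i \<le> N \<Longrightarrow> d i N = d i 0"
    and kalmanson: "i < j \<Longrightarrow> j < N \<Longrightarrow> d i (Suc j) + d (Suc i) j \<le> d i j + d (Suc i) (Suc j)"
begin

definition split_weight :: "nat \<Rightarrow> nat \<Rightarrow> real" where
  "split_weight i j = d i j + d (Suc i) (Suc j) - d i (Suc j) - d (Suc i) j"

text \<open>The pairs of gaps that split \<open>p\<close> from \<open>q\<close> form two rectangles
  of indices. On each of them the mixed differences telescope to \<open>d p q\<close> plus boundary
  terms, and these cancel because positions 0 and \<open>N\<close> coincide; hence the factor
  2.\<close>

lemma dist_as_splits:
  assumes pq: "p \<le> q" "q \<le> N"
  shows "2 * d p q = (\<Sum>j<N. \<Sum>i<j. of_bool (splits i j p q) * split_weight i j)"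
proof -
  have "(\<Sum>j<N. \<Sum>i<j. of_bool (splits i j p q) * split_weight i j)
      = (\<Sum>j<N. (if j \<in> {p..<q} then \<Sum>i\<in>{0..<p}. split_weight i j else 0)
          + (if j \<in> {q..<N} then \<Sum>i\<in>{p..<q}. split_weight i j else 0))"
  proof (rule sum.cong)
    fix j assume "j \<in> {..<N}"
    then have j: "j < N" by simp
    have "(\<Sum>i<j. of_bool (splits i j p q) * split_weight i j)
        = (\<Sum>i<j. if splits i j p q then split_weight i j else 0)"
      by (rule sum.cong) auto
    also have "\<dots> = (\<Sum>i\<in>{i\<in>{..<j}. splits i j p q}. split_weight i j)"
      by (simp only: sum.inter_filter[OF finite_lessThan])
    also have "{i\<in>{..<j}. splits i j p q} = (if j < p then {} else if j < q then {0..<p} else {p..<q})"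
      using pq by (auto simp: splits_def)
    finally show "(\<Sum>i<j. of_bool (splits i j p q) * split_weight i j)
        = (if j \<in> {p..<q} then \<Sum>i\<in>{0..<p}. split_weight i j else 0)
          + (if j \<in> {q..<N} then \<Sum>i\<in>{p..<q}. split_weight i j else 0)"
      using j pq by auto
  qed simp
  also have "\<dots> = (\<Sum>j\<in>{p..<q}. \<Sum>i\<in>{0..<p}. split_weight i j) + (\<Sum>j\<in>{q..<N}. \<Sum>i\<in>{p..<q}. split_weight i j)"
  proof -
    have "{..<N} \<inter> {p..<q} = {p..<q}" "{..<N} \<inter> {q..<N} = {q..<N}" using pq by auto
    then show ?thesis unfolding sum.distrib by (simp only: sum.inter_restrict[symmetric] finite_lessThan)
  qed
  also have "\<dots> = (d 0 p + d p q - d 0 q - d p p) + (d p q + d q N - d p N - d q q)"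
    unfolding split_weight_def using pq by (simp add: sum_mixed_difference)
  also have "\<dots> = 2 * d p q"
    using d_refl[of p] d_refl[of q] d_wrap[of p] d_wrap[of q] d_sym[of p 0] d_sym[of q 0] pq by simp
  finally show ?thesis by simp
qed

lemma split_weight_nonneg: "i < j \<Longrightarrow> j < N \<Longrightarrow> 0 \<le> split_weight i j"
  using kalmanson[of i j] by (simp add: split_weight_def)

lemma sum_dist_as_splits:
  assumes "finite A" "\<And>a. a \<in> A \<Longrightarrow> p a \<le> q a \<and> q a \<le> N"
  shows "2 * (\<Sum>a\<in>A. d (p a) (q a))
    = (\<Sum>j<N. \<Sum>i<j. real (card {a \<in> A. splits i j (p a) (q a)}) * split_weight i j)"
proof -
  have "2 * (\<Sum>a\<in>A. d (p a) (q a)) = (\<Sum>a\<in>A. \<Sum>j<N. \<Sum>i<j. of_bool (splits i j (p a) (q a)) * split_weight i j)"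
    unfolding sum_distrib_left by (rule sum.cong) (use assms(2) dist_as_splits in auto)
  also have "\<dots> = (\<Sum>j<N. \<Sum>a\<in>A. \<Sum>i<j. of_bool (splits i j (p a) (q a)) * split_weight i j)"
    by (rule sum.swap)
  also have "\<dots> = (\<Sum>j<N. \<Sum>i<j. \<Sum>a\<in>A. of_bool (splits i j (p a) (q a)) * split_weight i j)"
    by (intro sum.cong refl sum.swap)
  also have "\<dots> = (\<Sum>j<N. \<Sum>i<j. real (card {a \<in> A. splits i j (p a) (q a)}) * split_weight i j)"
    unfolding sum_distrib_right[symmetric] using assms(1)
    by (simp add: of_bool_def sum.If_cases Int_def)
  finally show ?thesis .
qed

text \<open>As the split weights are nonnegative, counting on each single pair of gaps compares the
  sums of distances.\<close>

lemma sum_dist_mono: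
  assumes A: "finite A" "\<And>a. a \<in> A \<Longrightarrow> p a \<le> q a \<and> q a \<le> N"
    and B: "finite B" "\<And>b. b \<in> B \<Longrightarrow> p' b \<le> q' b \<and> q' b \<le> N"
    and C: "finite C" "\<And>c. c \<in> C \<Longrightarrow> p'' c \<le> q'' c \<and> q'' c \<le> N"
    and le: "\<And>i j. i < j \<Longrightarrow> j < N \<Longrightarrow> card {a \<in> A. splits i j (p a) (q a)}
      \<le> card {b \<in> B. splits i j (p' b) (q' b)} + card {c \<in> C. splits i j (p'' c) (q'' c)}"
  shows "(\<Sum>a\<in>A. d (p a) (q a)) \<le> (\<Sum>b\<in>B. d (p' b) (q' b)) + (\<Sum>c\<in>C. d (p'' c) (q'' c))"
proof -
  have "2 * (\<Sum>a\<in>A. d (p a) (q a))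
      = (\<Sum>j<N. \<Sum>i<j. real (card {a \<in> A. splits i j (p a) (q a)}) * split_weight i j)"
    by (rule sum_dist_as_splits[OF A])
  also have "\<dots> \<le> (\<Sum>j<N. \<Sum>i<j. (real (card {b \<in> B. splits i j (p' b) (q' b)})
      + real (card {c \<in> C. splits i j (p'' c) (q'' c)})) * split_weight i j)"
    by (intro sum_mono mult_right_mono split_weight_nonneg) (use le in \<open>auto simp flip: of_nat_add\<close>)
  also have "\<dots> = (\<Sum>j<N. \<Sum>i<j. real (card {b \<in> B. splits i j (p' b) (q' b)}) * split_weight i j)
      + (\<Sum>j<N. \<Sum>i<j. real (card {c \<in> C. splits i j (p'' c) (q'' c)}) * split_weight i j)"
    by (simp add: sum.distrib distrib_right)
  also have "\<dots> = 2 * (\<Sum>b\<in>B. d (p' b) (q' b)) + 2 * (\<Sum>c\<in>C. d (p'' c) (q'' c))"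
    using sum_dist_as_splits[OF B] sum_dist_as_splits[OF C] by simp
  finally show ?thesis by simp
qed

end

lemma chords_splits:
  assumes "c \<in> chords h N" "i < N" "j < N"
  shows "splits i j (fst c) (run_end h N c) \<longleftrightarrow> covers h c i \<noteq> covers h c j"
  using run_end(3)[OF assms(1)] assms(2,3) by (auto simp: splits_def)

lemma card_le_add_card:
  assumes "finite B" "finite C" "A \<subseteq> B \<union> C"
  shows "card A \<le> card B + card C"
  using card_mono[of "B \<union> C" A] card_Un_le[of B C] assms by simp

section \<open>Replacing separable demands by non-crossing ones\<close>

locale separable_demands =
  fixes D :: "'d set" and \<xi> \<eta> :: "'d \<Rightarrow> nat" and n N :: nat
  assumes finD [simp]: "finite D"
    and \<xi>: "x \<in> D \<Longrightarrow> \<xi> x < n" and \<eta>: "x \<in> D \<Longrightarrow> n \<le> \<eta> x \<and> \<eta> x < N"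
begin

text \<open>
  \<open>nested_profile\<close> is the profile of the nested matching of sources and sinks. A pair of gaps \<open>i < n \<le> k\<close>
  is crossed \<open>2 * twist i k\<close> more times by the demands than by the nested matching, so the chords of
  \<open>twist_profile\<close>, which lie over the sources only or over the sinks only, make up for the difference.
\<close>

definition crossing :: "nat \<Rightarrow> nat \<Rightarrow> nat" where
  "crossing i j = card {x \<in> D. splits i j (\<xi> x) (\<eta> x)}"

definition nested_profile :: "nat \<Rightarrow> nat" where
  "nested_profile i = card {x \<in> D. \<xi> x \<le> i \<and> i < \<eta> x}"

definition twist :: "nat \<Rightarrow> nat \<Rightarrow> nat" where
  "twist i k = min (card {x \<in> D. \<xi> x \<le> i \<and> \<eta> x \<le> k}) (card {x \<in> D. i < \<xi> x \<and> k < \<eta> x})"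

text \<open>A height may depend on one gap only, so it takes the largest shortage over all partner
  gaps. \<open>insert 0\<close> keeps \<open>Max\<close> defined for \<open>N = 0\<close>.\<close>

definition twist_src :: "nat \<Rightarrow> nat" where
  "twist_src i = Max (insert 0 (twist i ` {..<N}))"

definition twist_tgt :: "nat \<Rightarrow> nat" where
  "twist_tgt k = Max (insert 0 ((\<lambda>i. twist i k) ` {..<N}))"

definition twist_profile :: "nat \<Rightarrow> nat" where
  "twist_profile i = twist_src i + twist_tgt i"

text \<open>Holds demand by demand: an interval that contains both outer gaps contains
  \<open>k\<close>, and one that contains just one of them is counted by
  \<open>crossing\<close>.\<close>

lemma nested_profile_le:
  assumes "i1 \<le> k" "k \<le> i2"
  shows "nested_profile i1 + nested_profile i2 \<le> crossing i1 i2 + 2 * nested_profile k"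
proof -
  have card: "card {x \<in> D. P x} = (\<Sum>x\<in>D. of_bool (P x))" for P
    by (simp add: of_bool_def sum.If_cases Int_def)
  have "nested_profile i1 + nested_profile i2
      = (\<Sum>x\<in>D. of_bool (\<xi> x \<le> i1 \<and> i1 < \<eta> x) + of_bool (\<xi> x \<le> i2 \<and> i2 < \<eta> x))"
    unfolding nested_profile_def card by (simp only: sum.distrib)
  also have "\<dots> \<le> (\<Sum>x\<in>D. of_bool (splits i1 i2 (\<xi> x) (\<eta> x)) + 2 * of_bool (\<xi> x \<le> k \<and> k < \<eta> x))"
    by (rule sum_mono) (use assms in \<open>auto simp: splits_def of_bool_def\<close>)
  also have "\<dots> = crossing i1 i2 + 2 * nested_profile k"
    unfolding nested_profile_def crossing_def card by (simp only: sum.distrib sum_distrib_left)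
  finally show ?thesis .
qed

lemma twist_src_eq_0: "n \<le> Suc i \<Longrightarrow> twist_src i = 0"
proof -
  assume n: "n \<le> Suc i"
  have E: "{x \<in> D. i < \<xi> x \<and> k < \<eta> x} = {}" for k using \<xi> n by fastforce
  have "twist i k = 0" for k unfolding twist_def E by simp
  then show ?thesis by (auto simp: twist_src_def image_constant_conv)
qed

lemma twist_tgt_eq_0: "k < n \<Longrightarrow> twist_tgt k = 0"
proof -
  assume n: "k < n"
  have E: "{x \<in> D. \<xi> x \<le> i \<and> \<eta> x \<le> k} = {}" for i using \<eta> n by fastforce
  have "twist i k = 0" for i unfolding twist_def E by simp
  then show ?thesis by (auto simp: twist_tgt_def image_constant_conv)
qed

lemma twist_src_attained: obtains k where "twist_src i = 0 \<or> k < N \<and> twist_src i = twist i k"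
proof -
  have "twist_src i \<in> insert 0 (twist i ` {..<N})" unfolding twist_src_def by (rule Max_in) auto
  then show ?thesis using that by auto
qed

lemma twist_tgt_attained: obtains i where "twist_tgt k = 0 \<or> i < N \<and> twist_tgt k = twist i k"
proof -
  have "twist_tgt k \<in> insert 0 ((\<lambda>i. twist i k) ` {..<N})" unfolding twist_tgt_def by (rule Max_in) auto
  then show ?thesis using that by auto
qed

lemma twist_le_src: "k < N \<Longrightarrow> twist i k \<le> twist_src i"
  unfolding twist_src_def by (rule Max_ge) auto

lemma twist_le_tgt: "i < N \<Longrightarrow> twist i k \<le> twist_tgt k"
  unfolding twist_tgt_def by (rule Max_ge) auto

text \<open>Moving the gap changes both counts in \<open>twist\<close> by at most the number of
  sources passed, and so does the maximum.\<close>

lemma twist_src_diff: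
  assumes "{x \<in> D. (\<xi> x \<le> i) \<noteq> (\<xi> x \<le> j)} \<subseteq> X" "finite X"
  shows "twist_src i \<le> twist_src j + card X"
proof -
  obtain k where k: "twist_src i = 0 \<or> k < N \<and> twist_src i = twist i k" by (rule twist_src_attained)
  have "twist i k \<le> twist j k + card X"
  proof -
    have "card {x \<in> D. \<xi> x \<le> i \<and> \<eta> x \<le> k} \<le> card {x \<in> D. \<xi> x \<le> j \<and> \<eta> x \<le> k} + card X"
      by (rule card_le_add_card) (use assms in auto)
    moreover have "card {x \<in> D. i < \<xi> x \<and> k < \<eta> x} \<le> card {x \<in> D. j < \<xi> x \<and> k < \<eta> x} + card X"
      by (rule card_le_add_card) (use assms in fastforce)+
    ultimately show ?thesis by (auto simp: twist_def)
  qed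
  then show ?thesis using k twist_le_src[of k j] by auto
qed

lemma twist_tgt_diff:
  assumes "{x \<in> D. (\<eta> x \<le> i) \<noteq> (\<eta> x \<le> j)} \<subseteq> X" "finite X"
  shows "twist_tgt i \<le> twist_tgt j + card X"
proof -
  obtain k where k: "twist_tgt i = 0 \<or> k < N \<and> twist_tgt i = twist k i" by (rule twist_tgt_attained)
  have "twist k i \<le> twist k j + card X"
  proof -
    have "card {x \<in> D. \<xi> x \<le> k \<and> \<eta> x \<le> i} \<le> card {x \<in> D. \<xi> x \<le> k \<and> \<eta> x \<le> j} + card X"
      by (rule card_le_add_card) (use assms in auto)
    moreover have "card {x \<in> D. k < \<xi> x \<and> i < \<eta> x} \<le> card {x \<in> D. k < \<xi> x \<and> j < \<eta> x} + card X"
      by (rule card_le_add_card) (use assms in fastforce)+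
    ultimately show ?thesis by (auto simp: twist_def)
  qed
  then show ?thesis using k twist_le_tgt[of k j] by auto
qed

lemma crossing_src: "i1 \<le> i2 \<Longrightarrow> i2 < n \<Longrightarrow> crossing i1 i2 = card {x \<in> D. i1 < \<xi> x \<and> \<xi> x \<le> i2}"
  unfolding crossing_def by (rule arg_cong[of _ _ card]) (use \<eta> in \<open>fastforce simp: splits_def\<close>)

lemma crossing_tgt: "i1 \<le> i2 \<Longrightarrow> n \<le> Suc i1 \<Longrightarrow> crossing i1 i2 = card {x \<in> D. i1 < \<eta> x \<and> \<eta> x \<le> i2}"
  unfolding crossing_def by (rule arg_cong[of _ _ card]) (use \<xi> in \<open>fastforce simp: splits_def\<close>)

lemma crossing_mixed:
  assumes "Suc i1 < n" "n \<le> i2"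
  shows "crossing i1 i2 = card {x \<in> D. \<xi> x \<le> i1 \<and> \<eta> x \<le> i2} + card {x \<in> D. i1 < \<xi> x \<and> i2 < \<eta> x}"
proof -
  have "{x \<in> D. splits i1 i2 (\<xi> x) (\<eta> x)}
      = {x \<in> D. \<xi> x \<le> i1 \<and> \<eta> x \<le> i2} \<union> {x \<in> D. i1 < \<xi> x \<and> i2 < \<eta> x}"
    using assms \<xi> \<eta> by (fastforce simp: splits_def)
  then show ?thesis unfolding crossing_def by (simp, subst card_Un_disjoint) auto
qed

text \<open>Within one side the heights vary by at most the number of demand ends passed, which is
  the crossing number. For a mixed pair, monotonicity of the two counts under the minimum bounds
  each height by the crossing number. Adding the two gaps gives the factor 2.\<close>

lemma twist_profile_le:
  assumes k: "i1 \<le> k" "k \<le> i2"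
  shows "twist_profile i1 + twist_profile i2 \<le> 2 * crossing i1 i2 + 2 * twist_profile k"
proof -
  \<comment> \<open>Gap \<open>n - 1\<close>, between the two sides, counts as belonging to both; a
    pair is mixed only if this gap lies strictly inside.\<close>
  consider "i2 < n" | "n \<le> Suc i1" | "Suc i1 < n" "n \<le> i2" by linarith
  then show ?thesis
  proof cases
    case 1
    have "twist_src i1 \<le> twist_src k + crossing i1 i2" "twist_src i2 \<le> twist_src k + crossing i1 i2"
      using crossing_src[of i1 i2] k 1 by (auto intro!: twist_src_diff)
    then show ?thesis using twist_tgt_eq_0 1 k by (simp add: twist_profile_def)
  next
    case 2
    have "twist_tgt i1 \<le> twist_tgt k + crossing i1 i2" "twist_tgt i2 \<le> twist_tgt k + crossing i1 i2"
      using crossing_tgt[of i1 i2] k 2 by (auto intro!: twist_tgt_diff)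
    then show ?thesis using twist_src_eq_0 2 k by (simp add: twist_profile_def)
  next
    case 3
    note cr = crossing_mixed[OF 3]
    have "twist_src i1 \<le> crossing i1 i2"
    proof -
      obtain j where j: "twist_src i1 = 0 \<or> j < N \<and> twist_src i1 = twist i1 j" by (rule twist_src_attained)
      have "twist i1 j \<le> crossing i1 i2"
      proof (cases "j \<le> i2")
        case True
        have "card {x \<in> D. \<xi> x \<le> i1 \<and> \<eta> x \<le> j} \<le> card {x \<in> D. \<xi> x \<le> i1 \<and> \<eta> x \<le> i2}"
          by (rule card_mono) (use True in auto)
        then show ?thesis using cr by (simp add: twist_def)
      next
        case False
        have "card {x \<in> D. i1 < \<xi> x \<and> j < \<eta> x} \<le> card {x \<in> D. i1 < \<xi> x \<and> i2 < \<eta> x}"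
          by (rule card_mono) (use False in auto)
        then show ?thesis using cr by (simp add: twist_def)
      qed
      then show ?thesis using j by auto
    qed
    moreover have "twist_tgt i2 \<le> crossing i1 i2"
    proof -
      obtain j where j: "twist_tgt i2 = 0 \<or> j < N \<and> twist_tgt i2 = twist j i2" by (rule twist_tgt_attained)
      have "twist j i2 \<le> crossing i1 i2"
      proof (cases "j \<le> i1")
        case True
        have "card {x \<in> D. \<xi> x \<le> j \<and> \<eta> x \<le> i2} \<le> card {x \<in> D. \<xi> x \<le> i1 \<and> \<eta> x \<le> i2}"
          by (rule card_mono) (use True in auto)
        then show ?thesis using cr by (simp add: twist_def)
      next
        case False
        have "card {x \<in> D. j < \<xi> x \<and> i2 < \<eta> x} \<le> card {x \<in> D. i1 < \<xi> x \<and> i2 < \<eta> x}"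
          by (rule card_mono) (use False in auto)
        then show ?thesis using cr by (simp add: twist_def)
      qed
      then show ?thesis using j by auto
    qed
    ultimately show ?thesis using twist_tgt_eq_0[of i1] twist_src_eq_0[of i2] 3 by (simp add: twist_profile_def)
  qed
qed

text \<open>Within one side the nested matching already crosses as often as the demands. For a mixed
  pair the twist heights, each at least \<open>min ?a ?b\<close>, cover its shortage. The bounds
  \<open>m\<close> and \<open>m'\<close> stand for the minima over the interval.\<close>

lemma crossing_le_profiles:
  assumes i: "i1 < i2" "i2 < N"
    and m: "\<And>k. i1 \<le> k \<Longrightarrow> k \<le> i2 \<Longrightarrow> m \<le> nested_profile k"
    and m': "\<And>k. i1 \<le> k \<Longrightarrow> k \<le> i2 \<Longrightarrow> m' \<le> twist_profile k"
  shows "crossing i1 i2 + 2 * m + 2 * m' \<le> nested_profile i1 + nested_profile i2 + twist_profile i1 + twist_profile i2"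
proof -
  have m12: "m \<le> nested_profile i1" "m \<le> nested_profile i2" "m' \<le> twist_profile i1" "m' \<le> twist_profile i2"
    using m[of i1] m[of i2] m'[of i1] m'[of i2] i by auto
  consider "i2 < n" | "n \<le> Suc i1" | "Suc i1 < n" "n \<le> i2" by linarith
  then show ?thesis
  proof cases
    case 1
    have "{x \<in> D. \<xi> x \<le> i2 \<and> i2 < \<eta> x} = {x \<in> D. \<xi> x \<le> i1 \<and> i1 < \<eta> x} \<union> {x \<in> D. i1 < \<xi> x \<and> \<xi> x \<le> i2}"
      using \<eta> 1 i by fastforce
    then have "nested_profile i2 = nested_profile i1 + crossing i1 i2"
      unfolding nested_profile_def using crossing_src[of i1 i2] i 1 by (simp, subst card_Un_disjoint) auto
    then show ?thesis using m12 by simp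
  next
    case 2
    have "{x \<in> D. \<xi> x \<le> i1 \<and> i1 < \<eta> x} = {x \<in> D. \<xi> x \<le> i2 \<and> i2 < \<eta> x} \<union> {x \<in> D. i1 < \<eta> x \<and> \<eta> x \<le> i2}"
      using \<xi> 2 i by fastforce
    then have "nested_profile i1 = nested_profile i2 + crossing i1 i2"
      unfolding nested_profile_def using crossing_tgt[of i1 i2] i 2 by (simp, subst card_Un_disjoint) auto
    then show ?thesis using m12 by simp
  next
    case 3
    let ?a = "card {x \<in> D. \<xi> x \<le> i1 \<and> \<eta> x \<le> i2}" and ?b = "card {x \<in> D. i1 < \<xi> x \<and> i2 < \<eta> x}"
    let ?v = "card {x \<in> D. \<xi> x \<le> i1 \<and> i2 < \<eta> x}"
    have "{x \<in> D. \<xi> x \<le> i1 \<and> i1 < \<eta> x} = {x \<in> D. \<xi> x \<le> i1 \<and> \<eta> x \<le> i2} \<union> {x \<in> D. \<xi> x \<le> i1 \<and> i2 < \<eta> x}"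
      using \<eta> 3 i by fastforce
    then have p1: "nested_profile i1 = ?a + ?v"
      unfolding nested_profile_def by (simp, subst card_Un_disjoint) auto
    have "{x \<in> D. \<xi> x \<le> i2 \<and> i2 < \<eta> x} = {x \<in> D. i1 < \<xi> x \<and> i2 < \<eta> x} \<union> {x \<in> D. \<xi> x \<le> i1 \<and> i2 < \<eta> x}"
      using \<xi> 3 i by fastforce
    then have p2: "nested_profile i2 = ?b + ?v"
      unfolding nested_profile_def by (simp, subst card_Un_disjoint) auto
    \<comment> \<open>The gap between sources and sinks has twist height 0, so no twist chord covers
      both gaps of a mixed pair.\<close>
    have "m' \<le> twist_profile (n - 1)" using m'[of "n - 1"] 3 by simp
    moreover have "twist_profile (n - 1) = 0"
      using twist_src_eq_0[of "n - 1"] twist_tgt_eq_0[of "n - 1"] 3 by (simp add: twist_profile_def)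
    ultimately have "m' = 0" by simp
    moreover have "min ?a ?b \<le> twist_profile i1" "min ?a ?b \<le> twist_profile i2"
      using twist_le_src[of i2 i1] twist_le_tgt[of i1 i2] i by (auto simp: twist_def twist_profile_def)
    ultimately show ?thesis using crossing_mixed[OF 3] p1 p2 m12(1,2) by (auto simp: min_def split: if_splits)
  qed
qed

lemma sum_dist_le:
  assumes "cyclic_metric N d"
  shows "(\<Sum>x\<in>D. d (\<xi> x) (\<eta> x))
    \<le> (\<Sum>c\<in>chords nested_profile N. d (fst c) (run_end nested_profile N c))
      + (\<Sum>c\<in>chords twist_profile N. d (fst c) (run_end twist_profile N c))"
proof -
  interpret cyclic_metric N d by (rule assms)
  have ends: "fst c \<le> run_end h N c \<and> run_end h N c \<le> N" if "c \<in> chords h N" for h c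
    using run_end(1,2)[OF that] by simp
  have card_splits: "card {c \<in> chords h N. splits i j (fst c) (run_end h N c)} + 2 * Min (h ` {i..j}) = h i + h j"
    if "i < j" "j < N" for h i j
  proof -
    have "{c \<in> chords h N. splits i j (fst c) (run_end h N c)} = {c \<in> chords h N. covers h c i \<noteq> covers h c j}"
      using chords_splits[of _ h N i j] that by auto
    then show ?thesis using card_chords_separating[of i j N h] that by simp
  qed
  show ?thesis
  proof (rule sum_dist_mono)
    fix i j assume ij: "i < j" "j < N"
    have "crossing i j + 2 * Min (nested_profile ` {i..j}) + 2 * Min (twist_profile ` {i..j})
        \<le> nested_profile i + nested_profile j + twist_profile i + twist_profile j"
      by (rule crossing_le_profiles[OF ij]) (auto intro!: Min_le)
    then show "card {x \<in> D. splits i j (\<xi> x) (\<eta> x)}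
        \<le> card {c \<in> chords nested_profile N. splits i j (fst c) (run_end nested_profile N c)}
          + card {c \<in> chords twist_profile N. splits i j (fst c) (run_end twist_profile N c)}"
      using card_splits[OF ij, of nested_profile] card_splits[OF ij, of twist_profile]
      by (simp add: crossing_def)
  qed (use ends \<xi> \<eta> in \<open>fastforce+\<close>)
qed

end

section \<open>Distances on faces\<close>

lemma sum_set_le_sum_list:
  fixes f :: "'x \<Rightarrow> real"
  assumes "\<And>x. x \<in> set p \<Longrightarrow> 0 \<le> f x"
  shows "sum f (set p) \<le> sum_list (map f p)"
  using assms
proof (induction p)
  case (Cons x p)
  then show ?case by (cases "x \<in> set p") (auto simp: insert_absorb intro: add_increasing)
qed simp

section \<open>Shortest path metrics\<close>

locale weighted_plane_graph = plane_graph +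
  fixes len :: "'b \<Rightarrow> real"
  assumes len_nonneg: "a \<in> arcs G \<Longrightarrow> 0 \<le> len a"
    and len_arev: "a \<in> arcs G \<Longrightarrow> len (arev a) = len a"
begin

definition cost :: "'b list \<Rightarrow> real" where
  "cost p = sum_list (map len p)"

text \<open>The total length bounds the cost of every path. As a default it keeps \<open>Min\<close>
  nonempty and preserves the triangle inequality between different components.\<close>

definition dist :: "'a \<Rightarrow> 'a \<Rightarrow> real" where
  "dist u v = Min (insert (sum len (arcs G)) (cost ` {p. apath u p v}))"

lemma cost_nonneg: "set p \<subseteq> arcs G \<Longrightarrow> 0 \<le> cost p"
  unfolding cost_def by (intro sum_list_nonneg) (auto simp: len_nonneg)

lemma cost_apath:
  assumes "apath u p v"
  shows "cost p = sum len (set p)" "set p \<subseteq> arcs G"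
proof -
  have p: "awalk u p v" "distinct (awalk_verts u p)" using assms by (auto simp: apath_def)
  then have "distinct p" by (rule distinct_verts_imp_distinct)
  then show "cost p = sum len (set p)" by (simp add: cost_def sum_list_distinct_conv_sum_set)
  show "set p \<subseteq> arcs G" using p(1) by (simp add: awalk_def)
qed

lemma dist_le_apath: "apath u p v \<Longrightarrow> dist u v \<le> cost p"
  unfolding dist_def by (rule Min_le) (auto simp: apaths_finite)

lemma dist_le_awalk:
  assumes "awalk u p v" shows "dist u v \<le> cost p"
proof -
  let ?q = "awalk_to_apath p"
  have q: "apath u ?q v" "set ?q \<subseteq> set p" "set p \<subseteq> arcs G"
    using apath_awalk_to_apath[OF assms] awalk_to_apath_subset[OF assms] assms by (auto simp: awalk_def)
  have "dist u v \<le> cost ?q" by (rule dist_le_apath[OF q(1)])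
  also have "\<dots> = sum len (set ?q)" by (rule cost_apath(1)[OF q(1)])
  also have "\<dots> \<le> sum len (set p)" by (rule sum_mono2) (use q len_nonneg in auto)
  also have "\<dots> \<le> cost p" unfolding cost_def by (rule sum_set_le_sum_list) (use q len_nonneg in auto)
  finally show ?thesis .
qed

lemma dist_le_total: "dist u v \<le> sum len (arcs G)"
  unfolding dist_def by (rule Min_le) (auto simp: apaths_finite)

lemma dist_cases: obtains "dist u v = sum len (arcs G)" | p where "apath u p v" "cost p = dist u v"
proof -
  have "dist u v \<in> insert (sum len (arcs G)) (cost ` {p. apath u p v})"
    unfolding dist_def by (rule Min_in) (auto simp: apaths_finite)
  then show ?thesis using that by auto
qed

lemma dist_attained:
  assumes "awalk u q v" obtains p where "apath u p v" "cost p = dist u v"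
proof (cases rule: dist_cases[of u v])
  case 1
  have q: "apath u (awalk_to_apath q) v" by (rule apath_awalk_to_apath[OF assms])
  have "cost (awalk_to_apath q) \<le> sum len (arcs G)"
    unfolding cost_apath(1)[OF q] by (rule sum_mono2) (use cost_apath(2)[OF q] len_nonneg in auto)
  then have "cost (awalk_to_apath q) = dist u v" using 1 dist_le_apath[OF q] by simp
  then show ?thesis using that q by blast
qed (use that in blast)

lemma dist_nonneg: "0 \<le> dist u v"
  by (cases rule: dist_cases[of u v])
    (use cost_apath(2) cost_nonneg in \<open>auto simp: sum_nonneg len_nonneg dest!: sym[of "cost _"]\<close>)

lemma cost_reverse: "set p \<subseteq> arcs G \<Longrightarrow> cost (rev (map arev p)) = cost p"
  by (induction p) (auto simp: cost_def len_arev)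

sublocale pseudometric_on "verts G" dist
proof
  fix u v x assume V: "u \<in> verts G" "v \<in> verts G" "x \<in> verts G"
  show "0 \<le> dist u v" by (rule dist_nonneg)
  have "dist u u \<le> cost []" by (rule dist_le_awalk) (use V in \<open>simp add: awalk_simps\<close>)
  then show "dist u u = 0" using dist_nonneg[of u u] by (simp add: cost_def)
  have le: "dist y z \<le> dist z y" for y z
  proof (cases rule: dist_cases[of z y])
    case 1
    then show ?thesis using dist_le_total[of y z] by simp
  next
    case (2 p)
    then have "awalk y (rev (map arev p)) z" using awalk_reverse by (auto simp: apath_def)
    then show ?thesis using dist_le_awalk cost_reverse[OF cost_apath(2)[OF 2(1)]] 2 by metis
  qed
  show "dist u v = dist v u" using le[of u v] le[of v u] by simp
  show "dist u x \<le> dist u v + dist v x"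
  proof (cases rule: dist_cases[of u v])
    case 1
    then show ?thesis using dist_le_total[of u x] dist_nonneg[of v x] by simp
  next
    case (2 p)
    show ?thesis
    proof (cases rule: dist_cases[of v x])
      case 1
      then show ?thesis using dist_le_total[of u x] dist_nonneg[of u v] by simp
    next
      case (2 q)
      then have "awalk u (p @ q) x" using \<open>apath u p v\<close> by (auto simp: apath_def)
      then show ?thesis using dist_le_awalk[of u "p @ q" x] 2 \<open>cost p = dist u v\<close> by (simp add: cost_def)
    qed
  qed
qed

lemma dist_le_len: "a \<in> arcs G \<Longrightarrow> dist (tail G a) (head G a) \<le> len a"
  using dist_le_awalk[of "tail G a" "[a]" "head G a"] by (simp add: awalk_simps cost_def)

end

lemma odd_card_pair: "i1 \<noteq> i2 \<Longrightarrow> odd (card {i \<in> {i1, i2}. P i}) \<longleftrightarrow> P i1 \<noteq> P i2"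
proof -
  assume "i1 \<noteq> i2"
  moreover have "{i \<in> {i1, i2}. P i} = (if P i1 then {i1} else {}) \<union> (if P i2 then {i2} else {})" by auto
  ultimately show ?thesis by auto
qed

context plane_profile
begin

lemma awalk_face:
  assumes F: "F \<in> \<F>" and "i \<le> j" "j \<le> card F"
  shows "\<exists>p. awalk (vert_at F i) p (vert_at F j)"
  using assms(2,3)
proof (induction j rule: dec_induct)
  case base
  then show ?case using vert_at_in_verts[OF F] by (auto simp: awalk_simps intro: exI[of _ "[]"])
next
  case (step j)
  then obtain p where p: "awalk (vert_at F i) p (vert_at F j)" by auto
  have j: "j < card F" using step by simp
  have "awalk (vert_at F j) [arc_at F j] (vert_at F (Suc j))"
    using arc_at_in[OF F j] vert_at_Suc(1)[OF F j] by (simp add: awalk_simps vert_at_def)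
  then show ?case using awalk_appendI[OF p] by blast
qed

lemma separated_iff_odd_crossings:
  assumes "i \<le> j" "j \<le> card F"
  shows "(vert_at F i \<in> S) \<noteq> (vert_at F j \<in> S) \<longleftrightarrow> odd (card (crossings F S \<inter> {i..<j}))"
  using assms
proof (induction j rule: dec_induct)
  case (step j)
  have "crossings F S \<inter> {i..<Suc j}
      = crossings F S \<inter> {i..<j} \<union> (if j \<in> crossings F S then {j} else {})"
    using step(1) by (auto simp: less_Suc_eq)
  then have "card (crossings F S \<inter> {i..<Suc j}) = card (crossings F S \<inter> {i..<j}) + of_bool (j \<in> crossings F S)"
    by auto
  moreover have "j \<in> crossings F S \<longleftrightarrow> (vert_at F j \<in> S) \<noteq> (vert_at F (Suc j) \<in> S)"
    using step by (simp add: crossings_def)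
  ultimately show ?case using step by auto
qed simp

lemma separated_iff_splits:
  assumes "i \<le> j" "j \<le> card F" "crossings F S = {i1, i2}" "i1 \<noteq> i2"
  shows "(vert_at F i \<in> S) \<noteq> (vert_at F j \<in> S) \<longleftrightarrow> splits i1 i2 i j"
proof -
  have "crossings F S \<inter> {i..<j} = {k \<in> {i1, i2}. i \<le> k \<and> k < j}" using assms(3) by auto
  then show ?thesis using separated_iff_odd_crossings[OF assms(1,2), of S] odd_card_pair[OF assms(4), of "\<lambda>k. i \<le> k \<and> k < j"]
    by (simp add: splits_def)
qed

lemma card_crossed_chords:
  assumes "crossings F S = {i1, i2}" "i1 < i2"
  shows "card (crossed_chords F S) + 2 * Min (prof F ` {i1..i2}) = prof F i1 + prof F i2"
proof -
  have "i2 < card F" using assms by (auto simp: crossings_def)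
  moreover have "crossed_chords F S = {c \<in> chords_of F. covers_of F c i1 \<noteq> covers_of F c i2}"
    unfolding crossed_chords_def assms(1) using odd_card_pair[of i1 i2] assms(2) by auto
  ultimately show ?thesis using card_chords_separating[of i1 i2 "card F" "prof F"] assms(2) by simp
qed

lemma crossed_chords_empty: "card (crossings F S) = 0 \<Longrightarrow> crossed_chords F S = {}"
proof -
  assume "card (crossings F S) = 0"
  moreover have "finite (crossings F S)" by (simp add: crossings_def)
  ultimately have "crossings F S = {}" by simp
  then show ?thesis by (simp add: crossed_chords_def)
qed

lemma crossings_pair:
  assumes "card (crossings F S) = 2"
  obtains i1 i2 where "crossings F S = {i1, i2}" "i1 < i2" "i2 < card F"
proof -
  obtain x y where "crossings F S = {x, y}" "x \<noteq> y" using assms by (auto simp: card_2_iff)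
  moreover have "x < card F" "y < card F" using calculation(1) by (auto simp: crossings_def)
  ultimately show ?thesis using that[of x y] that[of y x] by (cases "x < y") (auto simp: insert_commute)
qed

end

context weighted_plane_graph
begin

text \<open>Shortest paths joining crossing pairs of points on a face meet; here this comes out of the
  theorem on non-crossing demands, with the two paths as capacities.\<close>

lemma dist_kalmanson:
  assumes F: "F \<in> \<F>" and b: "b \<in> F"
    and ord: "i < j" "j < k" "k < l" "l \<le> card F"
  defines "v \<equiv> \<lambda>i. tail G ((\<phi> ^^ i) b)"
  shows "dist (v i) (v l) + dist (v j) (v k) \<le> dist (v i) (v k) + dist (v j) (v l)"
proof -
  define base where "base F' = (if F' = F then b else SOME a. a \<in> F')" for F'
  \<comment> \<open>Height 1 from \<open>i\<close> to \<open>l\<close> and height 2 from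
    \<open>j\<close> to \<open>k\<close>: the profile of the two nested chords.\<close>
  define h :: "nat \<Rightarrow> nat" where "h x = of_bool (i \<le> x \<and> x < l) + of_bool (j \<le> x \<and> x < k)" for x
  define prof where "prof F' = (if F' = F then h else (\<lambda>_. 0))" for F'
  interpret plane_profile G arev rot base prof
  proof unfold_locales
    fix F' assume "F' \<in> \<F>"
    then show "base F' \<in> F'" using b some_in_face by (auto simp: base_def)
  qed
  have v: "v x = vert_at F x" for x by (simp add: v_def vert_at_def arc_at_def base_def)
  obtain p where p: "apath (v i) p (v k)" "cost p = dist (v i) (v k)"
    using awalk_face[OF F, of i k] ord v dist_attained by (metis less_imp_le order.strict_trans le_trans)
  obtain q where q: "apath (v j) q (v l)" "cost q = dist (v j) (v l)"
    using awalk_face[OF F, of j l] ord v dist_attained by (metis less_imp_le order.strict_trans le_trans)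
  define cap where "cap = count_list (map rep (p @ q))"
  let ?s = "\<lambda>F' c. dist (vert_at F' (fst c)) (vert_at F' (run_end (prof F') (card F') c))"
  have wp: "awalk (v i) p (v k)" and wq: "awalk (v j) q (v l)" using p q by (auto simp: apath_def)
  have pq: "set (p @ q) \<subseteq> arcs G" using cost_apath(2) p q by auto
  have empty: "chords_of F' = {}" if "F' \<noteq> F" for F' using that by (auto simp: prof_def chords_def)
  have "(\<Sum>F'\<in>\<F>. \<Sum>c\<in>chords_of F'. ?s F' c)
      \<le> (\<Sum>e\<in>edges. real (cap e) * dist (tail G e) (head G e))"
  proof (rule sum_chords_le[OF pseudometric_on_axioms])
    fix S assume "S \<subseteq> verts G"
      and cr: "\<And>F'. F' \<in> \<F> \<Longrightarrow> card (crossings F' S) = 0 \<or> card (crossings F' S) = 2"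
    have "crossed_chords F' S = {}" if "F' \<noteq> F" for F' using empty[OF that] by (auto simp: crossed_chords_def)
    then have "(\<Sum>F'\<in>\<F>. card (crossed_chords F' S)) = (\<Sum>F'\<in>{F}. card (crossed_chords F' S))"
      using F by (intro sum.mono_neutral_right) auto
    also have "\<dots> \<le> sum cap (cut S)"
    proof (cases "card (crossings F S) = 0")
      case True
      then show ?thesis using crossed_chords_empty by simp
    next
      case False
      then have "card (crossings F S) = 2" using cr[OF F] by simp
      then obtain i1 i2 where i: "crossings F S = {i1, i2}" "i1 < i2" "i2 < card F" by (rule crossings_pair)
      have capsum: "sum cap (cut S) = sum (count_list (map rep p)) (cut S) + sum (count_list (map rep q)) (cut S)"
        by (simp add: cap_def sum.distrib)
      have P: "of_bool (splits i1 i2 i k) \<le> sum (count_list (map rep p)) (cut S)"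
        using awalk_crosses_cut[OF wp, of S] separated_iff_splits[of i k F S i1 i2] i ord v by (auto simp: of_bool_def)
      have Q: "of_bool (splits i1 i2 j l) \<le> sum (count_list (map rep q)) (cut S)"
        using awalk_crosses_cut[OF wq, of S] separated_iff_splits[of j l F S i1 i2] i ord v by (auto simp: of_bool_def)
      \<comment> \<open>The profile rises and then falls, so its minimum over an interval is
        attained at an end.\<close>
      have "min (h i1) (h i2) \<le> Min (h ` {i1..i2})"
      proof (subst Min_ge_iff)
        show "\<forall>a\<in>h ` {i1..i2}. min (h i1) (h i2) \<le> a"
          using ord by (auto simp: h_def of_bool_def min_def)
      qed (use i in auto)
      then have "card (crossed_chords F S) + 2 * min (h i1) (h i2) \<le> h i1 + h i2"
        using card_crossed_chords[OF i(1,2)] by (simp add: prof_def)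
      \<comment> \<open>\<open>h\<close> is also the sum of the indicators of \<open>{i..<k}\<close>
        and \<open>{j..<l}\<close>. Each indicator differs at the two gaps only if they split its
        interval, and then the corresponding path crosses the cut.\<close>
      moreover have "h i1 + h i2 \<le> 2 * min (h i1) (h i2) + of_bool (splits i1 i2 i k) + of_bool (splits i1 i2 j l)"
        using ord i(2) by (auto simp: h_def of_bool_def min_def splits_def)
      ultimately show ?thesis using P Q capsum by simp
    qed
    finally show "(\<Sum>F'\<in>\<F>. card (crossed_chords F' S)) \<le> sum cap (cut S)" .
  qed
  also have "\<dots> \<le> (\<Sum>e\<in>edges. real (cap e) * len e)"
    by (intro sum_mono mult_left_mono dist_le_len) auto
  also have "\<dots> = (\<Sum>a\<leftarrow>p @ q. len (rep a))"
    unfolding cap_def by (rule sum_count_list_rep[OF pq])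
  also have "\<dots> = cost (p @ q)"
  proof -
    have "len (rep a) = len a" if "a \<in> arcs G" for a using that len_arev rep_cases[of a] by auto
    then have "map (\<lambda>a. len (rep a)) (p @ q) = map len (p @ q)" using pq by (intro map_cong) auto
    then show ?thesis by (simp only: cost_def)
  qed
  also have "\<dots> = dist (v i) (v k) + dist (v j) (v l)" using p q by (simp add: cost_def)
  finally have upper: "(\<Sum>F'\<in>\<F>. \<Sum>c\<in>chords_of F'. ?s F' c) \<le> dist (v i) (v k) + dist (v j) (v l)" .
  have prof: "prof F = h" by (simp add: prof_def)
  have rs: "run_start h i 1 = i" "run_start h j 2 = j"
  proof -
    have run: "run_start h x t = x" if "t \<le> h x" "x = 0 \<or> h (x - 1) < t" for x t
    proof (rule ccontr)
      assume "run_start h x t \<noteq> x"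
      then have "run_start h x t \<le> x - 1" "x \<noteq> 0" using run_start_run(1)[of t h x] that(1) by auto
      then have "t \<le> h (x - 1)" using run_start_run(2)[of t h x "x - 1"] that(1) by simp
      then show False using that(2) \<open>x \<noteq> 0\<close> by simp
    qed
    have "i = 0 \<or> h (i - 1) < 1" "j = 0 \<or> h (j - 1) < 2" "1 \<le> h i" "2 \<le> h j"
      using ord by (auto simp: h_def of_bool_def)
    then show "run_start h i 1 = i" "run_start h j 2 = j" using run by auto
  qed
  have ch: "(i, 1) \<in> chords h (card F)" "(j, 2) \<in> chords h (card F)"
    using ord rs by (auto simp: chords_def h_def)
  have re: "run_end h (card F) (i, 1) = l" "run_end h (card F) (j, 2) = k"
    unfolding run_end_def using ord by (auto intro!: Least_equality simp: h_def split: if_splits)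
  have nn: "0 \<le> ?s F' c" for F' c by (rule dist_nonneg)
  have "dist (v i) (v l) + dist (v j) (v k) = (\<Sum>c\<in>{(i, 1), (j, 2)}. ?s F c)"
    using ord re by (simp add: v prof)
  also have "\<dots> \<le> (\<Sum>c\<in>chords_of F. ?s F c)"
    using ch prof nn by (intro sum_mono2) auto
  also have "\<dots> \<le> (\<Sum>F'\<in>\<F>. \<Sum>c\<in>chords_of F'. ?s F' c)"
    by (rule member_le_sum[OF F]) (auto intro: sum_nonneg nn)
  finally show ?thesis using upper by simp
qed

lemma cyclic_metric_face:
  assumes F: "F \<in> \<F>" and b: "b \<in> F"
  shows "cyclic_metric (card F) (\<lambda>i j. dist (tail G ((\<phi> ^^ i) b)) (tail G ((\<phi> ^^ j) b)))"
proof -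
  let ?v = "\<lambda>i. tail G ((\<phi> ^^ i) b)"
  interpret plane_profile G arev rot "\<lambda>F'. if F' = F then b else SOME a. a \<in> F'" "\<lambda>_ _. 0"
  proof unfold_locales
    fix F' assume "F' \<in> \<F>"
    then show "(if F' = F then b else SOME a. a \<in> F') \<in> F'" using b some_in_face by auto
  qed
  have v: "vert_at F i = ?v i" for i by (simp add: vert_at_def arc_at_def)
  have V: "?v i \<in> verts G" if "i \<le> card F" for i using vert_at_in_verts[OF F that] v by simp
  have wrap: "?v (card F) = ?v 0" using bij_arc_at(2)[OF F] v[of "card F"] v[of 0] by (simp add: vert_at_def)
  show ?thesis
  proof
    fix i j
    show "dist (?v i) (?v i) = 0" if "i \<le> card F" using refl V[OF that] by simp
    show "dist (?v i) (?v j) = dist (?v j) (?v i)" if "i \<le> card F" "j \<le> card F"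
      using sym V that by simp
    show "dist (?v i) (?v (card F)) = dist (?v i) (?v 0)" by (simp only: wrap)
    show "dist (?v i) (?v (Suc j)) + dist (?v (Suc i)) (?v j) \<le> dist (?v i) (?v j) + dist (?v (Suc i)) (?v (Suc j))"
      if ij: "i < j" "j < card F"
    \<comment> \<open>With only three distinct positions the crossing inequality is the triangle
      inequality.\<close>
    proof (cases "Suc i = j")
      case True
      then show ?thesis using triangle[OF V V V, of i j "Suc j"] refl[OF V, of j] ij by simp
    next
      case False
      then show ?thesis using dist_kalmanson[OF F b, of i "Suc i" j "Suc j"] ij by simp
    qed
  qed
qed

end

section \<open>Separable face instances\<close>

context plane_graph
begin

text \<open>The base is the first arc of the segment, so the segment occupies the positions below
  \<open>n\<close>. A vertex may occur at several positions; one end is given a position in the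
  segment, while no position of the other end is below \<open>n\<close>.\<close>

lemma separable_positions:
  assumes inst: "separable_face_instance G arev rot H \<Phi>"
  obtains base n \<xi> \<eta> where "\<And>F. F \<in> \<F> \<Longrightarrow> base F \<in> F"
    and "\<And>x. x \<in> arcs H \<Longrightarrow> \<Phi> x \<in> \<F> \<and> \<xi> x < n (\<Phi> x) \<and> n (\<Phi> x) \<le> \<eta> x \<and> \<eta> x < card (\<Phi> x) \<and>
      {tail G ((\<phi> ^^ \<xi> x) (base (\<Phi> x))), tail G ((\<phi> ^^ \<eta> x) (base (\<Phi> x)))} = {tail H x, head H x}"
proof -
  let ?seg = "\<lambda>a n. (\<lambda>i. tail G ((\<phi> ^^ i) a)) ` {..<n}"
  have "\<forall>F\<in>\<F>. \<exists>an. fst an \<in> F \<and>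
      (\<forall>x\<in>arcs H. \<Phi> x = F \<longrightarrow> (tail H x \<in> ?seg (fst an) (snd an)) \<noteq> (head H x \<in> ?seg (fst an) (snd an)))"
  proof
    fix F assume "F \<in> \<F>"
    then have "separable_on G arev rot H \<Phi> F" using inst by (simp add: separable_face_instance_def)
    then obtain a n where "a \<in> F"
      "\<forall>x\<in>arcs H. \<Phi> x = F \<longrightarrow> (tail H x \<in> ?seg a n) \<noteq> (head H x \<in> ?seg a n)"
      unfolding separable_on_def face_segment_def by blast
    then show "\<exists>an. fst an \<in> F \<and>
      (\<forall>x\<in>arcs H. \<Phi> x = F \<longrightarrow> (tail H x \<in> ?seg (fst an) (snd an)) \<noteq> (head H x \<in> ?seg (fst an) (snd an)))"
      by (intro exI[of _ "(a, n)"]) simp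
  qed
  then obtain an where an: "\<And>F. F \<in> \<F> \<Longrightarrow> fst (an F) \<in> F"
    "\<And>F x. F \<in> \<F> \<Longrightarrow> x \<in> arcs H \<Longrightarrow> \<Phi> x = F \<Longrightarrow>
      (tail H x \<in> ?seg (fst (an F)) (snd (an F))) \<noteq> (head H x \<in> ?seg (fst (an F)) (snd (an F)))"
    unfolding bchoice_iff by blast
  define base where "base F = fst (an F)" for F
  define n where "n F = snd (an F)" for F
  interpret plane_profile G arev rot base "\<lambda>_ _. 0" by unfold_locales (simp add: base_def an(1))
  have v: "tail G ((\<phi> ^^ i) (base F)) = vert_at F i" for F i by (simp add: vert_at_def arc_at_def)
  have "\<forall>x\<in>arcs H. \<exists>ij. fst ij < n (\<Phi> x) \<and> n (\<Phi> x) \<le> snd ij \<and> snd ij < card (\<Phi> x) \<and>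
      {vert_at (\<Phi> x) (fst ij), vert_at (\<Phi> x) (snd ij)} = {tail H x, head H x}"
  proof
    fix x assume x: "x \<in> arcs H"
    define F where "F = \<Phi> x"
    have F: "F \<in> \<F>" "tail H x \<in> face_verts G F" "head H x \<in> face_verts G F"
      using inst x by (auto simp: separable_face_instance_def face_instance_def F_def)
    have sep: "(tail H x \<in> vert_at F ` {..<n F}) \<noteq> (head H x \<in> vert_at F ` {..<n F})"
      using an(2)[OF F(1) x] by (simp add: F_def v[symmetric] base_def n_def)
    have onF: "\<exists>j. j < card F \<and> u = vert_at F j" if u: "u \<in> face_verts G F" for u
    proof -
      obtain a where a: "a \<in> F" "u = tail G a" using u by (auto simp: face_verts_def)
      then have "a \<in> arc_at F ` {..<card F}" using bij_arc_at(1)[OF F(1)] by (simp add: bij_betw_def)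
      then show ?thesis using a by (auto simp: vert_at_def)
    qed
    have "\<exists>ij. fst ij < n F \<and> n F \<le> snd ij \<and> snd ij < card F \<and>
        {vert_at F (fst ij), vert_at F (snd ij)} = {y, z}"
      if y: "y \<in> vert_at F ` {..<n F}" and z: "z \<notin> vert_at F ` {..<n F}" "z \<in> face_verts G F" for y z
    proof -
      obtain i where i: "i < n F" "y = vert_at F i" using y by auto
      obtain j where j: "j < card F" "z = vert_at F j" using onF[OF z(2)] by auto
      then have "n F \<le> j" using z(1) by (meson imageI lessThan_iff linorder_not_less)
      then show ?thesis using i j by (intro exI[of _ "(i, j)"]) simp
    qed
    from this[of "tail H x" "head H x"] this[of "head H x" "tail H x"]
    show "\<exists>ij. fst ij < n (\<Phi> x) \<and> n (\<Phi> x) \<le> snd ij \<and> snd ij < card (\<Phi> x) \<and>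
      {vert_at (\<Phi> x) (fst ij), vert_at (\<Phi> x) (snd ij)} = {tail H x, head H x}"
      using sep F unfolding F_def[symmetric] by (auto simp: insert_commute)
  qed
  then obtain ij where ij: "\<And>x. x \<in> arcs H \<Longrightarrow> fst (ij x) < n (\<Phi> x) \<and> n (\<Phi> x) \<le> snd (ij x) \<and> snd (ij x) < card (\<Phi> x) \<and>
      {vert_at (\<Phi> x) (fst (ij x)), vert_at (\<Phi> x) (snd (ij x))} = {tail H x, head H x}"
    unfolding bchoice_iff by blast
  show ?thesis
  proof (rule that[of base "fst \<circ> ij" n "snd \<circ> ij"])
    show "base F \<in> F" if "F \<in> \<F>" for F using an(1)[OF that] by (simp add: base_def)
    show "\<Phi> x \<in> \<F> \<and> (fst \<circ> ij) x < n (\<Phi> x) \<and> n (\<Phi> x) \<le> (snd \<circ> ij) x \<and> (snd \<circ> ij) x < card (\<Phi> x) \<and>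
      {tail G ((\<phi> ^^ (fst \<circ> ij) x) (base (\<Phi> x))), tail G ((\<phi> ^^ (snd \<circ> ij) x) (base (\<Phi> x)))} = {tail H x, head H x}"
      if "x \<in> arcs H" for x
      using ij[OF that] that inst by (simp add: v separable_face_instance_def face_instance_def)
  qed
qed

text \<open>Ensures that the distance of a demand pair is attained by a path and is not just the
  default value of \<open>dist\<close>.\<close>

lemma demand_connected:
  assumes inst: "separable_face_instance G arev rot H \<Phi>" and x: "x \<in> arcs H"
  shows "\<exists>p. awalk (tail H x) p (head H x)"
proof -
  obtain base n \<xi> \<eta> where base: "\<And>F. F \<in> \<F> \<Longrightarrow> base F \<in> F"
    and ends: "\<And>x. x \<in> arcs H \<Longrightarrow> \<Phi> x \<in> \<F> \<and> \<xi> x < n (\<Phi> x) \<and> n (\<Phi> x) \<le> \<eta> x \<and> \<eta> x < card (\<Phi> x) \<and>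
      {tail G ((\<phi> ^^ \<xi> x) (base (\<Phi> x))), tail G ((\<phi> ^^ \<eta> x) (base (\<Phi> x)))} = {tail H x, head H x}"
    using separable_positions[OF inst] by metis
  interpret plane_profile G arev rot base "\<lambda>_ _. 0" by unfold_locales (rule base)
  have v: "{vert_at (\<Phi> x) (\<xi> x), vert_at (\<Phi> x) (\<eta> x)} = {tail H x, head H x}"
    using ends[OF x] by (simp add: vert_at_def arc_at_def)
  obtain p where p: "awalk (vert_at (\<Phi> x) (\<xi> x)) p (vert_at (\<Phi> x) (\<eta> x))"
    using awalk_face[of "\<Phi> x" "\<xi> x" "\<eta> x"] ends[OF x] by auto
  then show ?thesis using v awalk_reverse[OF p] by (auto simp: doubleton_eq_iff)
qed

end

context weighted_plane_graph
begin

text \<open>If \<open>r\<close> copies of the demands dominate the chords on every pair of gaps, the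
  cut condition for the demands becomes the one for the chords with capacities \<open>r * c\<close>.
  Allowing every \<open>k\<close> between the gaps avoids naming the minimum of the profile.\<close>

lemma sum_chords_le_capacity:
  fixes c :: "'b \<Rightarrow> nat" and H :: "('a, 'd) pre_digraph" and r :: nat
  assumes base: "\<And>F. F \<in> \<F> \<Longrightarrow> base F \<in> F"
    and c: "\<And>a. a \<in> arcs G \<Longrightarrow> c (arev a) = c a" and H: "finite (arcs H)" and cc: "cut_condition G c H"
    and ends: "\<And>x. x \<in> arcs H \<Longrightarrow> \<Phi> x \<in> \<F> \<and> \<xi> x \<le> \<eta> x \<and> \<eta> x \<le> card (\<Phi> x) \<and>
      {tail G ((\<phi> ^^ \<xi> x) (base (\<Phi> x))), tail G ((\<phi> ^^ \<eta> x) (base (\<Phi> x)))} = {tail H x, head H x}"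
    and prof: "\<And>F i1 k i2. F \<in> \<F> \<Longrightarrow> i1 \<le> k \<Longrightarrow> k \<le> i2 \<Longrightarrow>
      prof F i1 + prof F i2 \<le> r * card {x \<in> {x \<in> arcs H. \<Phi> x = F}. splits i1 i2 (\<xi> x) (\<eta> x)} + 2 * prof F k"
  shows "(\<Sum>F\<in>\<F>. \<Sum>q\<in>chords (prof F) (card F).
      dist (tail G ((\<phi> ^^ fst q) (base F))) (tail G ((\<phi> ^^ run_end (prof F) (card F) q) (base F))))
    \<le> real r * (\<Sum>e\<in>edges. real (c e) * len e)"
proof -
  interpret plane_profile G arev rot base prof by unfold_locales (rule base)
  have v: "tail G ((\<phi> ^^ i) (base F)) = vert_at F i" for F i by (simp add: vert_at_def arc_at_def)
  have "(\<Sum>F\<in>\<F>. \<Sum>q\<in>chords_of F. dist (vert_at F (fst q)) (vert_at F (run_end (prof F) (card F) q)))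
      \<le> (\<Sum>e\<in>edges. real (r * c e) * dist (tail G e) (head G e))"
  proof (rule sum_chords_le[OF pseudometric_on_axioms])
    fix S assume S: "S \<subseteq> verts G"
      and cr: "\<And>F. F \<in> \<F> \<Longrightarrow> card (crossings F S) = 0 \<or> card (crossings F S) = 2"
    define sep where "sep F = {x \<in> {x \<in> arcs H. \<Phi> x = F}. (tail H x \<in> S) \<noteq> (head H x \<in> S)}" for F
    have "card (crossed_chords F S) \<le> r * card (sep F)" if F: "F \<in> \<F>" for F
    proof (cases "card (crossings F S) = 0")
      case True
      then show ?thesis using crossed_chords_empty by simp
    next
      case False
      then have "card (crossings F S) = 2" using cr[OF F] by simp
      then obtain i1 i2 where i: "crossings F S = {i1, i2}" "i1 < i2" "i2 < card F" by (rule crossings_pair)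
      have "Min (prof F ` {i1..i2}) \<in> prof F ` {i1..i2}" using i by (intro Min_in) auto
      then obtain k where k: "i1 \<le> k" "k \<le> i2" "Min (prof F ` {i1..i2}) = prof F k" by auto
      have "splits i1 i2 (\<xi> x) (\<eta> x) \<longleftrightarrow> (tail H x \<in> S) \<noteq> (head H x \<in> S)" if x: "x \<in> arcs H" "\<Phi> x = F" for x
      proof -
        have "(vert_at F (\<xi> x) \<in> S) \<noteq> (vert_at F (\<eta> x) \<in> S) \<longleftrightarrow> splits i1 i2 (\<xi> x) (\<eta> x)"
          using separated_iff_splits[of "\<xi> x" "\<eta> x" F S i1 i2] ends[OF x(1)] x i by simp
        moreover have "{vert_at F (\<xi> x), vert_at F (\<eta> x)} = {tail H x, head H x}"
          using ends[OF x(1)] x by (simp add: v)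
        ultimately show ?thesis by (auto simp: doubleton_eq_iff)
      qed
      then have "{x \<in> {x \<in> arcs H. \<Phi> x = F}. splits i1 i2 (\<xi> x) (\<eta> x)} = sep F" by (auto simp: sep_def)
      then show ?thesis using prof[OF F k(1,2)] card_crossed_chords[OF i(1,2)] k(3) by simp
    qed
    then have "(\<Sum>F\<in>\<F>. card (crossed_chords F S)) \<le> (\<Sum>F\<in>\<F>. r * card (sep F))"
      by (rule sum_mono)
    also have "\<dots> = r * (\<Sum>F\<in>\<F>. card (sep F))" by (simp add: sum_distrib_left)
    also have "(\<Sum>F\<in>\<F>. card (sep F)) = demand_cut H S"
    proof -
      let ?D = "{x \<in> arcs H. (tail H x \<in> S) \<noteq> (head H x \<in> S)}"
      have "(\<Sum>F\<in>\<F>. card (sep F)) = (\<Sum>F\<in>\<F>. \<Sum>x | x \<in> ?D \<and> \<Phi> x = F. 1)"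
        by (rule sum.cong) (auto simp: sep_def intro!: arg_cong[of _ _ card])
      also have "\<dots> = (\<Sum>x\<in>?D. 1)" by (rule sum.group) (use H ends in auto)
      finally show ?thesis by (simp add: demand_cut_def)
    qed
    also have "r * demand_cut H S \<le> r * sum c (cut S)"
      using cc S supply_cut_eq[of c S, OF c] by (auto simp: cut_condition_def)
    finally show "(\<Sum>F\<in>\<F>. card (crossed_chords F S)) \<le> (\<Sum>e\<in>cut S. r * c e)"
      by (simp add: sum_distrib_left)
  qed
  also have "\<dots> \<le> (\<Sum>e\<in>edges. real (r * c e) * len e)"
    by (intro sum_mono mult_left_mono dist_le_len) auto
  also have "\<dots> = real r * (\<Sum>e\<in>edges. real (c e) * len e)"
    by (simp add: sum_distrib_left mult.assoc)
  finally show ?thesis by (simp add: v)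
qed

theorem sum_dist_demands_le:
  fixes c :: "'b \<Rightarrow> nat" and H :: "('a, 'd) pre_digraph"
  assumes c: "\<And>a. a \<in> arcs G \<Longrightarrow> c (arev a) = c a" and H: "finite (arcs H)"
    and inst: "separable_face_instance G arev rot H \<Phi>" and cc: "cut_condition G c H"
  shows "(\<Sum>x\<in>arcs H. dist (tail H x) (head H x)) \<le> 3 * (\<Sum>e\<in>edges. real (c e) * len e)"
proof -
  obtain base n \<xi> \<eta> where base: "\<And>F. F \<in> \<F> \<Longrightarrow> base F \<in> F"
    and pos: "\<And>x. x \<in> arcs H \<Longrightarrow> \<Phi> x \<in> \<F> \<and> \<xi> x < n (\<Phi> x) \<and> n (\<Phi> x) \<le> \<eta> x \<and> \<eta> x < card (\<Phi> x) \<and>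
      {tail G ((\<phi> ^^ \<xi> x) (base (\<Phi> x))), tail G ((\<phi> ^^ \<eta> x) (base (\<Phi> x)))} = {tail H x, head H x}"
    using separable_positions[OF inst] by metis
  define v where "v F i = tail G ((\<phi> ^^ i) (base F))" for F i
  define D where "D F = {x \<in> arcs H. \<Phi> x = F}" for F
  have ends: "\<Phi> x \<in> \<F> \<and> \<xi> x \<le> \<eta> x \<and> \<eta> x \<le> card (\<Phi> x) \<and>
      {tail G ((\<phi> ^^ \<xi> x) (base (\<Phi> x))), tail G ((\<phi> ^^ \<eta> x) (base (\<Phi> x)))} = {tail H x, head H x}" if "x \<in> arcs H" for x
    using pos[OF that] by auto
  have sd: "separable_demands (D F) \<xi> \<eta> (n F) (card F)" for F
    by unfold_locales (use H pos in \<open>auto simp: D_def\<close>)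
  interpret P: plane_profile G arev rot base "\<lambda>_ _. 0" by unfold_locales (rule base)
  have pv: "P.vert_at = v" by (simp add: fun_eq_iff P.vert_at_def P.arc_at_def v_def)
  have vV: "v F i \<in> verts G" if "F \<in> \<F>" "i \<le> card F" for F i
    using P.vert_at_in_verts[OF that] pv by simp
  have dist_ends: "dist (v (\<Phi> x) (\<xi> x)) (v (\<Phi> x) (\<eta> x)) = dist (tail H x) (head H x)" if x: "x \<in> arcs H" for x
  proof -
    have V: "v (\<Phi> x) (\<xi> x) \<in> verts G" "v (\<Phi> x) (\<eta> x) \<in> verts G" using ends[OF x] by (auto intro!: vV)
    have "{v (\<Phi> x) (\<xi> x), v (\<Phi> x) (\<eta> x)} = {tail H x, head H x}" using ends[OF x] by (simp add: v_def)
    then show ?thesis using sym[OF V] by (auto simp: doubleton_eq_iff)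
  qed
  define nested where "nested F = separable_demands.nested_profile (D F) \<xi> \<eta>" for F
  define twisted where "twisted F = separable_demands.twist_profile (D F) \<xi> \<eta> (card F)" for F
  let ?sum = "\<lambda>prof F. \<Sum>q\<in>chords (prof F) (card F). dist (v F (fst q)) (v F (run_end (prof F) (card F) q))"
  have "(\<Sum>x\<in>arcs H. dist (tail H x) (head H x)) = (\<Sum>x\<in>arcs H. dist (v (\<Phi> x) (\<xi> x)) (v (\<Phi> x) (\<eta> x)))"
    by (rule sum.cong) (simp_all add: dist_ends)
  also have "\<dots> = (\<Sum>F\<in>\<F>. \<Sum>x\<in>D F. dist (v (\<Phi> x) (\<xi> x)) (v (\<Phi> x) (\<eta> x)))"
    unfolding D_def by (rule sum.group[symmetric]) (use H ends in auto)
  also have "\<dots> = (\<Sum>F\<in>\<F>. \<Sum>x\<in>D F. dist (v F (\<xi> x)) (v F (\<eta> x)))"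
    by (intro sum.cong) (auto simp: D_def)
  also have "\<dots> \<le> (\<Sum>F\<in>\<F>. ?sum nested F + ?sum twisted F)"
  proof (rule sum_mono)
    fix F assume F: "F \<in> \<F>"
    show "(\<Sum>x\<in>D F. dist (v F (\<xi> x)) (v F (\<eta> x))) \<le> ?sum nested F + ?sum twisted F"
      unfolding nested_def twisted_def v_def
      by (rule separable_demands.sum_dist_le[OF sd cyclic_metric_face[OF F base[OF F]]])
  qed
  also have "\<dots> = (\<Sum>F\<in>\<F>. ?sum nested F) + (\<Sum>F\<in>\<F>. ?sum twisted F)"
    by (rule sum.distrib)
  also have "(\<Sum>F\<in>\<F>. ?sum nested F) \<le> real 1 * (\<Sum>e\<in>edges. real (c e) * len e)"
    unfolding v_def
  proof (rule sum_chords_le_capacity[where base = base and c = c and H = H and \<Phi> = \<Phi> and \<xi> = \<xi> and \<eta> = \<eta>,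
      OF _ _ H cc])
    fix F i1 k i2 assume "F \<in> \<F>" "i1 \<le> k" "k \<le> (i2 :: nat)"
    then show "nested F i1 + nested F i2
        \<le> 1 * card {x \<in> {x \<in> arcs H. \<Phi> x = F}. splits i1 i2 (\<xi> x) (\<eta> x)} + 2 * nested F k"
      using separable_demands.nested_profile_le[OF sd, of i1 k i2 F] separable_demands.crossing_def[OF sd, of F i1 i2]
      by (simp add: nested_def D_def)
  qed (fact base c ends)+
  also have "(\<Sum>F\<in>\<F>. ?sum twisted F) \<le> real 2 * (\<Sum>e\<in>edges. real (c e) * len e)"
    unfolding v_def
  proof (rule sum_chords_le_capacity[where base = base and c = c and H = H and \<Phi> = \<Phi> and \<xi> = \<xi> and \<eta> = \<eta>,
      OF _ _ H cc])
    fix F i1 k i2 assume "F \<in> \<F>" "i1 \<le> k" "k \<le> (i2 :: nat)"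
    then show "twisted F i1 + twisted F i2
        \<le> 2 * card {x \<in> {x \<in> arcs H. \<Phi> x = F}. splits i1 i2 (\<xi> x) (\<eta> x)} + 2 * twisted F k"
      using separable_demands.twist_profile_le[OF sd, of i1 k i2 F] separable_demands.crossing_def[OF sd, of F i1 i2]
      by (simp add: twisted_def D_def)
  qed (fact base c ends)+
  finally show "(\<Sum>x\<in>arcs H. dist (tail H x) (head H x)) \<le> 3 * (\<Sum>e\<in>edges. real (c e) * len e)" by simp
qed

end

section \<open>Linear programming duality\<close>

text \<open>A pair \<open>(a, b)\<close> stands for the inequality that the sum of
  \<open>a i * x i\<close> is at most \<open>b\<close>. Adding one generator at a time lets
  induction keep track of the multipliers.\<close>

inductive_set cone :: "(('i \<Rightarrow> real) \<times> real) set \<Rightarrow> (('i \<Rightarrow> real) \<times> real) set" for C where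
  zero: "(\<lambda>_. 0, 0) \<in> cone C"
| add: "(a, b) \<in> C \<Longrightarrow> (a', b') \<in> cone C \<Longrightarrow> 0 \<le> t \<Longrightarrow> (\<lambda>i. a' i + t * a i, b' + t * b) \<in> cone C"

lemma cone_add:
  assumes "(a, b) \<in> cone C" "(a', b') \<in> cone C"
  shows "(\<lambda>i. a' i + a i, b' + b) \<in> cone C"
  using assms
proof (induction a b rule: cone.induct[split_format(complete)])
  case (add a1 b1 a2 b2 t)
  then have "(\<lambda>i. (a' i + a2 i) + t * a1 i, (b' + b2) + t * b1) \<in> cone C"
    by (intro cone.add) auto
  then show ?case by (simp add: add.assoc)
qed simp

lemma cone_scale:
  assumes "(a, b) \<in> cone C" "0 \<le> s"
  shows "(\<lambda>i. s * a i, s * b) \<in> cone C"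
  using assms
proof (induction a b rule: cone.induct[split_format(complete)])
  case (add a1 b1 a2 b2 t)
  then have "(\<lambda>i. s * a2 i + (s * t) * a1 i, s * b2 + (s * t) * b1) \<in> cone C"
    by (intro cone.add) auto
  then show ?case by (simp add: algebra_simps)
qed (simp add: cone.zero)

lemma cone_base: "(a, b) \<in> C \<Longrightarrow> (a, b) \<in> cone C"
  using cone.add[OF _ cone.zero, of a b C 1] by simp

lemma cone_mono:
  assumes "(a, b) \<in> cone C'" "C' \<subseteq> cone C"
  shows "(a, b) \<in> cone C"
  using assms
proof (induction a b rule: cone.induct[split_format(complete)])
  case (add a1 b1 a2 b2 t)
  then have "(\<lambda>i. t * a1 i, t * b1) \<in> cone C" by (intro cone_scale) auto
  then show ?case using cone_add add by blast
qed (rule cone.zero)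

text \<open>Fourier--Motzkin elimination.\<close>

theorem farkas:
  assumes "finite I" "finite C"
    and "\<And>a b. (a, b) \<in> cone C \<Longrightarrow> (\<And>i. i \<in> I \<Longrightarrow> a i = 0) \<Longrightarrow> 0 \<le> b"
  shows "\<exists>x. \<forall>(a, b)\<in>C. (\<Sum>i\<in>I. a i * x i) \<le> b"
  using assms
proof (induction I arbitrary: C rule: finite_induct)
  case empty
  have "0 \<le> b" if "(a, b) \<in> C" for a b using cone_base[OF that] empty.prems(2) by simp
  then show ?case by auto
next
  case (insert k I)
  \<comment> \<open>Scaled so that the coefficients at \<open>k\<close> become 1 and -1 and
    cancel.\<close>
  define comb where "comb p q = (\<lambda>i. (1 / fst p k) * fst p i + (1 / - fst q k) * fst q i,
      (1 / fst p k) * snd p + (1 / - fst q k) * snd q)" for p q :: "('a \<Rightarrow> real) \<times> real"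
  define P where "P = {p \<in> C. 0 < fst p k}"
  define Q where "Q = {q \<in> C. fst q k < 0}"
  define Z where "Z = {z \<in> C. fst z k = 0}"
  define C' where "C' = Z \<union> (\<lambda>(p, q). comb p q) ` (P \<times> Q)"
  have fin: "finite P" "finite Q" "finite C'" using insert.prems(1) by (auto simp: P_def Q_def Z_def C'_def)
  have comb_cone: "comb p q \<in> cone C" if "p \<in> P" "q \<in> Q" for p q
  proof -
    have pq: "(fst p, snd p) \<in> C" "(fst q, snd q) \<in> C" "0 < fst p k" "fst q k < 0"
      using that by (auto simp: P_def Q_def)
    have "(\<lambda>i. (1 / fst p k) * fst p i, (1 / fst p k) * snd p) \<in> cone C"
      using pq by (intro cone_scale cone_base) auto
    moreover have "(\<lambda>i. (1 / - fst q k) * fst q i, (1 / - fst q k) * snd q) \<in> cone C"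
      using pq by (intro cone_scale cone_base) auto
    ultimately show ?thesis unfolding comb_def using cone_add by blast
  qed
  have sub: "C' \<subseteq> cone C"
  proof -
    have "z \<in> cone C" if "z \<in> Z" for z using that cone_base[of "fst z" "snd z" C] by (simp add: Z_def)
    then show ?thesis using comb_cone by (auto simp: C'_def)
  qed
  have k0: "a k = 0" if "(a, b) \<in> cone C'" for a b
    using that
  proof (induction a b rule: cone.induct[split_format(complete)])
    case (add a1 b1 a2 b2 t)
    then have "a1 k = 0" by (auto simp: C'_def Z_def comb_def P_def Q_def)
    then show ?case using add by simp
  qed simp
  have "\<exists>x. \<forall>(a, b)\<in>C'. (\<Sum>i\<in>I. a i * x i) \<le> b"
  proof (rule insert.IH[OF fin(3)])
    fix a b assume ab: "(a, b) \<in> cone C'" "\<And>i. i \<in> I \<Longrightarrow> a i = 0"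
    show "0 \<le> b" using insert.prems(2)[OF cone_mono[OF ab(1) sub]] ab(2) k0[OF ab(1)] by auto
  qed
  then obtain x where x: "\<And>a b. (a, b) \<in> C' \<Longrightarrow> (\<Sum>i\<in>I. a i * x i) \<le> b" by blast
  define \<sigma> where "\<sigma> p = (\<Sum>i\<in>I. fst p i * x i)" for p :: "('a \<Rightarrow> real) \<times> real"
  \<comment> \<open>The bound on the variable \<open>k\<close> once the others are fixed: an upper
    bound for members of \<open>P\<close>, a lower bound for members of \<open>Q\<close>.\<close>
  define bnd where "bnd p = (snd p - \<sigma> p) / fst p k" for p
  have le: "bnd q \<le> bnd p" if p: "p \<in> P" and q: "q \<in> Q" for p q
  proof -
    have "comb p q \<in> C'" using p q by (force simp: C'_def)
    then have "(\<Sum>i\<in>I. ((1 / fst p k) * fst p i + (1 / - fst q k) * fst q i) * x i)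
        \<le> (1 / fst p k) * snd p + (1 / - fst q k) * snd q"
      using x unfolding comb_def by blast
    moreover have "(\<Sum>i\<in>I. ((1 / fst p k) * fst p i + (1 / - fst q k) * fst q i) * x i)
        = (1 / fst p k) * \<sigma> p + (1 / - fst q k) * \<sigma> q"
      unfolding \<sigma>_def sum_distrib_left sum.distrib[symmetric] by (rule sum.cong) (auto simp: algebra_simps)
    ultimately show ?thesis by (simp add: bnd_def diff_divide_distrib)
  qed
  obtain t where t: "\<And>p. p \<in> P \<Longrightarrow> t \<le> bnd p" "\<And>q. q \<in> Q \<Longrightarrow> bnd q \<le> t"
  proof (cases "P = {}")
    case True
    \<comment> \<open>Without upper bounds any value above all lower bounds works;
      \<open>insert 0\<close> covers the case without lower bounds.\<close>
    show ?thesis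
      by (rule that[of "Max (insert 0 (bnd ` Q))"]) (use True fin in \<open>auto intro: Max_ge\<close>)
  next
    case False
    show ?thesis
    proof (rule that[of "Min (bnd ` P)"])
      show "Min (bnd ` P) \<le> bnd p" if "p \<in> P" for p using that fin by (intro Min_le) auto
      show "bnd q \<le> Min (bnd ` P)" if "q \<in> Q" for q using that fin False le by (subst Min_ge_iff) auto
    qed
  qed
  have "(\<Sum>i\<in>insert k I. fst p i * (x(k := t)) i) \<le> snd p" if p: "p \<in> C" for p
  proof -
    have "(\<Sum>i\<in>I. fst p i * (x(k := t)) i) = \<sigma> p"
      unfolding \<sigma>_def by (rule sum.cong) (use insert.hyps in auto)
    then have eq: "(\<Sum>i\<in>insert k I. fst p i * (x(k := t)) i) = fst p k * t + \<sigma> p"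
      using insert.hyps by simp
    consider "p \<in> P" | "p \<in> Q" | "p \<in> Z" using p by (fastforce simp: P_def Q_def Z_def)
    then show ?thesis
    proof cases
      case 1
      then have "0 < fst p k" "t \<le> (snd p - \<sigma> p) / fst p k" using t(1) by (auto simp: P_def bnd_def)
      then show ?thesis unfolding eq by (simp add: pos_le_divide_eq mult.commute)
    next
      case 2
      then have "fst p k < 0" "(snd p - \<sigma> p) / fst p k \<le> t" using t(2) by (auto simp: Q_def bnd_def)
      then show ?thesis unfolding eq by (simp add: neg_divide_le_eq mult.commute)
    next
      case 3
      then show ?thesis unfolding eq using x[of "fst p" "snd p"] by (simp add: C'_def \<sigma>_def Z_def)
    qed
  qed
  then show ?case by (intro exI[of _ "x(k := t)"]) auto
qed

lemma sum_delta_add: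
  fixes f g :: "'x \<Rightarrow> real"
  assumes "finite A" "a \<in> A"
  shows "(\<Sum>x\<in>A. (f(a := f a + t)) x * g x) = (\<Sum>x\<in>A. f x * g x) + t * g a"
proof -
  have "(\<Sum>x\<in>A. (f(a := f a + t)) x * g x) = (\<Sum>x\<in>A. f x * g x + (if x = a then t * g x else 0))"
    by (rule sum.cong) (auto simp: algebra_simps)
  then show ?thesis using assms by (simp add: sum.distrib)
qed

text \<open>In \<open>dual\<close>, \<open>y\<close> prices the arcs and \<open>z\<close> is at most
  the price of every path of its demand. The conclusion of \<open>dual\<close> excludes every Farkas
  certificate of infeasibility.\<close>

lemma feasibleI:
  fixes cap :: "'b \<Rightarrow> real" and G :: "('a, 'b) pre_digraph" and H :: "('a, 'd) pre_digraph"
  assumes finH: "finite (arcs H)" and finG: "finite (arcs G)"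
    and finP: "\<And>x. x \<in> arcs H \<Longrightarrow> finite (demand_paths G H x)"
    and dual: "\<And>y z. (\<And>a. a \<in> arcs G \<Longrightarrow> 0 \<le> y a) \<Longrightarrow>
      (\<And>x p. x \<in> arcs H \<Longrightarrow> p \<in> demand_paths G H x \<Longrightarrow>
         z x \<le> (\<Sum>a | a \<in> arcs G \<and> (a \<in> set p \<or> arev a \<in> set p). y a)) \<Longrightarrow>
      (\<Sum>x\<in>arcs H. z x) \<le> (\<Sum>a\<in>arcs G. y a * cap a)"
  shows "feasible G arev cap H"
proof -
  define uses where "uses a p \<longleftrightarrow> a \<in> set p \<or> arev a \<in> set p" for a p
  define I where "I = Sigma (arcs H) (demand_paths G H)"
  define pos where "pos i = ((\<lambda>j. if j = i then - 1 else 0) :: 'd \<times> 'b list \<Rightarrow> real, 0 :: real)" for i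
  define ge where "ge x = ((\<lambda>j. if fst j = x then - 1 else 0) :: 'd \<times> 'b list \<Rightarrow> real, - 1 :: real)" for x
  define le where "le x = ((\<lambda>j. if fst j = x then 1 else 0) :: 'd \<times> 'b list \<Rightarrow> real, 1 :: real)" for x
  define load where "load a = ((\<lambda>j. if uses a (snd j) then 1 else 0) :: 'd \<times> 'b list \<Rightarrow> real, cap a)" for a
  define C where "C = pos ` I \<union> ge ` arcs H \<union> le ` arcs H \<union> load ` arcs G"
  have finI: "finite I" unfolding I_def using finH finP by (rule finite_SigmaI)
  have finC: "finite C" using finI finH finG by (simp add: C_def)
  \<comment> \<open>Every member of the cone has multipliers \<open>y\<close> for the capacities and
    \<open>z\<close>, of either sign, for the demand equations, which enter as \<open>ge\<close> and
    \<open>le\<close>. The generators \<open>pos\<close> can only lower coefficients, hence an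
    inequality for \<open>\<alpha>\<close>.\<close>
  have cert: "\<exists>y z. (\<forall>a\<in>arcs G. 0 \<le> y a) \<and>
      (\<forall>j\<in>I. \<alpha> j \<le> (\<Sum>a\<in>arcs G. y a * of_bool (uses a (snd j))) - z (fst j)) \<and>
      \<beta> = (\<Sum>a\<in>arcs G. y a * cap a) - (\<Sum>x\<in>arcs H. z x * 1)"
    if "(\<alpha>, \<beta>) \<in> cone C" for \<alpha> \<beta>
    using that
  proof (induction \<alpha> \<beta> rule: cone.induct[split_format(complete)])
    case zero
    show ?case by (rule exI[of _ "\<lambda>_. 0"], rule exI[of _ "\<lambda>_. 0"]) simp
  next
    case (add a b a' b' t)
    then obtain y z where y: "\<And>a. a \<in> arcs G \<Longrightarrow> 0 \<le> y a"
      and le': "\<And>j. j \<in> I \<Longrightarrow> a' j \<le> (\<Sum>a\<in>arcs G. y a * of_bool (uses a (snd j))) - z (fst j)"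
      and b': "b' = (\<Sum>a\<in>arcs G. y a * cap a) - (\<Sum>x\<in>arcs H. z x * 1)" by blast
    have t: "0 \<le> t" by (rule add.hyps)
    from \<open>(a, b) \<in> C\<close> consider i where "(a, b) = pos i" | x where "x \<in> arcs H" "(a, b) = ge x"
      | x where "x \<in> arcs H" "(a, b) = le x" | e where "e \<in> arcs G" "(a, b) = load e"
      by (auto simp: C_def)
    then show ?case
    proof cases
      case 1
      have "a' j + t * a j \<le> (\<Sum>a\<in>arcs G. y a * of_bool (uses a (snd j))) - z (fst j)" if "j \<in> I" for j
        using le'[OF that] 1 t by (auto simp: pos_def)
      then show ?thesis using y b' 1 by (intro exI[of _ y] exI[of _ z]) (auto simp: pos_def)
    next
      case (2 x)
      have "a' j + t * a j \<le> (\<Sum>a\<in>arcs G. y a * of_bool (uses a (snd j))) - (z(x := z x + t)) (fst j)" if "j \<in> I" for j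
        using le'[OF that] 2 by (auto simp: ge_def)
      moreover have "b' + t * b = (\<Sum>a\<in>arcs G. y a * cap a) - (\<Sum>i\<in>arcs H. (z(x := z x + t)) i * 1)"
        using b' 2 sum_delta_add[OF finH 2(1), of z t "\<lambda>_. 1"] by (simp add: ge_def)
      ultimately show ?thesis using y by (intro exI[of _ y] exI[of _ "z(x := z x + t)"]) blast
    next
      case (3 x)
      have "a' j + t * a j \<le> (\<Sum>a\<in>arcs G. y a * of_bool (uses a (snd j))) - (z(x := z x + - t)) (fst j)" if "j \<in> I" for j
        using le'[OF that] 3 by (auto simp: le_def)
      moreover have "b' + t * b = (\<Sum>a\<in>arcs G. y a * cap a) - (\<Sum>i\<in>arcs H. (z(x := z x + - t)) i * 1)"
        using b' 3 sum_delta_add[OF finH 3(1), of z "- t" "\<lambda>_. 1"] by (simp add: le_def)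
      ultimately show ?thesis using y by (intro exI[of _ y] exI[of _ "z(x := z x + - t)"]) blast
    next
      case (4 e)
      have "a' j + t * a j \<le> (\<Sum>a\<in>arcs G. (y(e := y e + t)) a * of_bool (uses a (snd j))) - z (fst j)" if "j \<in> I" for j
        unfolding sum_delta_add[OF finG 4(1), of y t "\<lambda>a. of_bool (uses a (snd j))"]
        using le'[OF that] 4(2) by (auto simp: load_def)
      moreover have "b' + t * b = (\<Sum>a\<in>arcs G. (y(e := y e + t)) a * cap a) - (\<Sum>i\<in>arcs H. z i * 1)"
        unfolding sum_delta_add[OF finG 4(1), of y t cap] using b' 4(2) by (simp add: load_def)
      moreover have "\<forall>a\<in>arcs G. 0 \<le> (y(e := y e + t)) a" using y t 4(1) by simp
      ultimately show ?thesis by (intro exI[of _ "y(e := y e + t)"] exI[of _ z]) blast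
    qed
  qed
  have "\<exists>f. \<forall>(a, b)\<in>C. (\<Sum>i\<in>I. a i * f i) \<le> b"
  proof (rule farkas[OF finI finC])
    fix \<alpha> \<beta> assume "(\<alpha>, \<beta>) \<in> cone C" and \<alpha>: "\<And>i. i \<in> I \<Longrightarrow> \<alpha> i = 0"
    then obtain y z where y: "\<And>a. a \<in> arcs G \<Longrightarrow> 0 \<le> y a"
      and le': "\<And>j. j \<in> I \<Longrightarrow> \<alpha> j \<le> (\<Sum>a\<in>arcs G. y a * of_bool (uses a (snd j))) - z (fst j)"
      and \<beta>: "\<beta> = (\<Sum>a\<in>arcs G. y a * cap a) - (\<Sum>x\<in>arcs H. z x * 1)"
      using cert by blast
    have "z x \<le> (\<Sum>a | a \<in> arcs G \<and> (a \<in> set p \<or> arev a \<in> set p). y a)"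
      if "x \<in> arcs H" "p \<in> demand_paths G H x" for x p
    proof -
      have "(x, p) \<in> I" using that by (simp add: I_def)
      then have "z x \<le> (\<Sum>a\<in>arcs G. y a * of_bool (uses a p))" using le'[of "(x, p)"] \<alpha>[of "(x, p)"] by simp
      also have "\<dots> = (\<Sum>a\<in>arcs G. if a \<in> set p \<or> arev a \<in> set p then y a else 0)"
        by (rule sum.cong) (auto simp: uses_def)
      also have "\<dots> = (\<Sum>a | a \<in> arcs G \<and> (a \<in> set p \<or> arev a \<in> set p). y a)"
        by (simp only: sum.inter_filter[OF finG])
      finally show ?thesis .
    qed
    from dual[OF y this] show "0 \<le> \<beta>" using \<beta> by simp
  qed
  then obtain f where f: "\<And>a b. (a, b) \<in> C \<Longrightarrow> (\<Sum>i\<in>I. a i * f i) \<le> b" by blast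
  have sumI: "(\<Sum>i\<in>I. g i) = (\<Sum>x\<in>arcs H. \<Sum>p\<in>demand_paths G H x. g (x, p))" for g :: "'d \<times> 'b list \<Rightarrow> real"
    unfolding I_def using finH finP by (subst sum.Sigma) auto
  have only: "(\<Sum>i\<in>I. (if fst i = x then s else 0) * f i) = s * (\<Sum>p\<in>demand_paths G H x. f (x, p))"
    if x: "x \<in> arcs H" for x and s :: real
  proof -
    have "(\<Sum>i\<in>I. (if fst i = x then s else 0) * f i)
        = (\<Sum>x'\<in>arcs H. if x' = x then s * (\<Sum>p\<in>demand_paths G H x'. f (x', p)) else 0)"
      unfolding sumI by (rule sum.cong) (auto simp: sum_distrib_left)
    then show ?thesis using finH x by simp
  qed
  show ?thesis unfolding feasible_def
  proof (rule exI[of _ "\<lambda>x p. f (x, p)"], intro conjI ballI)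
    fix x p assume "x \<in> arcs H" "p \<in> demand_paths G H x"
    then have i: "(x, p) \<in> I" by (simp add: I_def)
    then have "(\<Sum>j\<in>I. (if j = (x, p) then - 1 else 0) * f j) \<le> 0"
      using f[of "\<lambda>j. if j = (x, p) then - 1 else 0" 0] by (force simp: C_def pos_def)
    moreover have "(\<Sum>j\<in>I. (if j = (x, p) then - 1 else 0) * f j) = (\<Sum>j\<in>I. if j = (x, p) then - f j else 0)"
      by (rule sum.cong) auto
    ultimately show "0 \<le> f (x, p)" using i finI by simp
  next
    fix x assume x: "x \<in> arcs H"
    have "(\<Sum>i\<in>I. (if fst i = x then - 1 else 0) * f i) \<le> - 1"
      using f[of "\<lambda>i. if fst i = x then - 1 else 0" "- 1"] x by (force simp: C_def ge_def)
    moreover have "(\<Sum>i\<in>I. (if fst i = x then 1 else 0) * f i) \<le> 1"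
      using f[of "\<lambda>i. if fst i = x then 1 else 0" 1] x by (force simp: C_def le_def)
    ultimately show "(\<Sum>p\<in>demand_paths G H x. f (x, p)) = 1"
      unfolding only[OF x] by simp
  next
    fix a assume a: "a \<in> arcs G"
    have "(\<Sum>x\<in>arcs H. \<Sum>p | p \<in> demand_paths G H x \<and> (a \<in> set p \<or> arev a \<in> set p). f (x, p))
        = (\<Sum>x\<in>arcs H. \<Sum>p\<in>demand_paths G H x. (if uses a p then 1 else 0) * f (x, p))"
    proof (rule sum.cong)
      fix x assume "x \<in> arcs H"
      then have "(\<Sum>p | p \<in> demand_paths G H x \<and> (a \<in> set p \<or> arev a \<in> set p). f (x, p))
          = (\<Sum>p\<in>demand_paths G H x. if a \<in> set p \<or> arev a \<in> set p then f (x, p) else 0)"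
        by (simp only: sum.inter_filter[OF finP])
      also have "\<dots> = (\<Sum>p\<in>demand_paths G H x. (if uses a p then 1 else 0) * f (x, p))"
        by (rule sum.cong) (auto simp: uses_def)
      finally show "(\<Sum>p | p \<in> demand_paths G H x \<and> (a \<in> set p \<or> arev a \<in> set p). f (x, p))
          = (\<Sum>p\<in>demand_paths G H x. (if uses a p then 1 else 0) * f (x, p))" .
    qed simp
    also have "\<dots> = (\<Sum>i\<in>I. (if uses a (snd i) then 1 else 0) * f i)" unfolding sumI by simp
    also have "\<dots> \<le> cap a"
      using f[of "\<lambda>i. if uses a (snd i) then 1 else 0" "cap a"] a by (force simp: C_def load_def)
    finally show "(\<Sum>x\<in>arcs H. \<Sum>p | p \<in> demand_paths G H x \<and> (a \<in> set p \<or> arev a \<in> set p). f (x, p)) \<le> cap a" .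
  qed
qed

theorem theorem4:
  fixes G :: "('a, 'b) pre_digraph" and arev rot :: "'b \<Rightarrow> 'b" and c :: "'b \<Rightarrow> nat"
    and H :: "('a, 'd) pre_digraph" and \<Phi> :: "'d \<Rightarrow> 'b set"
  assumes "plane_graph G arev rot"
    and "\<And>a. a \<in> arcs G \<Longrightarrow> c (arev a) = c a"
    and "fin_digraph H" and "verts H = verts G"
    and "separable_face_instance G arev rot H \<Phi>"
    and "cut_condition G c H"
  shows "feasible G arev (scaled_capacity 3 c) H \<and> flow_cut_gap G arev c H \<le> 3"
proof -
  interpret plane_graph G arev rot by (rule assms(1))
  have finH: "finite (arcs H)" using assms(3) by (rule fin_digraph.finite_arcs)
  have feas: "feasible G arev (scaled_capacity 3 c) H"
  proof (rule feasibleI)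
    show "finite (demand_paths G H x)" for x unfolding demand_paths_def by (rule apaths_finite)
    fix y :: "'b \<Rightarrow> real" and z :: "'d \<Rightarrow> real"
    assume y: "\<And>a. a \<in> arcs G \<Longrightarrow> 0 \<le> y a"
      and z: "\<And>x p. x \<in> arcs H \<Longrightarrow> p \<in> demand_paths G H x \<Longrightarrow>
         z x \<le> (\<Sum>a | a \<in> arcs G \<and> (a \<in> set p \<or> arev a \<in> set p). y a)"
    \<comment> \<open>The load of an edge is bounded once for each of its two arcs, so using the
      edge costs both multipliers.\<close>
    interpret W: weighted_plane_graph G arev rot "\<lambda>a. y a + y (arev a)"
      by unfold_locales (use y in auto)
    have main: "(\<Sum>x\<in>arcs H. W.dist (tail H x) (head H x)) \<le> 3 * (\<Sum>e\<in>edges. real (c e) * (y e + y (arev e)))"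
      by (rule W.sum_dist_demands_le[OF _ finH assms(5,6)]) (rule assms(2))
    have conn: "\<exists>p. awalk (tail H x) p (head H x)" if "x \<in> arcs H" for x
      by (rule demand_connected[OF assms(5) that])
    have "z x \<le> W.dist (tail H x) (head H x)" if x: "x \<in> arcs H" for x
    proof -
      obtain q where "awalk (tail H x) q (head H x)" using conn[OF x] by blast
      then obtain p where p: "apath (tail H x) p (head H x)" "W.cost p = W.dist (tail H x) (head H x)"
        by (rule W.dist_attained)
      have pG: "set p \<subseteq> arcs G" by (rule W.cost_apath(2)[OF p(1)])
      have img: "sum y (arev ` set p) = (\<Sum>a\<in>set p. y (arev a))"
        by (subst sum.reindex) (auto simp: inj_on_arev)
      have "a \<in> set p \<union> arev ` set p" if "a \<in> set p \<or> arev a \<in> set p" for a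
        using that image_eqI[of a arev "arev a" "set p"] by auto
      then have "{a. a \<in> arcs G \<and> (a \<in> set p \<or> arev a \<in> set p)} \<subseteq> set p \<union> arev ` set p" by blast
      then have "(\<Sum>a | a \<in> arcs G \<and> (a \<in> set p \<or> arev a \<in> set p). y a) \<le> sum y (set p \<union> arev ` set p)"
        by (intro sum_mono2) (use pG y in auto)
      also have "\<dots> \<le> sum y (set p) + sum y (arev ` set p)"
        using sum.union_inter[of "set p" "arev ` set p" y] sum_nonneg[of "set p \<inter> arev ` set p" y] pG y
        by (auto simp: subset_iff)
      also have "\<dots> = W.cost p" using W.cost_apath(1)[OF p(1)] img by (simp add: sum.distrib)
      finally have "(\<Sum>a | a \<in> arcs G \<and> (a \<in> set p \<or> arev a \<in> set p). y a) \<le> W.cost p" .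
      moreover have "p \<in> demand_paths G H x" using p by (simp add: demand_paths_def)
      ultimately show ?thesis using z[OF x, of p] p(2) by simp
    qed
    then have "(\<Sum>x\<in>arcs H. z x) \<le> (\<Sum>x\<in>arcs H. W.dist (tail H x) (head H x))" by (rule sum_mono)
    also have "\<dots> \<le> 3 * (\<Sum>e\<in>edges. real (c e) * (y e + y (arev e)))" by (rule main)
    also have "\<dots> = (\<Sum>e\<in>edges. y e * scaled_capacity 3 c e + y (arev e) * scaled_capacity 3 c (arev e))"
      unfolding sum_distrib_left
      by (rule sum.cong) (use assms(2) in \<open>auto simp: scaled_capacity_def algebra_simps\<close>)
    also have "\<dots> = (\<Sum>a\<in>arcs G. y a * scaled_capacity 3 c a)"
      by (rule sum_arcs[symmetric])
    finally show "(\<Sum>x\<in>arcs H. z x) \<le> (\<Sum>a\<in>arcs G. y a * scaled_capacity 3 c a)" .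
  qed (use finH in auto)
  moreover have "flow_cut_gap G arev c H \<le> 3"
    unfolding flow_cut_gap_def by (rule cInf_lower) (use feas in \<open>auto intro!: bdd_belowI[of _ 1]\<close>)
  ultimately show ?thesis ..
qed

end
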